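(* Let $\mathcal{A}$ be an abelian Bénabou cosmos and let $\mathcal{C}$ be a small $\mathcal{A}$-category. Assume that $\mathcal{A}$ has enough projectives. Then $\mathrm{Mod}(\mathcal{C})$ has enough projectives. Moreover, a $\mathcal{C}$-module is projective if and only if it is a direct summand of a module of the form $\mathrm{Fr}(p_* )$ such that $p_c$ is a projective object of $\mathcal{A}$ for any object $c$ of $\mathcal{C}$.
   Context: A Bénabou cosmos is a complete and cocomplete symmetric closed monoidal category. A Bénabou cosmos $\mathcal{A}$ is called abelian if its underlying category is an abelian category satisfying (AB4) and (AB4* ), i.e. small coproducts, resp. products, of short exact sequences are short exact. A $\mathcal{C}$-module is an $\mathcal{A}$-functor $\mathcal{C}\to\mathcal{A}$; $\mathrm{Mod}(\mathcal{C})$ is the (abelian) ordinary category of $\mathcal{C}$-modules and $\mathcal{A}$-natural transformations. "Projective object" is meant in the ordinary sense in the underlying abelian categories. For a family $a_*=(a_c)_{c\in\mathrm{Ob}(\mathcal{C})}$ of objects of $\mathcal{A}$, the free module is $\mathrm{Fr}(a_* )=\coprod_{c}a_c\otimes\mathcal{C}(c,-)$; $\mathrm{Fr}$ is the left adjoint of the forgetful functor $\mathrm{Forg}$ sending a $\mathcal{C}$-module $M$ to the family $(Mc)_{c\in\mathrm{Ob}(\mathcal{C})}$. *)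

theory Defs
  imports "HOL-Library.FuncSet" "HOL-Algebra.Group"
begin

unbundle cardinal_syntax

section \<open>Ordinary categories\<close>

text \<open>
  Hom-sets are indexed by their end points and need not be disjoint; composition is a
  single operation on arrows, written in the order of function composition.
\<close>

record ('o, 'm) cat =
  Ob :: "'o set"
  Hom :: "'o \<Rightarrow> 'o \<Rightarrow> 'm set"
  idm :: "'o \<Rightarrow> 'm"
  Comp :: "'m \<Rightarrow> 'm \<Rightarrow> 'm"  (infixr "\<cdot>\<index>" 70)

locale category =
  fixes C :: "('o, 'm, 'x) cat_scheme" (structure)
  assumes id_in_hom: "X \<in> Ob C \<Longrightarrow> idm C X \<in> Hom C X X"
    and comp_in_hom: "\<lbrakk>X \<in> Ob C; Y \<in> Ob C; Z \<in> Ob C; f \<in> Hom C X Y; g \<in> Hom C Y Z\<rbrakk>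
      \<Longrightarrow> g \<cdot> f \<in> Hom C X Z"
    and id_left: "\<lbrakk>X \<in> Ob C; Y \<in> Ob C; f \<in> Hom C X Y\<rbrakk> \<Longrightarrow> idm C Y \<cdot> f = f"
    and id_right: "\<lbrakk>X \<in> Ob C; Y \<in> Ob C; f \<in> Hom C X Y\<rbrakk> \<Longrightarrow> f \<cdot> idm C X = f"
    and comp_assoc: "\<lbrakk>W \<in> Ob C; X \<in> Ob C; Y \<in> Ob C; Z \<in> Ob C;
        f \<in> Hom C W X; g \<in> Hom C X Y; h \<in> Hom C Y Z\<rbrakk> \<Longrightarrow> (h \<cdot> g) \<cdot> f = h \<cdot> (g \<cdot> f)"

context
  fixes C :: "('o, 'm, 'x) cat_scheme" (structure)
begin

definition inverse_arrows :: "'o \<Rightarrow> 'o \<Rightarrow> 'm \<Rightarrow> 'm \<Rightarrow> bool" where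
  "inverse_arrows X Y f g \<longleftrightarrow>
     f \<in> Hom C X Y \<and> g \<in> Hom C Y X \<and> g \<cdot> f = idm C X \<and> f \<cdot> g = idm C Y"

definition is_iso :: "'o \<Rightarrow> 'o \<Rightarrow> 'm \<Rightarrow> bool" where
  "is_iso X Y f \<longleftrightarrow> (\<exists>g. inverse_arrows X Y f g)"

definition inv_arrow :: "'o \<Rightarrow> 'o \<Rightarrow> 'm \<Rightarrow> 'm" where
  "inv_arrow X Y f = (THE g. inverse_arrows X Y f g)"

definition is_mono :: "'o \<Rightarrow> 'o \<Rightarrow> 'm \<Rightarrow> bool" where
  "is_mono X Y f \<longleftrightarrow> f \<in> Hom C X Y \<and>
     (\<forall>W\<in>Ob C. \<forall>u\<in>Hom C W X. \<forall>v\<in>Hom C W X. f \<cdot> u = f \<cdot> v \<longrightarrow> u = v)"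

definition is_epi :: "'o \<Rightarrow> 'o \<Rightarrow> 'm \<Rightarrow> bool" where
  "is_epi X Y f \<longleftrightarrow> f \<in> Hom C X Y \<and>
     (\<forall>Z\<in>Ob C. \<forall>u\<in>Hom C Y Z. \<forall>v\<in>Hom C Y Z. u \<cdot> f = v \<cdot> f \<longrightarrow> u = v)"

definition is_product :: "'i set \<Rightarrow> ('i \<Rightarrow> 'o) \<Rightarrow> 'o \<Rightarrow> ('i \<Rightarrow> 'm) \<Rightarrow> bool" where
  "is_product I X P pr \<longleftrightarrow> P \<in> Ob C \<and> (\<forall>i\<in>I. X i \<in> Ob C \<and> pr i \<in> Hom C P (X i)) \<and>
     (\<forall>Y\<in>Ob C. \<forall>f. (\<forall>i\<in>I. f i \<in> Hom C Y (X i)) \<longrightarrow>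
        (\<exists>!h. h \<in> Hom C Y P \<and> (\<forall>i\<in>I. pr i \<cdot> h = f i)))"

definition is_coproduct :: "'i set \<Rightarrow> ('i \<Rightarrow> 'o) \<Rightarrow> 'o \<Rightarrow> ('i \<Rightarrow> 'm) \<Rightarrow> bool" where
  "is_coproduct I X P inc \<longleftrightarrow> P \<in> Ob C \<and> (\<forall>i\<in>I. X i \<in> Ob C \<and> inc i \<in> Hom C (X i) P) \<and>
     (\<forall>Y\<in>Ob C. \<forall>f. (\<forall>i\<in>I. f i \<in> Hom C (X i) Y) \<longrightarrow>
        (\<exists>!h. h \<in> Hom C P Y \<and> (\<forall>i\<in>I. h \<cdot> inc i = f i)))"

definition zero_object :: "'o \<Rightarrow> bool" where
  "zero_object Z \<longleftrightarrow> Z \<in> Ob C \<and>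
     (\<forall>X\<in>Ob C. (\<exists>!f. f \<in> Hom C X Z) \<and> (\<exists>!f. f \<in> Hom C Z X))"

definition zero_arrow :: "'o \<Rightarrow> 'o \<Rightarrow> 'm \<Rightarrow> bool" where
  "zero_arrow X Y f \<longleftrightarrow>
     (\<exists>Z u v. zero_object Z \<and> u \<in> Hom C X Z \<and> v \<in> Hom C Z Y \<and> f = v \<cdot> u)"

definition is_kernel :: "'o \<Rightarrow> 'o \<Rightarrow> 'm \<Rightarrow> 'o \<Rightarrow> 'm \<Rightarrow> bool" where
  "is_kernel X Y f K k \<longleftrightarrow> K \<in> Ob C \<and> k \<in> Hom C K X \<and> zero_arrow K Y (f \<cdot> k) \<and>
     (\<forall>W\<in>Ob C. \<forall>u\<in>Hom C W X. zero_arrow W Y (f \<cdot> u) \<longrightarrow>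
        (\<exists>!h. h \<in> Hom C W K \<and> k \<cdot> h = u))"

definition is_cokernel :: "'o \<Rightarrow> 'o \<Rightarrow> 'm \<Rightarrow> 'o \<Rightarrow> 'm \<Rightarrow> bool" where
  "is_cokernel X Y f Q q \<longleftrightarrow> Q \<in> Ob C \<and> q \<in> Hom C Y Q \<and> zero_arrow X Q (q \<cdot> f) \<and>
     (\<forall>W\<in>Ob C. \<forall>u\<in>Hom C Y W. zero_arrow X W (u \<cdot> f) \<longrightarrow>
        (\<exists>!h. h \<in> Hom C Q W \<and> h \<cdot> q = u))"

text \<open>The sequence $0 \to X \to Y \to Z \to 0$ given by $f$ and $g$ is short exact.\<close>

definition short_exact :: "'o \<Rightarrow> 'o \<Rightarrow> 'o \<Rightarrow> 'm \<Rightarrow> 'm \<Rightarrow> bool" where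
  "short_exact X Y Z f g \<longleftrightarrow> X \<in> Ob C \<and> Y \<in> Ob C \<and> Z \<in> Ob C \<and>
     f \<in> Hom C X Y \<and> g \<in> Hom C Y Z \<and> is_kernel Y Z g X f \<and> is_cokernel X Y f Z g"

text \<open>The object $S$ is a direct sum of $X$ (index \<open>True\<close>) and $Y$ (index \<open>False\<close>).\<close>

definition is_biproduct :: "'o \<Rightarrow> 'o \<Rightarrow> 'o \<Rightarrow> (bool \<Rightarrow> 'm) \<Rightarrow> (bool \<Rightarrow> 'm) \<Rightarrow> bool" where
  "is_biproduct X Y S inc pr \<longleftrightarrow>
     is_coproduct UNIV (\<lambda>b. if b then X else Y) S inc \<and>
     is_product UNIV (\<lambda>b. if b then X else Y) S pr \<and>
     pr True \<cdot> inc True = idm C X \<and> pr False \<cdot> inc False = idm C Y \<and>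
     zero_arrow X Y (pr False \<cdot> inc True) \<and> zero_arrow Y X (pr True \<cdot> inc False)"

definition direct_summand :: "'o \<Rightarrow> 'o \<Rightarrow> bool" where
  "direct_summand X S \<longleftrightarrow> (\<exists>Y inc pr. is_biproduct X Y S inc pr)"

definition projective :: "'o \<Rightarrow> bool" where
  "projective P \<longleftrightarrow> P \<in> Ob C \<and>
     (\<forall>X\<in>Ob C. \<forall>Y\<in>Ob C. \<forall>e f. is_epi X Y e \<and> f \<in> Hom C P Y \<longrightarrow>
        (\<exists>g\<in>Hom C P X. e \<cdot> g = f))"

definition enough_projectives :: bool where
  "enough_projectives \<longleftrightarrow> (\<forall>X\<in>Ob C. \<exists>P e. projective P \<and> is_epi P X e)"

definition preadditive :: "('o \<Rightarrow> 'o \<Rightarrow> 'm \<Rightarrow> 'm \<Rightarrow> 'm) \<Rightarrow> ('o \<Rightarrow> 'o \<Rightarrow> 'm) \<Rightarrow> bool" where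
  "preadditive add zero \<longleftrightarrow>
     (\<forall>X\<in>Ob C. \<forall>Y\<in>Ob C.
        comm_group \<lparr>carrier = Hom C X Y, mult = add X Y, one = zero X Y\<rparr>) \<and>
     (\<forall>X\<in>Ob C. \<forall>Y\<in>Ob C. \<forall>Z\<in>Ob C.
        \<forall>f\<in>Hom C X Y. \<forall>f'\<in>Hom C X Y. \<forall>g\<in>Hom C Y Z. \<forall>g'\<in>Hom C Y Z.
          g \<cdot> add X Y f f' = add X Z (g \<cdot> f) (g \<cdot> f') \<and>
          add Y Z g g' \<cdot> f = add X Z (g \<cdot> f) (g' \<cdot> f))"

end

locale abelian_category = category +
  assumes ex_preadditive: "\<exists>add zero. preadditive C add zero"
    and ex_zero_object: "\<exists>Z. zero_object C Z"
    and ex_biproduct: "\<lbrakk>X \<in> Ob C; Y \<in> Ob C\<rbrakk> \<Longrightarrow> \<exists>S inc pr. is_biproduct C X Y S inc pr"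
    and ex_kernel: "\<lbrakk>X \<in> Ob C; Y \<in> Ob C; f \<in> Hom C X Y\<rbrakk> \<Longrightarrow> \<exists>K k. is_kernel C X Y f K k"
    and ex_cokernel: "\<lbrakk>X \<in> Ob C; Y \<in> Ob C; f \<in> Hom C X Y\<rbrakk> \<Longrightarrow> \<exists>Q q. is_cokernel C X Y f Q q"
    and mono_is_kernel: "\<lbrakk>X \<in> Ob C; Y \<in> Ob C; is_mono C X Y f\<rbrakk>
      \<Longrightarrow> \<exists>Z\<in>Ob C. \<exists>g\<in>Hom C Y Z. is_kernel C Y Z g X f"
    and epi_is_cokernel: "\<lbrakk>X \<in> Ob C; Y \<in> Ob C; is_epi C X Y f\<rbrakk>
      \<Longrightarrow> \<exists>W\<in>Ob C. \<exists>g\<in>Hom C W X. is_cokernel C W X g Y f"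


section \<open>Smallness, limits and colimits\<close>

text \<open>
  Smallness is relative to an infinite cardinal \<open>\<kappa>\<close>: a set is small if it has fewer than
  \<open>\<kappa>\<close> elements. For an inaccessible \<open>\<kappa>\<close> this is smallness with respect to a Grothendieck
  universe. Since every small set embeds into the field of \<open>\<kappa> :: 'u rel\<close>, letting the shapes
  of diagrams and the index sets below range over sets of elements of \<open>'u\<close> covers all small
  ones up to isomorphism.
\<close>

definition small :: "'u rel \<Rightarrow> 'a set \<Rightarrow> bool" where
  "small \<kappa> S \<longleftrightarrow> |S| <o \<kappa>"

definition small_category :: "'u rel \<Rightarrow> ('o, 'm, 'x) cat_scheme \<Rightarrow> bool" where
  "small_category \<kappa> J \<longleftrightarrow> category J \<and> small \<kappa> (Ob J) \<and>
     small \<kappa> (\<Union>i\<in>Ob J. \<Union>j\<in>Ob J. Hom J i j)"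

definition is_functor ::
  "('j, 'a, 'x) cat_scheme \<Rightarrow> ('o, 'm, 'y) cat_scheme \<Rightarrow> ('j \<Rightarrow> 'o) \<Rightarrow> ('a \<Rightarrow> 'm) \<Rightarrow> bool" where
  "is_functor J C D Dm \<longleftrightarrow>
     (\<forall>i\<in>Ob J. D i \<in> Ob C \<and> Dm (idm J i) = idm C (D i)) \<and>
     (\<forall>i\<in>Ob J. \<forall>j\<in>Ob J. \<forall>f\<in>Hom J i j. Dm f \<in> Hom C (D i) (D j)) \<and>
     (\<forall>i\<in>Ob J. \<forall>j\<in>Ob J. \<forall>k\<in>Ob J. \<forall>f\<in>Hom J i j. \<forall>g\<in>Hom J j k.
        Dm (g \<cdot>\<^bsub>J\<^esub> f) = Dm g \<cdot>\<^bsub>C\<^esub> Dm f)"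

definition is_cone :: "('j, 'a, 'x) cat_scheme \<Rightarrow> ('o, 'm, 'y) cat_scheme \<Rightarrow>
    ('j \<Rightarrow> 'o) \<Rightarrow> ('a \<Rightarrow> 'm) \<Rightarrow> 'o \<Rightarrow> ('j \<Rightarrow> 'm) \<Rightarrow> bool" where
  "is_cone J C D Dm L p \<longleftrightarrow> L \<in> Ob C \<and> (\<forall>i\<in>Ob J. p i \<in> Hom C L (D i)) \<and>
     (\<forall>i\<in>Ob J. \<forall>j\<in>Ob J. \<forall>f\<in>Hom J i j. Dm f \<cdot>\<^bsub>C\<^esub> p i = p j)"

definition is_cocone :: "('j, 'a, 'x) cat_scheme \<Rightarrow> ('o, 'm, 'y) cat_scheme \<Rightarrow>
    ('j \<Rightarrow> 'o) \<Rightarrow> ('a \<Rightarrow> 'm) \<Rightarrow> 'o \<Rightarrow> ('j \<Rightarrow> 'm) \<Rightarrow> bool" where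
  "is_cocone J C D Dm L q \<longleftrightarrow> L \<in> Ob C \<and> (\<forall>i\<in>Ob J. q i \<in> Hom C (D i) L) \<and>
     (\<forall>i\<in>Ob J. \<forall>j\<in>Ob J. \<forall>f\<in>Hom J i j. q j \<cdot>\<^bsub>C\<^esub> Dm f = q i)"

definition is_limit :: "('j, 'a, 'x) cat_scheme \<Rightarrow> ('o, 'm, 'y) cat_scheme \<Rightarrow>
    ('j \<Rightarrow> 'o) \<Rightarrow> ('a \<Rightarrow> 'm) \<Rightarrow> 'o \<Rightarrow> ('j \<Rightarrow> 'm) \<Rightarrow> bool" where
  "is_limit J C D Dm L p \<longleftrightarrow> is_cone J C D Dm L p \<and>
     (\<forall>X f. is_cone J C D Dm X f \<longrightarrow>
        (\<exists>!h. h \<in> Hom C X L \<and> (\<forall>i\<in>Ob J. p i \<cdot>\<^bsub>C\<^esub> h = f i)))"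

definition is_colimit :: "('j, 'a, 'x) cat_scheme \<Rightarrow> ('o, 'm, 'y) cat_scheme \<Rightarrow>
    ('j \<Rightarrow> 'o) \<Rightarrow> ('a \<Rightarrow> 'm) \<Rightarrow> 'o \<Rightarrow> ('j \<Rightarrow> 'm) \<Rightarrow> bool" where
  "is_colimit J C D Dm L q \<longleftrightarrow> is_cocone J C D Dm L q \<and>
     (\<forall>X f. is_cocone J C D Dm X f \<longrightarrow>
        (\<exists>!h. h \<in> Hom C L X \<and> (\<forall>i\<in>Ob J. h \<cdot>\<^bsub>C\<^esub> q i = f i)))"

definition complete :: "'u rel \<Rightarrow> ('o, 'm, 'x) cat_scheme \<Rightarrow> bool" where
  "complete \<kappa> C \<longleftrightarrow>
     (\<forall>(J :: ('u, 'u) cat) D Dm. small_category \<kappa> J \<and> is_functor J C D Dm \<longrightarrow>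
        (\<exists>L p. is_limit J C D Dm L p))"

definition cocomplete :: "'u rel \<Rightarrow> ('o, 'm, 'x) cat_scheme \<Rightarrow> bool" where
  "cocomplete \<kappa> C \<longleftrightarrow>
     (\<forall>(J :: ('u, 'u) cat) D Dm. small_category \<kappa> J \<and> is_functor J C D Dm \<longrightarrow>
        (\<exists>L q. is_colimit J C D Dm L q))"

definition AB4 :: "'u rel \<Rightarrow> ('o, 'm, 'x) cat_scheme \<Rightarrow> bool" where
  "AB4 \<kappa> C \<longleftrightarrow>
     (\<forall>(I :: 'u set) X Y Z f g SX SY SZ iX iY iZ F G.
        small \<kappa> I \<and> (\<forall>i\<in>I. short_exact C (X i) (Y i) (Z i) (f i) (g i)) \<and>
        is_coproduct C I X SX iX \<and> is_coproduct C I Y SY iY \<and> is_coproduct C I Z SZ iZ \<and>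
        F \<in> Hom C SX SY \<and> (\<forall>i\<in>I. F \<cdot>\<^bsub>C\<^esub> iX i = iY i \<cdot>\<^bsub>C\<^esub> f i) \<and>
        G \<in> Hom C SY SZ \<and> (\<forall>i\<in>I. G \<cdot>\<^bsub>C\<^esub> iY i = iZ i \<cdot>\<^bsub>C\<^esub> g i)
        \<longrightarrow> short_exact C SX SY SZ F G)"

definition AB4_star :: "'u rel \<Rightarrow> ('o, 'm, 'x) cat_scheme \<Rightarrow> bool" where
  "AB4_star \<kappa> C \<longleftrightarrow>
     (\<forall>(I :: 'u set) X Y Z f g PX PY PZ pX pY pZ F G.
        small \<kappa> I \<and> (\<forall>i\<in>I. short_exact C (X i) (Y i) (Z i) (f i) (g i)) \<and>
        is_product C I X PX pX \<and> is_product C I Y PY pY \<and> is_product C I Z PZ pZ \<and>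
        F \<in> Hom C PX PY \<and> (\<forall>i\<in>I. pY i \<cdot>\<^bsub>C\<^esub> F = f i \<cdot>\<^bsub>C\<^esub> pX i) \<and>
        G \<in> Hom C PY PZ \<and> (\<forall>i\<in>I. pZ i \<cdot>\<^bsub>C\<^esub> G = g i \<cdot>\<^bsub>C\<^esub> pY i)
        \<longrightarrow> short_exact C PX PY PZ F G)"


section \<open>Symmetric monoidal closed categories and cosmoi\<close>

text \<open>
  \<open>ihom A Y Z\<close> is the internal hom $[Y, Z]$ and \<open>ev A Y Z\<close> the evaluation
  $[Y, Z] \otimes Y \to Z$.
\<close>

record ('o, 'm) smc_cat = "('o, 'm) cat" +
  tensor_ob :: "'o \<Rightarrow> 'o \<Rightarrow> 'o"  (infixr "\<otimes>\<^sub>o\<index>" 75)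
  tensor_arr :: "'m \<Rightarrow> 'm \<Rightarrow> 'm"  (infixr "\<otimes>\<^sub>a\<index>" 75)
  unit :: "'o"
  assoc :: "'o \<Rightarrow> 'o \<Rightarrow> 'o \<Rightarrow> 'm"
  lunit :: "'o \<Rightarrow> 'm"
  runit :: "'o \<Rightarrow> 'm"
  braid :: "'o \<Rightarrow> 'o \<Rightarrow> 'm"
  ihom :: "'o \<Rightarrow> 'o \<Rightarrow> 'o"
  ev :: "'o \<Rightarrow> 'o \<Rightarrow> 'm"

locale symmetric_monoidal_category = category A
  for A :: "('o, 'm, 'x) smc_cat_scheme" (structure) +
  assumes tensor_ob: "\<lbrakk>X \<in> Ob A; Y \<in> Ob A\<rbrakk> \<Longrightarrow> X \<otimes>\<^sub>o Y \<in> Ob A"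
    and tensor_in_hom: "\<lbrakk>X \<in> Ob A; X' \<in> Ob A; Y \<in> Ob A; Y' \<in> Ob A; f \<in> Hom A X X'; g \<in> Hom A Y Y'\<rbrakk>
      \<Longrightarrow> f \<otimes>\<^sub>a g \<in> Hom A (X \<otimes>\<^sub>o Y) (X' \<otimes>\<^sub>o Y')"
    and tensor_id: "\<lbrakk>X \<in> Ob A; Y \<in> Ob A\<rbrakk> \<Longrightarrow> idm A X \<otimes>\<^sub>a idm A Y = idm A (X \<otimes>\<^sub>o Y)"
    and tensor_comp: "\<lbrakk>X \<in> Ob A; X' \<in> Ob A; X'' \<in> Ob A; Y \<in> Ob A; Y' \<in> Ob A; Y'' \<in> Ob A;
        f \<in> Hom A X X'; f' \<in> Hom A X' X''; g \<in> Hom A Y Y'; g' \<in> Hom A Y' Y''\<rbrakk>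
      \<Longrightarrow> (f' \<cdot> f) \<otimes>\<^sub>a (g' \<cdot> g) = (f' \<otimes>\<^sub>a g') \<cdot> (f \<otimes>\<^sub>a g)"
    and unit_ob: "unit A \<in> Ob A"
    and assoc_iso: "\<lbrakk>X \<in> Ob A; Y \<in> Ob A; Z \<in> Ob A\<rbrakk>
      \<Longrightarrow> is_iso A ((X \<otimes>\<^sub>o Y) \<otimes>\<^sub>o Z) (X \<otimes>\<^sub>o (Y \<otimes>\<^sub>o Z)) (assoc A X Y Z)"
    and assoc_natural: "\<lbrakk>X \<in> Ob A; X' \<in> Ob A; Y \<in> Ob A; Y' \<in> Ob A; Z \<in> Ob A; Z' \<in> Ob A;
        f \<in> Hom A X X'; g \<in> Hom A Y Y'; h \<in> Hom A Z Z'\<rbrakk>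
      \<Longrightarrow> assoc A X' Y' Z' \<cdot> ((f \<otimes>\<^sub>a g) \<otimes>\<^sub>a h) = (f \<otimes>\<^sub>a (g \<otimes>\<^sub>a h)) \<cdot> assoc A X Y Z"
    and lunit_iso: "X \<in> Ob A \<Longrightarrow> is_iso A (unit A \<otimes>\<^sub>o X) X (lunit A X)"
    and lunit_natural: "\<lbrakk>X \<in> Ob A; Y \<in> Ob A; f \<in> Hom A X Y\<rbrakk>
      \<Longrightarrow> lunit A Y \<cdot> (idm A (unit A) \<otimes>\<^sub>a f) = f \<cdot> lunit A X"
    and runit_iso: "X \<in> Ob A \<Longrightarrow> is_iso A (X \<otimes>\<^sub>o unit A) X (runit A X)"
    and runit_natural: "\<lbrakk>X \<in> Ob A; Y \<in> Ob A; f \<in> Hom A X Y\<rbrakk>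
      \<Longrightarrow> runit A Y \<cdot> (f \<otimes>\<^sub>a idm A (unit A)) = f \<cdot> runit A X"
    and triangle: "\<lbrakk>X \<in> Ob A; Y \<in> Ob A\<rbrakk>
      \<Longrightarrow> (idm A X \<otimes>\<^sub>a lunit A Y) \<cdot> assoc A X (unit A) Y = runit A X \<otimes>\<^sub>a idm A Y"
    and pentagon: "\<lbrakk>W \<in> Ob A; X \<in> Ob A; Y \<in> Ob A; Z \<in> Ob A\<rbrakk>
      \<Longrightarrow> assoc A W X (Y \<otimes>\<^sub>o Z) \<cdot> assoc A (W \<otimes>\<^sub>o X) Y Z =
        (idm A W \<otimes>\<^sub>a assoc A X Y Z) \<cdot> assoc A W (X \<otimes>\<^sub>o Y) Z \<cdot> (assoc A W X Y \<otimes>\<^sub>a idm A Z)"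
    and braid_in_hom: "\<lbrakk>X \<in> Ob A; Y \<in> Ob A\<rbrakk> \<Longrightarrow> braid A X Y \<in> Hom A (X \<otimes>\<^sub>o Y) (Y \<otimes>\<^sub>o X)"
    and braid_natural: "\<lbrakk>X \<in> Ob A; X' \<in> Ob A; Y \<in> Ob A; Y' \<in> Ob A; f \<in> Hom A X X'; g \<in> Hom A Y Y'\<rbrakk>
      \<Longrightarrow> braid A X' Y' \<cdot> (f \<otimes>\<^sub>a g) = (g \<otimes>\<^sub>a f) \<cdot> braid A X Y"
    and symmetry: "\<lbrakk>X \<in> Ob A; Y \<in> Ob A\<rbrakk> \<Longrightarrow> braid A Y X \<cdot> braid A X Y = idm A (X \<otimes>\<^sub>o Y)"
    and hexagon: "\<lbrakk>X \<in> Ob A; Y \<in> Ob A; Z \<in> Ob A\<rbrakk>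
      \<Longrightarrow> assoc A Y Z X \<cdot> braid A X (Y \<otimes>\<^sub>o Z) \<cdot> assoc A X Y Z =
        (idm A Y \<otimes>\<^sub>a braid A X Z) \<cdot> assoc A Y X Z \<cdot> (braid A X Y \<otimes>\<^sub>a idm A Z)"

locale symmetric_monoidal_closed_category = symmetric_monoidal_category +
  assumes ihom_ob: "\<lbrakk>Y \<in> Ob A; Z \<in> Ob A\<rbrakk> \<Longrightarrow> ihom A Y Z \<in> Ob A"
    and ev_in_hom: "\<lbrakk>Y \<in> Ob A; Z \<in> Ob A\<rbrakk> \<Longrightarrow> ev A Y Z \<in> Hom A (ihom A Y Z \<otimes>\<^sub>o Y) Z"
    and ev_universal: "\<lbrakk>X \<in> Ob A; Y \<in> Ob A; Z \<in> Ob A; f \<in> Hom A (X \<otimes>\<^sub>o Y) Z\<rbrakk>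
      \<Longrightarrow> \<exists>!g. g \<in> Hom A X (ihom A Y Z) \<and> ev A Y Z \<cdot> (g \<otimes>\<^sub>a idm A Y) = f"

definition benabou_cosmos :: "'u rel \<Rightarrow> ('o, 'm, 'x) smc_cat_scheme \<Rightarrow> bool" where
  "benabou_cosmos \<kappa> A \<longleftrightarrow>
     symmetric_monoidal_closed_category A \<and> complete \<kappa> A \<and> cocomplete \<kappa> A"

definition abelian_benabou_cosmos :: "'u rel \<Rightarrow> ('o, 'm, 'x) smc_cat_scheme \<Rightarrow> bool" where
  "abelian_benabou_cosmos \<kappa> A \<longleftrightarrow>
     benabou_cosmos \<kappa> A \<and> abelian_category A \<and> AB4 \<kappa> A \<and> AB4_star \<kappa> A"


section \<open>Enriched categories\<close>

text \<open>
  \<open>eid C a\<close> is the unit $I \to C(a,a)$ and \<open>ecomp C a b c\<close> the composition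
  $C(b,c) \otimes C(a,b) \to C(a,c)$.
\<close>

record ('c, 'o, 'm) enr_cat =
  EOb :: "'c set"
  EHom :: "'c \<Rightarrow> 'c \<Rightarrow> 'o"
  eid :: "'c \<Rightarrow> 'm"
  ecomp :: "'c \<Rightarrow> 'c \<Rightarrow> 'c \<Rightarrow> 'm"

record ('c, 'd, 'm) enr_functor =
  fob :: "'c \<Rightarrow> 'd"
  fhom :: "'c \<Rightarrow> 'c \<Rightarrow> 'm"

locale enriched_category =
  fixes A :: "('o, 'm, 'x) smc_cat_scheme" (structure)
    and C :: "('c, 'o, 'm, 'y) enr_cat_scheme"
  assumes ehom_ob: "\<lbrakk>a \<in> EOb C; b \<in> EOb C\<rbrakk> \<Longrightarrow> EHom C a b \<in> Ob A"
    and eid_in_hom: "a \<in> EOb C \<Longrightarrow> eid C a \<in> Hom A (unit A) (EHom C a a)"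
    and ecomp_in_hom: "\<lbrakk>a \<in> EOb C; b \<in> EOb C; c \<in> EOb C\<rbrakk>
      \<Longrightarrow> ecomp C a b c \<in> Hom A (EHom C b c \<otimes>\<^sub>o EHom C a b) (EHom C a c)"
    and ecomp_assoc: "\<lbrakk>a \<in> EOb C; b \<in> EOb C; c \<in> EOb C; d \<in> EOb C\<rbrakk>
      \<Longrightarrow> ecomp C a b d \<cdot> (ecomp C b c d \<otimes>\<^sub>a idm A (EHom C a b)) =
        ecomp C a c d \<cdot> (idm A (EHom C c d) \<otimes>\<^sub>a ecomp C a b c) \<cdot>
          assoc A (EHom C c d) (EHom C b c) (EHom C a b)"
    and eid_left: "\<lbrakk>a \<in> EOb C; b \<in> EOb C\<rbrakk>
      \<Longrightarrow> ecomp C a b b \<cdot> (eid C b \<otimes>\<^sub>a idm A (EHom C a b)) = lunit A (EHom C a b)"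
    and eid_right: "\<lbrakk>a \<in> EOb C; b \<in> EOb C\<rbrakk>
      \<Longrightarrow> ecomp C a a b \<cdot> (idm A (EHom C a b) \<otimes>\<^sub>a eid C a) = runit A (EHom C a b)"

definition small_enriched_category ::
  "'u rel \<Rightarrow> ('o, 'm, 'x) smc_cat_scheme \<Rightarrow> ('c, 'o, 'm, 'y) enr_cat_scheme \<Rightarrow> bool" where
  "small_enriched_category \<kappa> A C \<longleftrightarrow> enriched_category A C \<and> small \<kappa> (EOb C)"

context
  fixes A :: "('o, 'm, 'x) smc_cat_scheme" (structure)
begin

definition enriched_functor :: "('c, 'o, 'm, 'y) enr_cat_scheme \<Rightarrow>
    ('d, 'o, 'm, 'z) enr_cat_scheme \<Rightarrow> ('c, 'd, 'm) enr_functor \<Rightarrow> bool" where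
  "enriched_functor C D F \<longleftrightarrow>
     fob F \<in> EOb C \<rightarrow>\<^sub>E EOb D \<and>
     fhom F \<in> (\<Pi>\<^sub>E a\<in>EOb C. \<Pi>\<^sub>E b\<in>EOb C. Hom A (EHom C a b) (EHom D (fob F a) (fob F b))) \<and>
     (\<forall>a\<in>EOb C. fhom F a a \<cdot> eid C a = eid D (fob F a)) \<and>
     (\<forall>a\<in>EOb C. \<forall>b\<in>EOb C. \<forall>c\<in>EOb C.
        fhom F a c \<cdot> ecomp C a b c =
        ecomp D (fob F a) (fob F b) (fob F c) \<cdot> (fhom F b c \<otimes>\<^sub>a fhom F a b))"

definition enriched_natural :: "('c, 'o, 'm, 'y) enr_cat_scheme \<Rightarrow>
    ('d, 'o, 'm, 'z) enr_cat_scheme \<Rightarrow> ('c, 'd, 'm) enr_functor \<Rightarrow> ('c, 'd, 'm) enr_functor \<Rightarrow>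
    ('c \<Rightarrow> 'm) \<Rightarrow> bool" where
  "enriched_natural C D F G t \<longleftrightarrow>
     (\<forall>a\<in>EOb C. t a \<in> Hom A (unit A) (EHom D (fob F a) (fob G a))) \<and>
     (\<forall>a\<in>EOb C. \<forall>b\<in>EOb C.
        ecomp D (fob F a) (fob F b) (fob G b) \<cdot> (t b \<otimes>\<^sub>a fhom F a b) \<cdot>
          inv_arrow A (unit A \<otimes>\<^sub>o EHom C a b) (EHom C a b) (lunit A (EHom C a b)) =
        ecomp D (fob F a) (fob G a) (fob G b) \<cdot> (fhom G a b \<otimes>\<^sub>a t a) \<cdot>
          inv_arrow A (EHom C a b \<otimes>\<^sub>o unit A) (EHom C a b) (runit A (EHom C a b)))"

text \<open>The transpose $X \to [Y, Z]$ of $f : X \otimes Y \to Z$.\<close>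

definition transpose_arr :: "'o \<Rightarrow> 'o \<Rightarrow> 'o \<Rightarrow> 'm \<Rightarrow> 'm" where
  "transpose_arr X Y Z f = (THE g. g \<in> Hom A X (ihom A Y Z) \<and> ev A Y Z \<cdot> (g \<otimes>\<^sub>a idm A Y) = f)"

text \<open>The category \<open>A\<close>, enriched over itself by means of the internal hom.\<close>

definition self_enriched :: "('o, 'o, 'm) enr_cat" where
  "self_enriched = \<lparr>
     EOb = Ob A,
     EHom = ihom A,
     eid = (\<lambda>X. transpose_arr (unit A) X X (lunit A X)),
     ecomp = (\<lambda>X Y Z. transpose_arr (ihom A Y Z \<otimes>\<^sub>o ihom A X Y) X Z
       (ev A Y Z \<cdot> (idm A (ihom A Y Z) \<otimes>\<^sub>a ev A X Y) \<cdot> assoc A (ihom A Y Z) (ihom A X Y) X))\<rparr>"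

text \<open>The arrow $I \to [X, Y]$ corresponding to $f : X \to Y$.\<close>

definition name_arrow :: "'o \<Rightarrow> 'o \<Rightarrow> 'm \<Rightarrow> 'm" where
  "name_arrow X Y f = transpose_arr (unit A) X Y (f \<cdot> lunit A X)"


section \<open>Modules\<close>

text \<open>
  A natural transformation between modules, whose components are arrows $I \to [M c, N c]$, is
  represented by the corresponding family of arrows $M c \to N c$, so that composition is
  componentwise composition in \<open>A\<close>.
\<close>

definition ModCat :: "('c, 'o, 'm, 'y) enr_cat_scheme \<Rightarrow> (('c, 'o, 'm) enr_functor, 'c \<Rightarrow> 'm) cat" where
  "ModCat C = \<lparr>
     Ob = {M. enriched_functor C self_enriched M},
     Hom = (\<lambda>M N. {t \<in> (\<Pi>\<^sub>E c\<in>EOb C. Hom A (fob M c) (fob N c)).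
       enriched_natural C self_enriched M N (\<lambda>c. name_arrow (fob M c) (fob N c) (t c))}),
     idm = (\<lambda>M. \<lambda>c\<in>EOb C. idm A (fob M c)),
     Comp = (\<lambda>s t. \<lambda>c\<in>EOb C. s c \<cdot> t c)\<rparr>"

text \<open>
  The module $x \otimes C(c,-)$. Its action $C(d,e) \to [x \otimes C(c,d), x \otimes C(c,e)]$ is
  the transpose of the composite
  $C(d,e) \otimes (x \otimes C(c,d)) \cong x \otimes (C(d,e) \otimes C(c,d)) \to x \otimes C(c,e)$.
\<close>

definition tensor_rep_action ::
  "('c, 'o, 'm, 'y) enr_cat_scheme \<Rightarrow> 'o \<Rightarrow> 'c \<Rightarrow> 'c \<Rightarrow> 'c \<Rightarrow> 'm" where
  "tensor_rep_action C x c d e =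
     (idm A x \<otimes>\<^sub>a ecomp C c d e) \<cdot>
     assoc A x (EHom C d e) (EHom C c d) \<cdot>
     (braid A (EHom C d e) x \<otimes>\<^sub>a idm A (EHom C c d)) \<cdot>
     inv_arrow A ((EHom C d e \<otimes>\<^sub>o x) \<otimes>\<^sub>o EHom C c d) (EHom C d e \<otimes>\<^sub>o (x \<otimes>\<^sub>o EHom C c d))
       (assoc A (EHom C d e) x (EHom C c d))"

definition tensor_rep ::
  "('c, 'o, 'm, 'y) enr_cat_scheme \<Rightarrow> 'o \<Rightarrow> 'c \<Rightarrow> ('c, 'o, 'm) enr_functor" where
  "tensor_rep C x c = \<lparr>
     fob = (\<lambda>d\<in>EOb C. x \<otimes>\<^sub>o EHom C c d),
     fhom = (\<lambda>d\<in>EOb C. \<lambda>e\<in>EOb C.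
       transpose_arr (EHom C d e) (x \<otimes>\<^sub>o EHom C c d) (x \<otimes>\<^sub>o EHom C c e)
         (tensor_rep_action C x c d e))\<rparr>"

text \<open>
  \<open>F\<close> is $\mathrm{Fr}(x_*) = \coprod_c x_c \otimes C(c,-)$; like any coproduct, it is
  determined up to isomorphism only.
\<close>

definition is_Fr ::
  "('c, 'o, 'm, 'y) enr_cat_scheme \<Rightarrow> ('c \<Rightarrow> 'o) \<Rightarrow> ('c, 'o, 'm) enr_functor \<Rightarrow> bool" where
  "is_Fr C x F \<longleftrightarrow>
     (\<exists>inc. is_coproduct (ModCat C) (EOb C) (\<lambda>c. tensor_rep C (x c) c) F inc)"

end

end

theory Submission imports Defs begin

text \<open>
  A module is the same as a family of actions $C(a,b) \otimes M a \to M b$, and the free module on $x$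
  at $c$ represents $M \mapsto \mathrm{Hom}(x, M c)$. Tensoring with an object has a right adjoint, so it
  preserves coproducts and cokernels, is additive, and coproducts and cokernels of modules
  exist and are computed componentwise. In particular an epimorphism of modules is epi in every
  component; hence $x \otimes C(c,-)$ is projective if $x$ is, and so are coproducts of such modules.
  Conversely, epimorphisms $p_c \to M c$ induce an epimorphism $\mathrm{Fr}(p_*) \to M$, which splits
  if $M$ is projective.
\<close>

section \<open>Arrows with end points and monoidal coherence\<close>

text \<open>In the definitions a module maps hom-objects into internal homs, and a natural
  transformation is a family of arrows out of the unit. Colimits are hard to reach in that form, so
  everything is transposed once and for all to arrows C(a,b) \<otimes> M a -> M b. The price is
  coherence: the action on x \<otimes> C(c,-) contains a braiding, and its module laws need
  consequences of the triangle, pentagon and hexagon that have to be derived from the axioms.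

  Epimorphisms are componentwise because cokernels are: if q is the cokernel of an epimorphism e,
  then q e = 0 = 0 e forces q = 0, so every component of e has zero cokernel. A direct summand has
  to be half of a full biproduct, so splitting M off a free module requires a complementary module.
  It is again a cokernel, that of the section s, and additivity of B \<otimes> - is what makes the
  complementary idempotent 1 - s e natural.\<close>

text \<open>Hom-sets need not be disjoint, so an arrow is bundled with its end points; the side conditions of
  associativity then become equations between end points that the simplifier can decide.\<close>

datatype ('o, 'm) arrow = Arrow (src: 'o) (tgt: 'o) (lab: 'm)

section \<open>Calculus of bundled arrows and their inverses\<close>

context category
begin

definition arr :: "('o, 'm) arrow \<Rightarrow> bool" where
  "arr f \<longleftrightarrow> src f \<in> Ob C \<and> tgt f \<in> Ob C \<and> lab f \<in> Hom C (src f) (tgt f)"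

text \<open>Total on all pairs: the end points are the outer ones, and composability is left to the
  side conditions of each law.\<close>

definition cmp :: "('o, 'm) arrow \<Rightarrow> ('o, 'm) arrow \<Rightarrow> ('o, 'm) arrow"  (infixr "\<bullet>" 70) where
  "g \<bullet> f = Arrow (src f) (tgt g) (lab g \<cdot> lab f)"

definition Idt :: "'o \<Rightarrow> ('o, 'm) arrow" where
  "Idt X = Arrow X X (idm C X)"

abbreviation in_hom :: "('o, 'm) arrow \<Rightarrow> 'o \<Rightarrow> 'o \<Rightarrow> bool"  ("\<guillemotleft>_ : _ \<rightarrow> _\<guillemotright>") where
  "\<guillemotleft>f : X \<rightarrow> Y\<guillemotright> \<equiv> arr f \<and> src f = X \<and> tgt f = Y"

lemma src_cmp [simp]: "src (g \<bullet> f) = src f"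
  and tgt_cmp [simp]: "tgt (g \<bullet> f) = tgt g"
  and lab_cmp [simp]: "lab (g \<bullet> f) = lab g \<cdot> lab f"
  by (simp_all add: cmp_def)

lemma src_Idt [simp]: "src (Idt X) = X"
  and tgt_Idt [simp]: "tgt (Idt X) = X"
  and lab_Idt [simp]: "lab (Idt X) = idm C X"
  by (simp_all add: Idt_def)

lemma arr_Arrow [simp]:
  "arr (Arrow X Y f) \<longleftrightarrow> X \<in> Ob C \<and> Y \<in> Ob C \<and> f \<in> Hom C X Y"
  by (simp add: arr_def)

lemma arr_Idt [simp]: "X \<in> Ob C \<Longrightarrow> arr (Idt X)"
  by (simp add: arr_def id_in_hom)

lemma arr_cmp [simp]: "\<lbrakk>arr f; arr g; src g = tgt f\<rbrakk> \<Longrightarrow> arr (g \<bullet> f)"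
  using comp_in_hom[of "src f" "tgt f" "tgt g" "lab f" "lab g"] by (simp add: arr_def)

lemma arr_src [simp]: "arr f \<Longrightarrow> src f \<in> Ob C"
  and arr_tgt [simp]: "arr f \<Longrightarrow> tgt f \<in> Ob C"
  by (simp_all add: arr_def)

lemma arr_lab [simp]: "\<lbrakk>arr f; src f = X; tgt f = Y\<rbrakk> \<Longrightarrow> lab f \<in> Hom C X Y"
  by (auto simp: arr_def)

lemma arrow_eqI: "\<lbrakk>src f = src g; tgt f = tgt g; lab f = lab g\<rbrakk> \<Longrightarrow> f = g"
  by (cases f; cases g) simp

lemma Idt_cmp [simp]: "\<lbrakk>arr f; tgt f = X\<rbrakk> \<Longrightarrow> Idt X \<bullet> f = f"
  by (rule arrow_eqI) (auto simp: id_left[of "src f" "tgt f" "lab f"])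

lemma cmp_Idt [simp]: "\<lbrakk>arr f; src f = X\<rbrakk> \<Longrightarrow> f \<bullet> Idt X = f"
  by (rule arrow_eqI) (auto simp: id_right[of "src f" "tgt f" "lab f"])

lemma cmp_assoc [simp]:
  "\<lbrakk>arr f; arr g; arr h; src g = tgt f; src h = tgt g\<rbrakk> \<Longrightarrow> (h \<bullet> g) \<bullet> f = h \<bullet> (g \<bullet> f)"
  by (rule arrow_eqI) (simp_all add: comp_assoc[of "src f" "tgt f" "tgt g" "tgt h" "lab f" "lab g" "lab h"])

lemma cmp_Arrow: "Arrow Y Z g \<bullet> Arrow X Y f = Arrow X Z (g \<cdot> f)"
  by (simp add: cmp_def)

lemma inverse_arrows_unique:
  assumes "X \<in> Ob C" "Y \<in> Ob C" "inverse_arrows C X Y f g" "inverse_arrows C X Y f g'"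
  shows "g = g'"
proof -
  have "g = (g' \<cdot> f) \<cdot> g"
    using assms by (simp add: inverse_arrows_def id_left)
  also have "\<dots> = g' \<cdot> (f \<cdot> g)"
    using assms by (intro comp_assoc[of Y X Y X]) (auto simp: inverse_arrows_def)
  also have "\<dots> = g'"
    using assms by (simp add: inverse_arrows_def id_right)
  finally show ?thesis .
qed

lemma inverse_arrows_inv_arrow:
  assumes "X \<in> Ob C" "Y \<in> Ob C" "is_iso C X Y f"
  shows "inverse_arrows C X Y f (inv_arrow C X Y f)"
proof -
  obtain g where "inverse_arrows C X Y f g"
    using assms(3) by (auto simp: is_iso_def)
  then show ?thesis
    unfolding inv_arrow_def
    by (metis theI inverse_arrows_unique[OF assms(1,2)])
qed

text \<open>A relation between two bundled arrows rather than a chosen inverse: it is stable under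
  tensoring, and for braidings the inverse is again a braiding.\<close>

definition mutual_inverse :: "('o, 'm) arrow \<Rightarrow> ('o, 'm) arrow \<Rightarrow> bool" where
  "mutual_inverse f g \<longleftrightarrow> arr f \<and> arr g \<and> src g = tgt f \<and> tgt g = src f \<and>
     g \<bullet> f = Idt (src f) \<and> f \<bullet> g = Idt (tgt f)"

lemma inverse_inv_arrow:
  assumes "X \<in> Ob C" "Y \<in> Ob C" "is_iso C X Y f"
  shows "mutual_inverse (Arrow X Y f) (Arrow Y X (inv_arrow C X Y f))"
  using inverse_arrows_inv_arrow[OF assms] assms
  by (simp add: mutual_inverse_def inverse_arrows_def cmp_Arrow Idt_def)

lemma inverse_cancel:
  assumes "mutual_inverse f g"
  shows "\<lbrakk>arr u; tgt u = src f\<rbrakk> \<Longrightarrow> g \<bullet> f \<bullet> u = u"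
    and "\<lbrakk>arr u; tgt u = tgt f\<rbrakk> \<Longrightarrow> f \<bullet> g \<bullet> u = u"
proof -
  assume "arr u" "tgt u = src f"
  then have "g \<bullet> f \<bullet> u = (g \<bullet> f) \<bullet> u"
    using assms unfolding mutual_inverse_def by (intro cmp_assoc[symmetric]) auto
  then show "g \<bullet> f \<bullet> u = u"
    using assms \<open>arr u\<close> \<open>tgt u = src f\<close> by (simp add: mutual_inverse_def)
next
  assume "arr u" "tgt u = tgt f"
  then have "f \<bullet> g \<bullet> u = (f \<bullet> g) \<bullet> u"
    using assms unfolding mutual_inverse_def by (intro cmp_assoc[symmetric]) auto
  then show "f \<bullet> g \<bullet> u = u"
    using assms \<open>arr u\<close> \<open>tgt u = tgt f\<close> by (simp add: mutual_inverse_def)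
qed

lemma cancel_left:
  assumes "mutual_inverse f g" "f \<bullet> u = f \<bullet> v" "arr u" "arr v" "tgt u = src f" "tgt v = src f"
  shows "u = v"
  using inverse_cancel(1)[OF assms(1)] assms(2-) by metis

lemma cancel_right:
  assumes "mutual_inverse f g" "u \<bullet> f = v \<bullet> f" "arr u" "arr v" "src u = tgt f" "src v = tgt f"
  shows "u = v"
proof -
  have "(w \<bullet> f) \<bullet> g = w" if "arr w" "src w = tgt f" for w
    using assms(1) that by (simp add: mutual_inverse_def)
  then show ?thesis
    using assms(2-) by metis
qed

end

section \<open>The symmetric monoidal structure on bundled arrows\<close>

context symmetric_monoidal_category
begin

notation cmp  (infixr "\<bullet>" 70)
notation in_hom  ("\<guillemotleft>_ : _ \<rightarrow> _\<guillemotright>")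

definition tens :: "('o, 'm) arrow \<Rightarrow> ('o, 'm) arrow \<Rightarrow> ('o, 'm) arrow"  (infixr "\<boxtimes>" 75) where
  "f \<boxtimes> g = Arrow (src f \<otimes>\<^sub>o src g) (tgt f \<otimes>\<^sub>o tgt g) (lab f \<otimes>\<^sub>a lab g)"

lemma src_tens [simp]: "src (f \<boxtimes> g) = src f \<otimes>\<^sub>o src g"
  and tgt_tens [simp]: "tgt (f \<boxtimes> g) = tgt f \<otimes>\<^sub>o tgt g"
  and lab_tens [simp]: "lab (f \<boxtimes> g) = lab f \<otimes>\<^sub>a lab g"
  by (simp_all add: tens_def)

declare tensor_ob [simp] unit_ob [simp]

lemma arr_tens [simp]: "\<lbrakk>arr f; arr g\<rbrakk> \<Longrightarrow> arr (f \<boxtimes> g)"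
  using tensor_in_hom[of "src f" "tgt f" "src g" "tgt g" "lab f" "lab g"] by (simp add: arr_def del: arr_src arr_tgt)

lemma tens_Idt [simp]: "\<lbrakk>X \<in> Ob A; Y \<in> Ob A\<rbrakk> \<Longrightarrow> Idt X \<boxtimes> Idt Y = Idt (X \<otimes>\<^sub>o Y)"
  by (rule arrow_eqI) (simp_all add: tensor_id)

lemma tens_cmp [simp]:
  "\<lbrakk>arr f; arr f'; arr g; arr g'; src f' = tgt f; src g' = tgt g\<rbrakk>
    \<Longrightarrow> (f' \<boxtimes> g') \<bullet> (f \<boxtimes> g) = (f' \<bullet> f) \<boxtimes> (g' \<bullet> g)"
  by (rule arrow_eqI) (simp_all add: tensor_comp[of "src f" "tgt f" "tgt f'" "src g" "tgt g" "tgt g'" "lab f" "lab f'" "lab g" "lab g'"])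

text \<open>Composites are normalised to right-nested form, where two adjacent tensors followed by a
  tail are not a subterm that \<open>tens_cmp\<close> could match. The same reason accounts for
  \<open>structure_inverse'\<close> below.\<close>

lemma tens_cmp' [simp]:
  assumes "arr f" "arr f'" "arr g" "arr g'" "src f' = tgt f" "src g' = tgt g"
    "arr h" "tgt h = src f \<otimes>\<^sub>o src g"
  shows "(f' \<boxtimes> g') \<bullet> (f \<boxtimes> g) \<bullet> h = ((f' \<bullet> f) \<boxtimes> (g' \<bullet> g)) \<bullet> h"
proof -
  have "(f' \<boxtimes> g') \<bullet> (f \<boxtimes> g) \<bullet> h = ((f' \<boxtimes> g') \<bullet> (f \<boxtimes> g)) \<bullet> h"
    using assms by (simp del: tens_cmp)
  then show ?thesis
    using assms by simp
qed

definition al :: "'o \<Rightarrow> 'o \<Rightarrow> 'o \<Rightarrow> ('o, 'm) arrow" where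
  "al X Y Z = Arrow ((X \<otimes>\<^sub>o Y) \<otimes>\<^sub>o Z) (X \<otimes>\<^sub>o (Y \<otimes>\<^sub>o Z)) (assoc A X Y Z)"

definition al' :: "'o \<Rightarrow> 'o \<Rightarrow> 'o \<Rightarrow> ('o, 'm) arrow" where
  "al' X Y Z = Arrow (X \<otimes>\<^sub>o (Y \<otimes>\<^sub>o Z)) ((X \<otimes>\<^sub>o Y) \<otimes>\<^sub>o Z)
     (inv_arrow A ((X \<otimes>\<^sub>o Y) \<otimes>\<^sub>o Z) (X \<otimes>\<^sub>o (Y \<otimes>\<^sub>o Z)) (assoc A X Y Z))"

definition lu :: "'o \<Rightarrow> ('o, 'm) arrow" where
  "lu X = Arrow (unit A \<otimes>\<^sub>o X) X (lunit A X)"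

definition lu' :: "'o \<Rightarrow> ('o, 'm) arrow" where
  "lu' X = Arrow X (unit A \<otimes>\<^sub>o X) (inv_arrow A (unit A \<otimes>\<^sub>o X) X (lunit A X))"

definition ru :: "'o \<Rightarrow> ('o, 'm) arrow" where
  "ru X = Arrow (X \<otimes>\<^sub>o unit A) X (runit A X)"

definition ru' :: "'o \<Rightarrow> ('o, 'm) arrow" where
  "ru' X = Arrow X (X \<otimes>\<^sub>o unit A) (inv_arrow A (X \<otimes>\<^sub>o unit A) X (runit A X))"

definition br :: "'o \<Rightarrow> 'o \<Rightarrow> ('o, 'm) arrow" where
  "br X Y = Arrow (X \<otimes>\<^sub>o Y) (Y \<otimes>\<^sub>o X) (braid A X Y)"

lemma src_structure [simp]:
  "src (al X Y Z) = (X \<otimes>\<^sub>o Y) \<otimes>\<^sub>o Z" "src (al' X Y Z) = X \<otimes>\<^sub>o (Y \<otimes>\<^sub>o Z)"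
  "src (lu X) = unit A \<otimes>\<^sub>o X" "src (lu' X) = X" "src (ru X) = X \<otimes>\<^sub>o unit A" "src (ru' X) = X"
  "src (br X Y) = X \<otimes>\<^sub>o Y"
  by (simp_all add: al_def al'_def lu_def lu'_def ru_def ru'_def br_def)

lemma tgt_structure [simp]:
  "tgt (al X Y Z) = X \<otimes>\<^sub>o (Y \<otimes>\<^sub>o Z)" "tgt (al' X Y Z) = (X \<otimes>\<^sub>o Y) \<otimes>\<^sub>o Z"
  "tgt (lu X) = X" "tgt (lu' X) = unit A \<otimes>\<^sub>o X" "tgt (ru X) = X" "tgt (ru' X) = X \<otimes>\<^sub>o unit A"
  "tgt (br X Y) = Y \<otimes>\<^sub>o X"
  by (simp_all add: al_def al'_def lu_def lu'_def ru_def ru'_def br_def)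

lemma inverse_al: "\<lbrakk>X \<in> Ob A; Y \<in> Ob A; Z \<in> Ob A\<rbrakk> \<Longrightarrow> mutual_inverse (al X Y Z) (al' X Y Z)"
  unfolding al_def al'_def by (intro inverse_inv_arrow assoc_iso) auto

lemma inverse_lu: "X \<in> Ob A \<Longrightarrow> mutual_inverse (lu X) (lu' X)"
  unfolding lu_def lu'_def by (intro inverse_inv_arrow lunit_iso) auto

lemma inverse_ru: "X \<in> Ob A \<Longrightarrow> mutual_inverse (ru X) (ru' X)"
  unfolding ru_def ru'_def by (intro inverse_inv_arrow runit_iso) auto

lemma inverse_br: "\<lbrakk>X \<in> Ob A; Y \<in> Ob A\<rbrakk> \<Longrightarrow> mutual_inverse (br X Y) (br Y X)"
  by (simp add: mutual_inverse_def br_def braid_in_hom cmp_Arrow symmetry Idt_def)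

lemma arr_structure [simp]:
  "\<lbrakk>X \<in> Ob A; Y \<in> Ob A; Z \<in> Ob A\<rbrakk> \<Longrightarrow> arr (al X Y Z)"
  "\<lbrakk>X \<in> Ob A; Y \<in> Ob A; Z \<in> Ob A\<rbrakk> \<Longrightarrow> arr (al' X Y Z)"
  "X \<in> Ob A \<Longrightarrow> arr (lu X)" "X \<in> Ob A \<Longrightarrow> arr (lu' X)"
  "X \<in> Ob A \<Longrightarrow> arr (ru X)" "X \<in> Ob A \<Longrightarrow> arr (ru' X)"
  "\<lbrakk>X \<in> Ob A; Y \<in> Ob A\<rbrakk> \<Longrightarrow> arr (br X Y)"
  using inverse_al inverse_lu inverse_ru inverse_br by (auto simp: mutual_inverse_def)

lemma structure_inverse [simp]:
  "\<lbrakk>X \<in> Ob A; Y \<in> Ob A; Z \<in> Ob A\<rbrakk> \<Longrightarrow> al X Y Z \<bullet> al' X Y Z = Idt (X \<otimes>\<^sub>o (Y \<otimes>\<^sub>o Z))"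
  "\<lbrakk>X \<in> Ob A; Y \<in> Ob A; Z \<in> Ob A\<rbrakk> \<Longrightarrow> al' X Y Z \<bullet> al X Y Z = Idt ((X \<otimes>\<^sub>o Y) \<otimes>\<^sub>o Z)"
  "X \<in> Ob A \<Longrightarrow> lu X \<bullet> lu' X = Idt X" "X \<in> Ob A \<Longrightarrow> lu' X \<bullet> lu X = Idt (unit A \<otimes>\<^sub>o X)"
  "X \<in> Ob A \<Longrightarrow> ru X \<bullet> ru' X = Idt X" "X \<in> Ob A \<Longrightarrow> ru' X \<bullet> ru X = Idt (X \<otimes>\<^sub>o unit A)"
  "\<lbrakk>X \<in> Ob A; Y \<in> Ob A\<rbrakk> \<Longrightarrow> br Y X \<bullet> br X Y = Idt (X \<otimes>\<^sub>o Y)"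
  using inverse_al inverse_lu inverse_ru inverse_br by (auto simp: mutual_inverse_def)

lemma structure_inverse' [simp]:
  "\<lbrakk>X \<in> Ob A; Y \<in> Ob A; Z \<in> Ob A; arr f; tgt f = X \<otimes>\<^sub>o (Y \<otimes>\<^sub>o Z)\<rbrakk>
    \<Longrightarrow> al X Y Z \<bullet> al' X Y Z \<bullet> f = f"
  "\<lbrakk>X \<in> Ob A; Y \<in> Ob A; Z \<in> Ob A; arr f; tgt f = (X \<otimes>\<^sub>o Y) \<otimes>\<^sub>o Z\<rbrakk>
    \<Longrightarrow> al' X Y Z \<bullet> al X Y Z \<bullet> f = f"
  "\<lbrakk>X \<in> Ob A; arr f; tgt f = X\<rbrakk> \<Longrightarrow> lu X \<bullet> lu' X \<bullet> f = f"
  "\<lbrakk>X \<in> Ob A; arr f; tgt f = unit A \<otimes>\<^sub>o X\<rbrakk> \<Longrightarrow> lu' X \<bullet> lu X \<bullet> f = f"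
  "\<lbrakk>X \<in> Ob A; arr f; tgt f = X\<rbrakk> \<Longrightarrow> ru X \<bullet> ru' X \<bullet> f = f"
  "\<lbrakk>X \<in> Ob A; arr f; tgt f = X \<otimes>\<^sub>o unit A\<rbrakk> \<Longrightarrow> ru' X \<bullet> ru X \<bullet> f = f"
  "\<lbrakk>X \<in> Ob A; Y \<in> Ob A; arr f; tgt f = X \<otimes>\<^sub>o Y\<rbrakk> \<Longrightarrow> br Y X \<bullet> br X Y \<bullet> f = f"
  using inverse_cancel[OF inverse_al] inverse_cancel[OF inverse_lu] inverse_cancel[OF inverse_ru]
    inverse_cancel[OF inverse_br] by auto

lemma al_natural:
  "\<lbrakk>\<guillemotleft>f : X \<rightarrow> X'\<guillemotright>; \<guillemotleft>g : Y \<rightarrow> Y'\<guillemotright>; \<guillemotleft>h : Z \<rightarrow> Z'\<guillemotright>\<rbrakk>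
    \<Longrightarrow> al X' Y' Z' \<bullet> ((f \<boxtimes> g) \<boxtimes> h) = (f \<boxtimes> (g \<boxtimes> h)) \<bullet> al X Y Z"
  by (rule arrow_eqI) (auto simp: al_def assoc_natural[of "src f" "tgt f" "src g" "tgt g" "src h" "tgt h" "lab f" "lab g" "lab h"])

lemma al'_natural:
  assumes "\<guillemotleft>f : X \<rightarrow> X'\<guillemotright>" "\<guillemotleft>g : Y \<rightarrow> Y'\<guillemotright>" "\<guillemotleft>h : Z \<rightarrow> Z'\<guillemotright>"
  shows "al' X' Y' Z' \<bullet> (f \<boxtimes> (g \<boxtimes> h)) = ((f \<boxtimes> g) \<boxtimes> h) \<bullet> al' X Y Z"
proof -
  have ob: "X \<in> Ob A" "X' \<in> Ob A" "Y \<in> Ob A" "Y' \<in> Ob A" "Z \<in> Ob A" "Z' \<in> Ob A"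
    using assms by auto
  have "al' X' Y' Z' \<bullet> (f \<boxtimes> (g \<boxtimes> h)) = al' X' Y' Z' \<bullet> ((f \<boxtimes> (g \<boxtimes> h)) \<bullet> al X Y Z) \<bullet> al' X Y Z"
    using assms ob by simp
  also have "\<dots> = ((f \<boxtimes> g) \<boxtimes> h) \<bullet> al' X Y Z"
    using assms ob by (simp add: al_natural[symmetric])
  finally show ?thesis .
qed

lemma lu_natural: "\<guillemotleft>f : X \<rightarrow> Y\<guillemotright> \<Longrightarrow> lu Y \<bullet> (Idt (unit A) \<boxtimes> f) = f \<bullet> lu X"
  by (rule arrow_eqI) (auto simp: lu_def lunit_natural[of "src f" "tgt f" "lab f"])

lemma ru_natural: "\<guillemotleft>f : X \<rightarrow> Y\<guillemotright> \<Longrightarrow> ru Y \<bullet> (f \<boxtimes> Idt (unit A)) = f \<bullet> ru X"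
  by (rule arrow_eqI) (auto simp: ru_def runit_natural[of "src f" "tgt f" "lab f"])

lemma br_natural:
  "\<lbrakk>\<guillemotleft>f : X \<rightarrow> X'\<guillemotright>; \<guillemotleft>g : Y \<rightarrow> Y'\<guillemotright>\<rbrakk> \<Longrightarrow> br X' Y' \<bullet> (f \<boxtimes> g) = (g \<boxtimes> f) \<bullet> br X Y"
  by (rule arrow_eqI) (auto simp: br_def braid_natural[of "src f" "tgt f" "src g" "tgt g" "lab f" "lab g"])

lemma triangle_arrow:
  "\<lbrakk>X \<in> Ob A; Y \<in> Ob A\<rbrakk> \<Longrightarrow> (Idt X \<boxtimes> lu Y) \<bullet> al X (unit A) Y = ru X \<boxtimes> Idt Y"
  by (rule arrow_eqI) (auto simp: al_def lu_def ru_def triangle)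

lemma pentagon_arrow:
  "\<lbrakk>W \<in> Ob A; X \<in> Ob A; Y \<in> Ob A; Z \<in> Ob A\<rbrakk>
    \<Longrightarrow> al W X (Y \<otimes>\<^sub>o Z) \<bullet> al (W \<otimes>\<^sub>o X) Y Z =
      (Idt W \<boxtimes> al X Y Z) \<bullet> al W (X \<otimes>\<^sub>o Y) Z \<bullet> (al W X Y \<boxtimes> Idt Z)"
  by (rule arrow_eqI) (auto simp: al_def pentagon)

lemma hexagon_arrow:
  "\<lbrakk>X \<in> Ob A; Y \<in> Ob A; Z \<in> Ob A\<rbrakk>
    \<Longrightarrow> al Y Z X \<bullet> br X (Y \<otimes>\<^sub>o Z) \<bullet> al X Y Z =
      (Idt Y \<boxtimes> br X Z) \<bullet> al Y X Z \<bullet> (br X Y \<boxtimes> Idt Z)"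
  by (rule arrow_eqI) (auto simp: al_def br_def hexagon)

text \<open>The left unitor is a natural isomorphism from I \<otimes> - to the identity functor, and
  the identity functor is faithful.\<close>

lemma unit_tens_faithful:
  assumes "Idt (unit A) \<boxtimes> f = Idt (unit A) \<boxtimes> g" "\<guillemotleft>f : X \<rightarrow> Y\<guillemotright>" "\<guillemotleft>g : X \<rightarrow> Y\<guillemotright>"
  shows "f = g"
proof -
  have *: "f \<bullet> lu X = g \<bullet> lu X"
    using lu_natural[OF assms(2)] lu_natural[OF assms(3)] assms(1) by metis
  show ?thesis
    by (rule cancel_right[OF inverse_lu *]) (use assms in auto)
qed

lemma tens_unit_faithful:
  assumes "f \<boxtimes> Idt (unit A) = g \<boxtimes> Idt (unit A)" "\<guillemotleft>f : X \<rightarrow> Y\<guillemotright>" "\<guillemotleft>g : X \<rightarrow> Y\<guillemotright>"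
  shows "f = g"
proof -
  have *: "f \<bullet> ru X = g \<bullet> ru X"
    using ru_natural[OF assms(2)] ru_natural[OF assms(3)] assms(1) by metis
  show ?thesis
    by (rule cancel_right[OF inverse_ru *]) (use assms in auto)
qed

lemma inverse_tens:
  "\<lbrakk>mutual_inverse f f'; mutual_inverse g g'\<rbrakk> \<Longrightarrow> mutual_inverse (f \<boxtimes> g) (f' \<boxtimes> g')"
  by (auto simp: mutual_inverse_def)

lemma inverse_Idt: "X \<in> Ob A \<Longrightarrow> mutual_inverse (Idt X) (Idt X)"
  by (simp add: mutual_inverse_def)

text \<open>Kelly's argument: after tensoring with the unit, which is faithful, the identity follows from the
  pentagon and the triangle.\<close>

lemma lu_tens:
  assumes [simp]: "X \<in> Ob A" "Y \<in> Ob A"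
  shows "lu (X \<otimes>\<^sub>o Y) \<bullet> al (unit A) X Y = lu X \<boxtimes> Idt Y"
proof (rule unit_tens_faithful)
  let ?I = "unit A"
  let ?p = "al ?I (?I \<otimes>\<^sub>o X) Y" and ?q = "al ?I ?I X \<boxtimes> Idt Y"
  have "(Idt ?I \<boxtimes> (lu (X \<otimes>\<^sub>o Y) \<bullet> al ?I X Y)) \<bullet> ?p \<bullet> ?q
      = (Idt ?I \<boxtimes> lu (X \<otimes>\<^sub>o Y)) \<bullet> (Idt ?I \<boxtimes> al ?I X Y) \<bullet> ?p \<bullet> ?q"
    by simp
  also have "\<dots> = (Idt ?I \<boxtimes> lu (X \<otimes>\<^sub>o Y)) \<bullet> al ?I ?I (X \<otimes>\<^sub>o Y) \<bullet> al (?I \<otimes>\<^sub>o ?I) X Y"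
    by (subst pentagon_arrow) simp_all
  also have "\<dots> = (ru ?I \<boxtimes> Idt (X \<otimes>\<^sub>o Y)) \<bullet> al (?I \<otimes>\<^sub>o ?I) X Y"
    by (simp flip: triangle_arrow cmp_assoc)
  also have "\<dots> = al ?I X Y \<bullet> ((ru ?I \<boxtimes> Idt X) \<boxtimes> Idt Y)"
    by (simp add: al_natural[of _ "?I \<otimes>\<^sub>o ?I" _ _ X X _ Y Y])
  also have "\<dots> = al ?I X Y \<bullet> ((Idt ?I \<boxtimes> lu X) \<boxtimes> Idt Y) \<bullet> ?q"
    by (simp flip: triangle_arrow)
  also have "\<dots> = (al ?I X Y \<bullet> ((Idt ?I \<boxtimes> lu X) \<boxtimes> Idt Y)) \<bullet> ?q"
    by simp
  also have "\<dots> = (Idt ?I \<boxtimes> (lu X \<boxtimes> Idt Y)) \<bullet> ?p \<bullet> ?q"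
    by (subst al_natural[of _ ?I _ _ "?I \<otimes>\<^sub>o X" X _ Y Y]) simp_all
  finally have *: "((Idt ?I \<boxtimes> (lu (X \<otimes>\<^sub>o Y) \<bullet> al ?I X Y)) \<bullet> ?p) \<bullet> ?q = ((Idt ?I \<boxtimes> (lu X \<boxtimes> Idt Y)) \<bullet> ?p) \<bullet> ?q"
    by simp
  have "(Idt ?I \<boxtimes> (lu (X \<otimes>\<^sub>o Y) \<bullet> al ?I X Y)) \<bullet> ?p = (Idt ?I \<boxtimes> (lu X \<boxtimes> Idt Y)) \<bullet> ?p"
    by (rule cancel_right[OF inverse_tens[OF inverse_al inverse_Idt] *]) simp_all
  then show "Idt ?I \<boxtimes> (lu (X \<otimes>\<^sub>o Y) \<bullet> al ?I X Y) = Idt ?I \<boxtimes> (lu X \<boxtimes> Idt Y)"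
    by (rule cancel_right[OF inverse_al, rotated -5]) simp_all
qed simp_all

text \<open>Mirror image of the previous argument: the unit is tensored on the right, the pentagon
  is read at X, Y, I, I, and the associator to cancel stands on the left.\<close>

lemma ru_tens:
  assumes [simp]: "X \<in> Ob A" "Y \<in> Ob A"
  shows "(Idt X \<boxtimes> ru Y) \<bullet> al X Y (unit A) = ru (X \<otimes>\<^sub>o Y)"
proof (rule tens_unit_faithful)
  let ?I = "unit A"
  let ?q = "al X Y ?I \<boxtimes> Idt ?I"
  have "al X Y ?I \<bullet> (ru (X \<otimes>\<^sub>o Y) \<boxtimes> Idt ?I)
      = (al X Y ?I \<bullet> (Idt (X \<otimes>\<^sub>o Y) \<boxtimes> lu ?I)) \<bullet> al (X \<otimes>\<^sub>o Y) ?I ?I"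
    by (simp flip: triangle_arrow)
  also have "\<dots> = ((Idt X \<boxtimes> (Idt Y \<boxtimes> lu ?I)) \<bullet> al X Y (?I \<otimes>\<^sub>o ?I)) \<bullet> al (X \<otimes>\<^sub>o Y) ?I ?I"
    by (subst al_natural[of "Idt X" X X "Idt Y" Y Y _ "?I \<otimes>\<^sub>o ?I" ?I, symmetric]) simp_all
  also have "\<dots> = (Idt X \<boxtimes> (Idt Y \<boxtimes> lu ?I)) \<bullet> (Idt X \<boxtimes> al Y ?I ?I) \<bullet> al X (Y \<otimes>\<^sub>o ?I) ?I \<bullet> ?q"
    by (simp add: pentagon_arrow del: tens_cmp')
  also have "\<dots> = ((Idt X \<boxtimes> (ru Y \<boxtimes> Idt ?I)) \<bullet> al X (Y \<otimes>\<^sub>o ?I) ?I) \<bullet> ?q"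
    by (simp add: triangle_arrow)
  also have "\<dots> = (al X Y ?I \<bullet> ((Idt X \<boxtimes> ru Y) \<boxtimes> Idt ?I)) \<bullet> ?q"
    by (subst al_natural[of _ X _ _ "Y \<otimes>\<^sub>o ?I" _ _ ?I]) simp_all
  finally have *: "al X Y ?I \<bullet> (ru (X \<otimes>\<^sub>o Y) \<boxtimes> Idt ?I)
      = al X Y ?I \<bullet> (((Idt X \<boxtimes> ru Y) \<bullet> al X Y ?I) \<boxtimes> Idt ?I)"
    by simp
  show "((Idt X \<boxtimes> ru Y) \<bullet> al X Y ?I) \<boxtimes> Idt ?I = ru (X \<otimes>\<^sub>o Y) \<boxtimes> Idt ?I"
    by (rule cancel_left[OF inverse_al *[symmetric]]) simp_all
qed simp_all

text \<open>After tensoring with the unit, the hexagon at X, I, I produces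
  \<open>br X (I \<otimes> I)\<close>. Naturality of the braiding in \<open>lu I\<close> turns this
  into \<open>br X I\<close>, which then cancels.\<close>

lemma lu_br:
  assumes [simp]: "X \<in> Ob A"
  shows "lu X \<bullet> br X (unit A) = ru X"
proof (rule tens_unit_faithful)
  let ?I = "unit A"
  have "br X ?I \<bullet> (lu X \<boxtimes> Idt ?I) \<bullet> (br X ?I \<boxtimes> Idt ?I)
      = (br X ?I \<bullet> lu (X \<otimes>\<^sub>o ?I)) \<bullet> al ?I X ?I \<bullet> (br X ?I \<boxtimes> Idt ?I)"
    by (simp flip: lu_tens)
  also have "\<dots> = lu (?I \<otimes>\<^sub>o X) \<bullet> (Idt ?I \<boxtimes> br X ?I) \<bullet> al ?I X ?I \<bullet> (br X ?I \<boxtimes> Idt ?I)"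
    by (subst lu_natural[of _ "X \<otimes>\<^sub>o ?I" "?I \<otimes>\<^sub>o X", symmetric]) simp_all
  also have "\<dots> = (lu (?I \<otimes>\<^sub>o X) \<bullet> al ?I ?I X) \<bullet> br X (?I \<otimes>\<^sub>o ?I) \<bullet> al X ?I ?I"
    by (simp flip: hexagon_arrow)
  also have "\<dots> = ((lu ?I \<boxtimes> Idt X) \<bullet> br X (?I \<otimes>\<^sub>o ?I)) \<bullet> al X ?I ?I"
    by (subst lu_tens) simp_all
  also have "\<dots> = (br X ?I \<bullet> (Idt X \<boxtimes> lu ?I)) \<bullet> al X ?I ?I"
    by (subst br_natural[of "Idt X" X X _ "?I \<otimes>\<^sub>o ?I"]) simp_all
  also have "\<dots> = br X ?I \<bullet> (ru X \<boxtimes> Idt ?I)"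
    by (simp add: triangle_arrow)
  finally have *: "br X ?I \<bullet> ((lu X \<bullet> br X ?I) \<boxtimes> Idt ?I) = br X ?I \<bullet> (ru X \<boxtimes> Idt ?I)"
    by simp
  show "(lu X \<bullet> br X ?I) \<boxtimes> Idt ?I = ru X \<boxtimes> Idt ?I"
    by (rule cancel_left[OF inverse_br *]) simp_all
qed simp_all

lemma ru_br:
  assumes [simp]: "X \<in> Ob A"
  shows "ru X \<bullet> br (unit A) X = lu X"
  by (simp flip: lu_br)

text \<open>The hexagon solved for the opposite braiding: by symmetry
  \<open>br (Y \<otimes> Z) X\<close> inverts \<open>br X (Y \<otimes> Z)\<close>, so the left side
  of the hexagon can be inserted and rewritten.\<close>

lemma br_tens:
  assumes [simp]: "X \<in> Ob A" "Y \<in> Ob A" "Z \<in> Ob A"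
  shows "br (Y \<otimes>\<^sub>o Z) X \<bullet> al' Y Z X \<bullet> (Idt Y \<boxtimes> br X Z)
    = al X Y Z \<bullet> (br Y X \<boxtimes> Idt Z) \<bullet> al' Y X Z"
proof -
  have "al X Y Z \<bullet> (br Y X \<boxtimes> Idt Z) \<bullet> al' Y X Z
      = br (Y \<otimes>\<^sub>o Z) X \<bullet> al' Y Z X \<bullet> (al Y Z X \<bullet> br X (Y \<otimes>\<^sub>o Z) \<bullet> al X Y Z) \<bullet> (br Y X \<boxtimes> Idt Z) \<bullet> al' Y X Z"
    by simp
  also have "\<dots> = br (Y \<otimes>\<^sub>o Z) X \<bullet> al' Y Z X \<bullet> (Idt Y \<boxtimes> br X Z)"
    by (subst hexagon_arrow) simp_all
  finally show ?thesis by simp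
qed

text \<open>The isomorphism by which a hom-object D = C(d,e) passes the coefficient X in the action
  on X \<otimes> C(c,-). All braidings of the free modules are packed into it, so the lemmas about
  \<open>swap\<close> below are all the coherence that free modules require.\<close>

definition swap :: "'o \<Rightarrow> 'o \<Rightarrow> 'o \<Rightarrow> ('o, 'm) arrow" where
  "swap D X B = al X D B \<bullet> (br D X \<boxtimes> Idt B) \<bullet> al' D X B"

lemma swap_simps [simp]:
  "src (swap D X B) = D \<otimes>\<^sub>o (X \<otimes>\<^sub>o B)" "tgt (swap D X B) = X \<otimes>\<^sub>o (D \<otimes>\<^sub>o B)"
  "\<lbrakk>D \<in> Ob A; X \<in> Ob A; B \<in> Ob A\<rbrakk> \<Longrightarrow> arr (swap D X B)"
  by (simp_all add: swap_def)

lemma swap_natural: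
  assumes "\<guillemotleft>f : D \<rightarrow> D'\<guillemotright>" "\<guillemotleft>g : X \<rightarrow> X'\<guillemotright>" "\<guillemotleft>h : B \<rightarrow> B'\<guillemotright>"
  shows "swap D' X' B' \<bullet> (f \<boxtimes> (g \<boxtimes> h)) = (g \<boxtimes> (f \<boxtimes> h)) \<bullet> swap D X B"
proof -
  have [simp]: "D \<in> Ob A" "D' \<in> Ob A" "X \<in> Ob A" "X' \<in> Ob A" "B \<in> Ob A" "B' \<in> Ob A"
    using assms by auto
  have "swap D' X' B' \<bullet> (f \<boxtimes> (g \<boxtimes> h)) = al X' D' B' \<bullet> (br D' X' \<boxtimes> Idt B') \<bullet> ((f \<boxtimes> g) \<boxtimes> h) \<bullet> al' D X B"
    using assms by (simp add: swap_def al'_natural[OF assms])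
  also have "\<dots> = (al X' D' B' \<bullet> ((g \<boxtimes> f) \<boxtimes> h)) \<bullet> (br D X \<boxtimes> Idt B) \<bullet> al' D X B"
    using assms by (simp add: br_natural[OF assms(1,2)])
  also have "\<dots> = (g \<boxtimes> (f \<boxtimes> h)) \<bullet> swap D X B"
    using assms by (simp add: swap_def al_natural[OF assms(2,1,3)])
  finally show ?thesis .
qed

text \<open>The hexagon with its first braiding undone by symmetry. It is used to show that
  \<open>rep_hom\<close> is natural: moving X behind D \<otimes> B after \<open>swap\<close> leaves
  only the braiding of X with B.\<close>

lemma swap_br:
  assumes [simp]: "D \<in> Ob A" "X \<in> Ob A" "B \<in> Ob A"
  shows "al D B X \<bullet> br X (D \<otimes>\<^sub>o B) \<bullet> swap D X B = Idt D \<boxtimes> br X B"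
proof -
  have "al D B X \<bullet> br X (D \<otimes>\<^sub>o B) \<bullet> swap D X B
      = (al D B X \<bullet> br X (D \<otimes>\<^sub>o B) \<bullet> al X D B) \<bullet> (br D X \<boxtimes> Idt B) \<bullet> al' D X B"
    by (simp add: swap_def)
  also have "\<dots> = Idt D \<boxtimes> br X B"
    by (subst hexagon_arrow) simp_all
  finally show ?thesis .
qed

text \<open>The coherence behind the unit law of the free action: a unit passes X, by
  \<open>ru_br\<close>, as if it had been absorbed at once.\<close>

lemma swap_unit_left:
  assumes [simp]: "X \<in> Ob A" "B \<in> Ob A"
  shows "(Idt X \<boxtimes> lu B) \<bullet> swap (unit A) X B = lu (X \<otimes>\<^sub>o B)"
proof -
  have "(Idt X \<boxtimes> lu B) \<bullet> swap (unit A) X B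
      = ((Idt X \<boxtimes> lu B) \<bullet> al X (unit A) B) \<bullet> (br (unit A) X \<boxtimes> Idt B) \<bullet> al' (unit A) X B"
    by (simp add: swap_def)
  also have "\<dots> = (lu X \<boxtimes> Idt B) \<bullet> al' (unit A) X B"
    by (subst triangle_arrow) (simp_all add: ru_br)
  also have "\<dots> = lu (X \<otimes>\<^sub>o B)"
    by (simp flip: lu_tens)
  finally show ?thesis .
qed

text \<open>The coherence behind \<open>rep_hom_eta\<close>: \<open>ru' X\<close> is the coherence
  part of the generator \<open>rep_unit\<close>, and \<open>ru D\<close> is what remains after the
  right unit law of C.\<close>

lemma swap_unit_right:
  assumes [simp]: "D \<in> Ob A" "X \<in> Ob A"
  shows "(Idt X \<boxtimes> ru D) \<bullet> swap D X (unit A) \<bullet> (Idt D \<boxtimes> ru' X) = br D X"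
proof -
  have "(Idt X \<boxtimes> ru D) \<bullet> swap D X (unit A) \<bullet> (Idt D \<boxtimes> ru' X)
      = ((Idt X \<boxtimes> ru D) \<bullet> al X D (unit A)) \<bullet> (br D X \<boxtimes> Idt (unit A)) \<bullet> al' D X (unit A) \<bullet> (Idt D \<boxtimes> ru' X)"
    by (simp add: swap_def)
  also have "\<dots> = (ru (X \<otimes>\<^sub>o D) \<bullet> (br D X \<boxtimes> Idt (unit A))) \<bullet> al' D X (unit A) \<bullet> (Idt D \<boxtimes> ru' X)"
    by (subst ru_tens) simp_all
  also have "\<dots> = br D X \<bullet> ((Idt D \<boxtimes> ru X) \<bullet> al D X (unit A)) \<bullet> al' D X (unit A) \<bullet> (Idt D \<boxtimes> ru' X)"
    by (subst ru_natural[of _ "D \<otimes>\<^sub>o X"]) (simp_all add: ru_tens)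
  also have "\<dots> = br D X"
    by simp
  finally show ?thesis .
qed

text \<open>The coherence behind associativity of the free action: E \<otimes> D passes X in one
  move or one factor at a time. The hexagon splits the braiding, and three instances of the pentagon
  (at E, D, X, B, then E, X, D, B, then X, E, D, B) take care of the brackets.\<close>

lemma swap_tens:
  assumes [simp]: "E \<in> Ob A" "D \<in> Ob A" "X \<in> Ob A" "B \<in> Ob A"
  shows "(Idt X \<boxtimes> al E D B) \<bullet> swap (E \<otimes>\<^sub>o D) X B
    = swap E X (D \<otimes>\<^sub>o B) \<bullet> (Idt E \<boxtimes> swap D X B) \<bullet> al E D (X \<otimes>\<^sub>o B)"
proof -
  let ?p = "(Idt E \<boxtimes> br D X) \<boxtimes> Idt B" and ?q = "al E D X \<boxtimes> Idt B"
  \<comment> \<open>\<open>br_tens\<close> with the trailing braiding of D and X moved to the other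
    side by symmetry.\<close>
  have braid: "br (E \<otimes>\<^sub>o D) X = al X E D \<bullet> (br E X \<boxtimes> Idt D) \<bullet> al' E X D \<bullet> (Idt E \<boxtimes> br D X) \<bullet> al E D X"
  proof -
    have "br (E \<otimes>\<^sub>o D) X = (br (E \<otimes>\<^sub>o D) X \<bullet> al' E D X \<bullet> (Idt E \<boxtimes> br X D)) \<bullet> (Idt E \<boxtimes> br D X) \<bullet> al E D X"
      by simp
    then show ?thesis
      by (subst (asm) br_tens) simp_all
  qed
  have "swap E X (D \<otimes>\<^sub>o B) \<bullet> (Idt E \<boxtimes> swap D X B) \<bullet> al E D (X \<otimes>\<^sub>o B) \<bullet> al (E \<otimes>\<^sub>o D) X B
      = swap E X (D \<otimes>\<^sub>o B) \<bullet> (Idt E \<boxtimes> swap D X B) \<bullet> (Idt E \<boxtimes> al D X B) \<bullet> al E (D \<otimes>\<^sub>o X) B \<bullet> ?q"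
    by (simp add: pentagon_arrow del: tens_cmp')
  also have "\<dots> = swap E X (D \<otimes>\<^sub>o B) \<bullet> (Idt E \<boxtimes> al X D B) \<bullet> ((Idt E \<boxtimes> (br D X \<boxtimes> Idt B)) \<bullet> al E (D \<otimes>\<^sub>o X) B) \<bullet> ?q"
    by (simp add: swap_def)
  also have "\<dots> = swap E X (D \<otimes>\<^sub>o B) \<bullet> (Idt E \<boxtimes> al X D B) \<bullet> (al E (X \<otimes>\<^sub>o D) B \<bullet> ?p) \<bullet> ?q"
    by (subst al_natural[of _ E _ _ "D \<otimes>\<^sub>o X" _ _ B]) simp_all
  also have "\<dots> = swap E X (D \<otimes>\<^sub>o B) \<bullet> ((Idt E \<boxtimes> al X D B) \<bullet> al E (X \<otimes>\<^sub>o D) B \<bullet> (al E X D \<boxtimes> Idt B)) \<bullet>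
      (al' E X D \<boxtimes> Idt B) \<bullet> ?p \<bullet> ?q"
    by simp
  also have "\<dots> = swap E X (D \<otimes>\<^sub>o B) \<bullet> (al E X (D \<otimes>\<^sub>o B) \<bullet> al (E \<otimes>\<^sub>o X) D B) \<bullet>
      (al' E X D \<boxtimes> Idt B) \<bullet> ?p \<bullet> ?q"
    by (subst pentagon_arrow) simp_all
  also have "\<dots> = al X E (D \<otimes>\<^sub>o B) \<bullet> ((br E X \<boxtimes> (Idt D \<boxtimes> Idt B)) \<bullet> al (E \<otimes>\<^sub>o X) D B) \<bullet>
      (al' E X D \<boxtimes> Idt B) \<bullet> ?p \<bullet> ?q"
    by (simp add: swap_def)
  also have "\<dots> = (al X E (D \<otimes>\<^sub>o B) \<bullet> al (X \<otimes>\<^sub>o E) D B) \<bullet> ((br E X \<boxtimes> Idt D) \<boxtimes> Idt B) \<bullet>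
      (al' E X D \<boxtimes> Idt B) \<bullet> ?p \<bullet> ?q"
    by (subst al_natural[of _ "E \<otimes>\<^sub>o X" "X \<otimes>\<^sub>o E" _ D D _ B B, symmetric]) simp_all
  also have "\<dots> = (Idt X \<boxtimes> al E D B) \<bullet> al X (E \<otimes>\<^sub>o D) B \<bullet> (br (E \<otimes>\<^sub>o D) X \<boxtimes> Idt B)"
    by (subst pentagon_arrow) (simp_all add: braid)
  also have "\<dots> = ((Idt X \<boxtimes> al E D B) \<bullet> swap (E \<otimes>\<^sub>o D) X B) \<bullet> al (E \<otimes>\<^sub>o D) X B"
    by (simp add: swap_def)
  finally have *: "((Idt X \<boxtimes> al E D B) \<bullet> swap (E \<otimes>\<^sub>o D) X B) \<bullet> al (E \<otimes>\<^sub>o D) X B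
    = (swap E X (D \<otimes>\<^sub>o B) \<bullet> (Idt E \<boxtimes> swap D X B) \<bullet> al E D (X \<otimes>\<^sub>o B)) \<bullet> al (E \<otimes>\<^sub>o D) X B"
    by simp
  show ?thesis
    by (rule cancel_right[OF inverse_al *]) simp_all
qed

end

section \<open>The internal hom and modules as families of actions\<close>

context symmetric_monoidal_closed_category
begin

notation cmp  (infixr "\<bullet>" 70)
notation in_hom  ("\<guillemotleft>_ : _ \<rightarrow> _\<guillemotright>")
notation tens  (infixr "\<boxtimes>" 75)

declare ihom_ob [simp]

definition Ev :: "'a \<Rightarrow> 'a \<Rightarrow> ('a, 'b) arrow" where
  "Ev Y Z = Arrow (ihom A Y Z \<otimes>\<^sub>o Y) Z (ev A Y Z)"

definition cur :: "'a \<Rightarrow> 'a \<Rightarrow> ('a, 'b) arrow \<Rightarrow> ('a, 'b) arrow" where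
  "cur X Y f = Arrow X (ihom A Y (tgt f)) (transpose_arr A X Y (tgt f) (lab f))"

lemma Ev_simps [simp]:
  "src (Ev Y Z) = ihom A Y Z \<otimes>\<^sub>o Y" "tgt (Ev Y Z) = Z"
  "\<lbrakk>Y \<in> Ob A; Z \<in> Ob A\<rbrakk> \<Longrightarrow> arr (Ev Y Z)"
  by (simp_all add: Ev_def ev_in_hom)

lemma src_cur [simp]: "src (cur X Y f) = X"
  and tgt_cur [simp]: "tgt (cur X Y f) = ihom A Y (tgt f)"
  by (simp_all add: cur_def)

lemma transpose_arr:
  assumes "X \<in> Ob A" "Y \<in> Ob A" "Z \<in> Ob A" "f \<in> Hom A (X \<otimes>\<^sub>o Y) Z"
  shows "transpose_arr A X Y Z f \<in> Hom A X (ihom A Y Z)"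
    and "ev A Y Z \<cdot> (transpose_arr A X Y Z f \<otimes>\<^sub>a idm A Y) = f"
  using theI'[OF ev_universal[OF assms]] by (simp_all add: transpose_arr_def)

lemma arr_cur [simp]:
  assumes "arr f" "src f = X \<otimes>\<^sub>o Y" "X \<in> Ob A" "Y \<in> Ob A"
  shows "arr (cur X Y f)"
  using assms by (simp add: cur_def transpose_arr)

lemma Ev_cur [simp]:
  assumes "arr f" "src f = X \<otimes>\<^sub>o Y" "tgt f = Z" "X \<in> Ob A" "Y \<in> Ob A"
  shows "Ev Y Z \<bullet> (cur X Y f \<boxtimes> Idt Y) = f"
proof (rule arrow_eqI)
  have "Z \<in> Ob A" using assms by auto
  then show "lab (Ev Y Z \<bullet> (cur X Y f \<boxtimes> Idt Y)) = lab f"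
    using assms by (simp add: cur_def Ev_def transpose_arr(2))
qed (use assms in simp_all)

text \<open>The uniqueness half of \<open>ev_universal\<close>: equations between arrows into an
  internal hom can be tested after evaluation.\<close>

lemma Ev_inj:
  assumes "\<guillemotleft>g : X \<rightarrow> ihom A Y Z\<guillemotright>" "\<guillemotleft>g' : X \<rightarrow> ihom A Y Z\<guillemotright>" "Y \<in> Ob A" "Z \<in> Ob A"
    and eq: "Ev Y Z \<bullet> (g \<boxtimes> Idt Y) = Ev Y Z \<bullet> (g' \<boxtimes> Idt Y)"
  shows "g = g'"
proof (rule arrow_eqI)
  have X: "X \<in> Ob A" using assms(1) by auto
  have "ev A Y Z \<cdot> (lab g \<otimes>\<^sub>a idm A Y) \<in> Hom A (X \<otimes>\<^sub>o Y) Z"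
  proof -
    have "lab (Ev Y Z \<bullet> (g \<boxtimes> Idt Y)) \<in> Hom A (X \<otimes>\<^sub>o Y) Z"
      using assms by (intro arr_lab) auto
    then show ?thesis by (simp add: Ev_def)
  qed
  moreover have "ev A Y Z \<cdot> (lab g' \<otimes>\<^sub>a idm A Y) = ev A Y Z \<cdot> (lab g \<otimes>\<^sub>a idm A Y)"
    using arg_cong[OF eq, of lab] by (simp add: Ev_def)
  moreover have "lab g \<in> Hom A X (ihom A Y Z)" "lab g' \<in> Hom A X (ihom A Y Z)"
    using assms(1,2) by auto
  ultimately show "lab g = lab g'"
    using ev_universal[OF X assms(3,4)] by blast
qed (use assms in auto)

text \<open>The internal hom is right adjoint to - \<otimes> Y, but in an action C(a,b) \<otimes> M
  a -> M b the factor that varies in a colimit stands on the right. The braiding turns evaluation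
  into the counit of an adjunction for Y \<otimes> -, and \<open>lev_surj\<close> and
  \<open>lev_inj\<close> are the two halves of its bijection.\<close>

definition lev :: "'a \<Rightarrow> 'a \<Rightarrow> ('a, 'b) arrow" where
  "lev Y Z = Ev Y Z \<bullet> br Y (ihom A Y Z)"

lemma lev_simps [simp]:
  "src (lev Y Z) = Y \<otimes>\<^sub>o ihom A Y Z" "tgt (lev Y Z) = Z"
  "\<lbrakk>Y \<in> Ob A; Z \<in> Ob A\<rbrakk> \<Longrightarrow> arr (lev Y Z)"
  by (simp_all add: lev_def)

lemma lev_tens:
  assumes "\<guillemotleft>g : X \<rightarrow> ihom A Y Z\<guillemotright>" "Y \<in> Ob A" "Z \<in> Ob A"
  shows "lev Y Z \<bullet> (Idt Y \<boxtimes> g) = (Ev Y Z \<bullet> (g \<boxtimes> Idt Y)) \<bullet> br Y X"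
proof -
  have "X \<in> Ob A" using assms by auto
  then show ?thesis
    using assms by (simp add: lev_def br_natural[of "Idt Y" Y Y g])
qed

lemma lev_surj:
  assumes "\<guillemotleft>f : B \<otimes>\<^sub>o X \<rightarrow> Z\<guillemotright>" and [simp]: "B \<in> Ob A" "X \<in> Ob A"
  obtains g where "\<guillemotleft>g : X \<rightarrow> ihom A B Z\<guillemotright>" "lev B Z \<bullet> (Idt B \<boxtimes> g) = f"
proof
  have "Z \<in> Ob A" using assms by auto
  let ?g = "cur X B (f \<bullet> br X B)"
  show g: "\<guillemotleft>?g : X \<rightarrow> ihom A B Z\<guillemotright>"
    using assms by simp
  show "lev B Z \<bullet> (Idt B \<boxtimes> ?g) = f"
    unfolding lev_tens[OF g \<open>B \<in> Ob A\<close> \<open>Z \<in> Ob A\<close>]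
    using assms by simp
qed

lemma lev_inj:
  assumes "\<guillemotleft>g : X \<rightarrow> ihom A B Z\<guillemotright>" "\<guillemotleft>g' : X \<rightarrow> ihom A B Z\<guillemotright>" "B \<in> Ob A" "Z \<in> Ob A"
    and eq: "lev B Z \<bullet> (Idt B \<boxtimes> g) = lev B Z \<bullet> (Idt B \<boxtimes> g')"
  shows "g = g'"
proof (rule Ev_inj[OF assms(1-4)])
  have X: "X \<in> Ob A" using assms by auto
  have *: "(Ev B Z \<bullet> (g \<boxtimes> Idt B)) \<bullet> br B X = (Ev B Z \<bullet> (g' \<boxtimes> Idt B)) \<bullet> br B X"
    using eq assms by (simp only: lev_tens)
  show "Ev B Z \<bullet> (g \<boxtimes> Idt B) = Ev B Z \<bullet> (g' \<boxtimes> Idt B)"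
    by (rule cancel_right[OF inverse_br *]) (use assms X in auto)
qed

lemma self_enriched_simps [simp]: "EOb (self_enriched A) = Ob A" "EHom (self_enriched A) = ihom A"
  by (simp_all add: self_enriched_def)

definition self_comp :: "'a \<Rightarrow> 'a \<Rightarrow> 'a \<Rightarrow> ('a, 'b) arrow" where
  "self_comp X Y Z = Arrow (ihom A Y Z \<otimes>\<^sub>o ihom A X Y) (ihom A X Z) (ecomp (self_enriched A) X Y Z)"

lemma self_comp_cur:
  assumes "X \<in> Ob A" "Y \<in> Ob A" "Z \<in> Ob A"
  shows "self_comp X Y Z = cur (ihom A Y Z \<otimes>\<^sub>o ihom A X Y) X
    (Ev Y Z \<bullet> (Idt (ihom A Y Z) \<boxtimes> Ev X Y) \<bullet> al (ihom A Y Z) (ihom A X Y) X)"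
  by (simp add: self_comp_def self_enriched_def cur_def Ev_def al_def)

lemma self_comp_simps [simp]:
  "src (self_comp X Y Z) = ihom A Y Z \<otimes>\<^sub>o ihom A X Y" "tgt (self_comp X Y Z) = ihom A X Z"
  "\<lbrakk>X \<in> Ob A; Y \<in> Ob A; Z \<in> Ob A\<rbrakk> \<Longrightarrow> arr (self_comp X Y Z)"
  by (simp_all add: self_comp_cur) (simp_all add: self_comp_def)

text \<open>Composition of the self-enriched category is defined as the transpose of double
  evaluation. Evaluating it therefore gives iterated evaluation, which translates functoriality into
  a law about actions.\<close>

lemma Ev_self_comp:
  assumes "X \<in> Ob A" "Y \<in> Ob A" "Z \<in> Ob A" "\<guillemotleft>g : U \<rightarrow> ihom A Y Z\<guillemotright>" "\<guillemotleft>f : V \<rightarrow> ihom A X Y\<guillemotright>"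
  shows "Ev X Z \<bullet> ((self_comp X Y Z \<bullet> (g \<boxtimes> f)) \<boxtimes> Idt X)
    = (Ev Y Z \<bullet> (g \<boxtimes> Idt Y)) \<bullet> (Idt U \<boxtimes> (Ev X Y \<bullet> (f \<boxtimes> Idt X))) \<bullet> al U V X"
proof -
  have [simp]: "U \<in> Ob A" "V \<in> Ob A" using assms(4,5) by auto
  have "Ev X Z \<bullet> ((self_comp X Y Z \<bullet> (g \<boxtimes> f)) \<boxtimes> Idt X)
      = (Ev X Z \<bullet> (self_comp X Y Z \<boxtimes> Idt X)) \<bullet> ((g \<boxtimes> f) \<boxtimes> Idt X)"
    using assms by simp
  also have "\<dots> = Ev Y Z \<bullet> (Idt (ihom A Y Z) \<boxtimes> Ev X Y) \<bullet> (al (ihom A Y Z) (ihom A X Y) X \<bullet> ((g \<boxtimes> f) \<boxtimes> Idt X))"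
    using assms by (simp add: self_comp_cur)
  also have "\<dots> = Ev Y Z \<bullet> (Idt (ihom A Y Z) \<boxtimes> Ev X Y) \<bullet> (g \<boxtimes> (f \<boxtimes> Idt X)) \<bullet> al U V X"
    using assms by (subst al_natural[of _ U _ _ V _ _ X]) simp_all
  also have "\<dots> = (Ev Y Z \<bullet> (g \<boxtimes> Idt Y)) \<bullet> (Idt U \<boxtimes> (Ev X Y \<bullet> (f \<boxtimes> Idt X))) \<bullet> al U V X"
    using assms by simp
  finally show ?thesis .
qed

definition name :: "('a, 'b) arrow \<Rightarrow> ('a, 'b) arrow" where
  "name f = Arrow (unit A) (ihom A (src f) (tgt f)) (name_arrow A (src f) (tgt f) (lab f))"

lemma name_cur: "name f = cur (unit A) (src f) (f \<bullet> lu (src f))"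
  by (simp add: name_def cur_def name_arrow_def lu_def)

lemma name_simps [simp]:
  "src (name f) = unit A" "tgt (name f) = ihom A (src f) (tgt f)"
  "arr f \<Longrightarrow> arr (name f)"
  by (simp_all add: name_cur)

lemma Ev_name [simp]:
  "\<lbrakk>arr f; src f = X; tgt f = Y\<rbrakk> \<Longrightarrow> Ev X Y \<bullet> (name f \<boxtimes> Idt X) = f \<bullet> lu X"
  by (auto simp: name_cur)

end

section \<open>Enriched functors into A and their transposed actions\<close>

locale enriched_modules = symmetric_monoidal_closed_category A + enriched_category A C
  for A :: "('o, 'm, 'x) smc_cat_scheme" (structure) and C :: "('c, 'o, 'm, 'y) enr_cat_scheme"
begin

notation cmp  (infixr "\<bullet>" 70)
notation in_hom  ("\<guillemotleft>_ : _ \<rightarrow> _\<guillemotright>")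
notation tens  (infixr "\<boxtimes>" 75)

declare ehom_ob [simp]

definition eun :: "'c \<Rightarrow> ('o, 'm) arrow" where
  "eun a = Arrow (unit A) (EHom C a a) (eid C a)"

definition emu :: "'c \<Rightarrow> 'c \<Rightarrow> 'c \<Rightarrow> ('o, 'm) arrow" where
  "emu a b c = Arrow (EHom C b c \<otimes>\<^sub>o EHom C a b) (EHom C a c) (ecomp C a b c)"

lemma eun_simps [simp]:
  "src (eun a) = unit A" "tgt (eun a) = EHom C a a" "a \<in> EOb C \<Longrightarrow> arr (eun a)"
  by (simp_all add: eun_def eid_in_hom)

lemma emu_simps [simp]:
  "src (emu a b c) = EHom C b c \<otimes>\<^sub>o EHom C a b" "tgt (emu a b c) = EHom C a c"
  "\<lbrakk>a \<in> EOb C; b \<in> EOb C; c \<in> EOb C\<rbrakk> \<Longrightarrow> arr (emu a b c)"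
  by (simp_all add: emu_def ecomp_in_hom)

lemma emu_assoc:
  "\<lbrakk>a \<in> EOb C; b \<in> EOb C; c \<in> EOb C; d \<in> EOb C\<rbrakk>
    \<Longrightarrow> emu a b d \<bullet> (emu b c d \<boxtimes> Idt (EHom C a b)) =
      emu a c d \<bullet> (Idt (EHom C c d) \<boxtimes> emu a b c) \<bullet> al (EHom C c d) (EHom C b c) (EHom C a b)"
  by (rule arrow_eqI) (simp_all add: emu_def al_def ecomp_assoc)

lemma emu_unit:
  "\<lbrakk>a \<in> EOb C; b \<in> EOb C\<rbrakk> \<Longrightarrow> emu a b b \<bullet> (eun b \<boxtimes> Idt (EHom C a b)) = lu (EHom C a b)"
  "\<lbrakk>a \<in> EOb C; b \<in> EOb C\<rbrakk> \<Longrightarrow> emu a a b \<bullet> (Idt (EHom C a b) \<boxtimes> eun a) = ru (EHom C a b)"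
  by (rule arrow_eqI; simp add: emu_def eun_def lu_def ru_def eid_left eid_right)+

text \<open>The usual unit and associativity laws of a left module, for a monoid with several
  objects C. These are the functor laws for C -> A after transposition.\<close>

definition module_action :: "('c \<Rightarrow> 'o) \<Rightarrow> ('c \<Rightarrow> 'c \<Rightarrow> ('o, 'm) arrow) \<Rightarrow> bool" where
  "module_action M m \<longleftrightarrow>
     (\<forall>a\<in>EOb C. M a \<in> Ob A) \<and>
     (\<forall>a\<in>EOb C. \<forall>b\<in>EOb C. \<guillemotleft>m a b : EHom C a b \<otimes>\<^sub>o M a \<rightarrow> M b\<guillemotright>) \<and>
     (\<forall>a\<in>EOb C. m a a \<bullet> (eun a \<boxtimes> Idt (M a)) = lu (M a)) \<and>
     (\<forall>a\<in>EOb C. \<forall>b\<in>EOb C. \<forall>c\<in>EOb C. m a c \<bullet> (emu a b c \<boxtimes> Idt (M a)) =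
        m b c \<bullet> (Idt (EHom C b c) \<boxtimes> m a b) \<bullet> al (EHom C b c) (EHom C a b) (M a))"

abbreviation Mod :: "(('c, 'o, 'm) enr_functor, 'c \<Rightarrow> 'm) cat" where
  "Mod \<equiv> ModCat A C"

definition fharr :: "('c, 'o, 'm) enr_functor \<Rightarrow> 'c \<Rightarrow> 'c \<Rightarrow> ('o, 'm) arrow" where
  "fharr M a b = Arrow (EHom C a b) (ihom A (fob M a) (fob M b)) (fhom M a b)"

definition act :: "('c, 'o, 'm) enr_functor \<Rightarrow> 'c \<Rightarrow> 'c \<Rightarrow> ('o, 'm) arrow" where
  "act M a b = Ev (fob M a) (fob M b) \<bullet> (fharr M a b \<boxtimes> Idt (fob M a))"

text \<open>The restrictions to \<open>EOb C\<close> are forced by \<open>enriched_functor\<close>,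
  which asks for extensional functions.\<close>

definition mk_module :: "('c \<Rightarrow> 'o) \<Rightarrow> ('c \<Rightarrow> 'c \<Rightarrow> ('o, 'm) arrow) \<Rightarrow> ('c, 'o, 'm) enr_functor" where
  "mk_module M m = \<lparr>fob = \<lambda>a\<in>EOb C. M a,
     fhom = \<lambda>a\<in>EOb C. \<lambda>b\<in>EOb C. lab (cur (EHom C a b) (M a) (m a b))\<rparr>"

lemma fharr_simps [simp]: "src (fharr M a b) = EHom C a b" "tgt (fharr M a b) = ihom A (fob M a) (fob M b)"
  by (simp_all add: fharr_def)

lemma act_simps [simp]: "src (act M a b) = EHom C a b \<otimes>\<^sub>o fob M a" "tgt (act M a b) = fob M b"
  by (simp_all add: act_def)

text \<open>The typing part of \<open>enriched_functor\<close>. It is separated because the functor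
  laws can be transposed only once the data are known to be arrows.\<close>

definition premodule :: "('c, 'o, 'm) enr_functor \<Rightarrow> bool" where
  "premodule M \<longleftrightarrow> fob M \<in> EOb C \<rightarrow>\<^sub>E Ob A \<and>
     fhom M \<in> (\<Pi>\<^sub>E a\<in>EOb C. \<Pi>\<^sub>E b\<in>EOb C. Hom A (EHom C a b) (ihom A (fob M a) (fob M b)))"

lemma premodule_fhom:
  "premodule M \<Longrightarrow>
    fhom M \<in> (\<Pi>\<^sub>E a\<in>EOb C. \<Pi>\<^sub>E b\<in>EOb C. Hom A (EHom C a b) (ihom A (fob M a) (fob M b)))"
  by (simp add: premodule_def)

lemma premodule_simps:
  assumes "premodule M" "a \<in> EOb C"
  shows "fob M a \<in> Ob A" "b \<in> EOb C \<Longrightarrow> arr (fharr M a b)" "b \<in> EOb C \<Longrightarrow> arr (act M a b)"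
proof -
  show ob: "fob M a \<in> Ob A"
    using assms by (auto simp: premodule_def)
  assume b: "b \<in> EOb C"
  then have ob': "fob M b \<in> Ob A"
    using assms by (auto simp: premodule_def)
  show "arr (fharr M a b)"
    using PiE_mem[OF PiE_mem[OF premodule_fhom[OF assms(1)] assms(2)] b] ob b ob' assms(2)
    by (simp add: fharr_def)
  then show "arr (act M a b)"
    using ob ob' by (simp add: act_def)
qed

text \<open>Transposition is injective, so each functor law is equivalent to its evaluated form. The
  law for identities becomes the unit law, and by \<open>Ev_self_comp\<close> the law for
  composition becomes associativity.\<close>

lemma module_iff: "M \<in> Ob Mod \<longleftrightarrow> premodule M \<and> module_action (fob M) (act M)"
proof (cases "premodule M")
  case True
  note [simp] = premodule_simps[OF True]
  have un: "fhom M a a \<cdot> eid C a = eid (self_enriched A) (fob M a) \<longleftrightarrow>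
      act M a a \<bullet> (eun a \<boxtimes> Idt (fob M a)) = lu (fob M a)" if [simp]: "a \<in> EOb C" for a
  proof -
    have "fhom M a a \<cdot> eid C a = eid (self_enriched A) (fob M a) \<longleftrightarrow>
        fharr M a a \<bullet> eun a = cur (unit A) (fob M a) (lu (fob M a))"
      by (simp add: fharr_def eun_def cur_def self_enriched_def cmp_Arrow lu_def)
    also have "\<dots> \<longleftrightarrow> Ev (fob M a) (fob M a) \<bullet> ((fharr M a a \<bullet> eun a) \<boxtimes> Idt (fob M a))
        = Ev (fob M a) (fob M a) \<bullet> (cur (unit A) (fob M a) (lu (fob M a)) \<boxtimes> Idt (fob M a))"
      by (auto intro: Ev_inj[where X = "unit A"] simp del: Ev_cur)
    also have "\<dots> \<longleftrightarrow> act M a a \<bullet> (eun a \<boxtimes> Idt (fob M a)) = lu (fob M a)"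
      by (simp add: act_def)
    finally show ?thesis .
  qed
  have mu: "fhom M a c \<cdot> ecomp C a b c =
        ecomp (self_enriched A) (fob M a) (fob M b) (fob M c) \<cdot> (fhom M b c \<otimes>\<^sub>a fhom M a b) \<longleftrightarrow>
      act M a c \<bullet> (emu a b c \<boxtimes> Idt (fob M a)) =
        act M b c \<bullet> (Idt (EHom C b c) \<boxtimes> act M a b) \<bullet> al (EHom C b c) (EHom C a b) (fob M a)"
    if [simp]: "a \<in> EOb C" "b \<in> EOb C" "c \<in> EOb C" for a b c
  proof -
    let ?l = "fharr M a c \<bullet> emu a b c"
    let ?r = "self_comp (fob M a) (fob M b) (fob M c) \<bullet> (fharr M b c \<boxtimes> fharr M a b)"
    have "fhom M a c \<cdot> ecomp C a b c =
        ecomp (self_enriched A) (fob M a) (fob M b) (fob M c) \<cdot> (fhom M b c \<otimes>\<^sub>a fhom M a b) \<longleftrightarrow> ?l = ?r"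
      by (simp add: fharr_def emu_def self_comp_def cmp_Arrow tens_def)
    also have "\<dots> \<longleftrightarrow> Ev (fob M a) (fob M c) \<bullet> (?l \<boxtimes> Idt (fob M a)) = Ev (fob M a) (fob M c) \<bullet> (?r \<boxtimes> Idt (fob M a))"
      by (auto intro: Ev_inj[where X = "EHom C b c \<otimes>\<^sub>o EHom C a b"])
    also have "\<dots> \<longleftrightarrow> act M a c \<bullet> (emu a b c \<boxtimes> Idt (fob M a)) =
        act M b c \<bullet> (Idt (EHom C b c) \<boxtimes> act M a b) \<bullet> al (EHom C b c) (EHom C a b) (fob M a)"
      by (subst Ev_self_comp[where U = "EHom C b c" and V = "EHom C a b"]) (simp_all add: act_def)
    finally show ?thesis .
  qed
  show ?thesis
    using True un mu
    by (simp add: ModCat_def enriched_functor_def premodule_def module_action_def)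
next
  case False
  then show ?thesis
    by (simp add: ModCat_def enriched_functor_def premodule_def) blast
qed

lemma mk_module:
  assumes "module_action M m"
  shows "mk_module M m \<in> Ob Mod"
    and "a \<in> EOb C \<Longrightarrow> fob (mk_module M m) a = M a"
    and "\<lbrakk>a \<in> EOb C; b \<in> EOb C\<rbrakk> \<Longrightarrow> act (mk_module M m) a b = m a b"
proof -
  have [simp]: "M a \<in> Ob A" if "a \<in> EOb C" for a
    using assms that by (simp add: module_action_def)
  have [simp]: "\<guillemotleft>m a b : EHom C a b \<otimes>\<^sub>o M a \<rightarrow> M b\<guillemotright>" if "a \<in> EOb C" "b \<in> EOb C" for a b
    using assms that by (simp add: module_action_def)
  show fob [simp]: "fob (mk_module M m) a = M a" if "a \<in> EOb C" for a
    using that by (simp add: mk_module_def)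
  have "fharr (mk_module M m) a b = cur (EHom C a b) (M a) (m a b)" if "a \<in> EOb C" "b \<in> EOb C" for a b
    using that by (intro arrow_eqI) (simp_all add: fharr_def mk_module_def)
  then show act [simp]: "act (mk_module M m) a b = m a b" if "a \<in> EOb C" "b \<in> EOb C" for a b
    using that by (simp add: act_def)
  have "premodule (mk_module M m)"
    by (auto simp: premodule_def mk_module_def)
  moreover have "module_action (fob (mk_module M m)) (act (mk_module M m))"
    using assms by (simp add: module_action_def)
  ultimately show "mk_module M m \<in> Ob Mod"
    by (simp add: module_iff)
qed

lemma module_simps:
  assumes "M \<in> Ob Mod" "a \<in> EOb C"
  shows "fob M a \<in> Ob A" "b \<in> EOb C \<Longrightarrow> arr (act M a b)"
    and "act M a a \<bullet> (eun a \<boxtimes> Idt (fob M a)) = lu (fob M a)"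
    and "\<lbrakk>b \<in> EOb C; c \<in> EOb C\<rbrakk> \<Longrightarrow> act M a c \<bullet> (emu a b c \<boxtimes> Idt (fob M a)) =
        act M b c \<bullet> (Idt (EHom C b c) \<boxtimes> act M a b) \<bullet> al (EHom C b c) (EHom C a b) (fob M a)"
  using assms premodule_simps by (auto simp: module_iff module_action_def)

text \<open>A module morphism is a bare family of arrows, so the modules must be given to restore
  the end points of a component.\<close>

definition cpt :: "('c, 'o, 'm) enr_functor \<Rightarrow> ('c, 'o, 'm) enr_functor \<Rightarrow> ('c \<Rightarrow> 'm) \<Rightarrow> 'c \<Rightarrow> ('o, 'm) arrow" where
  "cpt M N t c = Arrow (fob M c) (fob N c) (t c)"

lemma cpt_simps [simp]: "src (cpt M N t c) = fob M c" "tgt (cpt M N t c) = fob N c" "lab (cpt M N t c) = t c"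
  by (simp_all add: cpt_def)

text \<open>Both sides of \<open>enriched_natural\<close> are arrows into [M a, N b] and are
  compared after evaluation. The unitors there disappear by \<open>lu_tens\<close> on one side and
  by the triangle on the other, leaving the ordinary commuting square of actions.\<close>

lemma module_hom_iff:
  assumes M: "M \<in> Ob Mod" and N: "N \<in> Ob Mod"
  shows "t \<in> Hom Mod M N \<longleftrightarrow> t \<in> extensional (EOb C) \<and> (\<forall>c\<in>EOb C. arr (cpt M N t c)) \<and>
    (\<forall>a\<in>EOb C. \<forall>b\<in>EOb C. cpt M N t b \<bullet> act M a b = act N a b \<bullet> (Idt (EHom C a b) \<boxtimes> cpt M N t a))"
proof -
  have pre: "premodule M" "premodule N"
    using assms by (simp_all add: module_iff)
  note [simp] = premodule_simps[OF pre(1)] premodule_simps[OF pre(2)]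
  have ext: "t \<in> (\<Pi>\<^sub>E c\<in>EOb C. Hom A (fob M c) (fob N c)) \<longleftrightarrow>
      t \<in> extensional (EOb C) \<and> (\<forall>c\<in>EOb C. arr (cpt M N t c))"
    by (auto simp: cpt_def PiE_def)
  have nat: "(name_arrow A (fob M a) (fob N a) (t a) \<in> Hom A (unit A) (ihom A (fob M a) (fob N a)))"
    if t: "\<forall>c\<in>EOb C. arr (cpt M N t c)" and a: "a \<in> EOb C" for a
  proof -
    have "arr (name (cpt M N t a))" using t a by simp
    then show ?thesis using a by (simp add: name_def)
  qed
  have eq: "ecomp (self_enriched A) (fob M a) (fob M b) (fob N b) \<cdot>
        (name_arrow A (fob M b) (fob N b) (t b) \<otimes>\<^sub>a fhom M a b) \<cdot>
        inv_arrow A (unit A \<otimes>\<^sub>o EHom C a b) (EHom C a b) (lunit A (EHom C a b)) =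
      ecomp (self_enriched A) (fob M a) (fob N a) (fob N b) \<cdot>
        (fhom N a b \<otimes>\<^sub>a name_arrow A (fob M a) (fob N a) (t a)) \<cdot>
        inv_arrow A (EHom C a b \<otimes>\<^sub>o unit A) (EHom C a b) (runit A (EHom C a b)) \<longleftrightarrow>
      cpt M N t b \<bullet> act M a b = act N a b \<bullet> (Idt (EHom C a b) \<boxtimes> cpt M N t a)" (is "?L = ?R \<longleftrightarrow> _")
    if t: "\<forall>c\<in>EOb C. arr (cpt M N t c)" and [simp]: "a \<in> EOb C" "b \<in> EOb C" for a b
  proof -
    have [simp]: "arr (cpt M N t a)" "arr (cpt M N t b)" using t by auto
    let ?H = "EHom C a b"
    let ?Ma = "fob M a" and ?Mb = "fob M b" and ?Na = "fob N a" and ?Nb = "fob N b"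
    let ?nb = "name (cpt M N t b)" and ?na = "name (cpt M N t a)"
    let ?lc = "self_comp ?Ma ?Mb ?Nb \<bullet> (name (cpt M N t b) \<boxtimes> fharr M a b)"
    let ?rc = "self_comp ?Ma ?Na ?Nb \<bullet> (fharr N a b \<boxtimes> name (cpt M N t a))"
    let ?l = "self_comp ?Ma ?Mb ?Nb \<bullet> (?nb \<boxtimes> fharr M a b) \<bullet> lu' ?H"
    let ?r = "self_comp ?Ma ?Na ?Nb \<bullet> (fharr N a b \<boxtimes> ?na) \<bullet> ru' ?H"
    have "?l = Arrow ?H (ihom A ?Ma ?Nb) ?L"
      by (rule arrow_eqI) (simp_all add: self_comp_def name_def fharr_def lu'_def)
    moreover have "?r = Arrow ?H (ihom A ?Ma ?Nb) ?R"
      by (rule arrow_eqI) (simp_all add: self_comp_def name_def fharr_def ru'_def)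
    ultimately have "?L = ?R \<longleftrightarrow> ?l = ?r"
      by simp
    also have "\<dots> \<longleftrightarrow> Ev ?Ma ?Nb \<bullet> (?l \<boxtimes> Idt ?Ma) = Ev ?Ma ?Nb \<bullet> (?r \<boxtimes> Idt ?Ma)"
      by (auto intro: Ev_inj[where X = ?H])
    also have "Ev ?Ma ?Nb \<bullet> (?l \<boxtimes> Idt ?Ma) = cpt M N t b \<bullet> act M a b"
    proof -
      have "Ev ?Ma ?Nb \<bullet> (?l \<boxtimes> Idt ?Ma) = (Ev ?Ma ?Nb \<bullet> (?lc \<boxtimes> Idt ?Ma)) \<bullet> (lu' ?H \<boxtimes> Idt ?Ma)"
        by simp
      also have "\<dots> = ((Ev ?Mb ?Nb \<bullet> (name (cpt M N t b) \<boxtimes> Idt ?Mb)) \<bullet> (Idt (unit A) \<boxtimes> act M a b) \<bullet>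
          al (unit A) ?H ?Ma) \<bullet> (lu' ?H \<boxtimes> Idt ?Ma)"
        by (subst Ev_self_comp[where U = "unit A" and V = ?H]) (simp_all add: act_def)
      also have "\<dots> = cpt M N t b \<bullet> (lu ?Mb \<bullet> (Idt (unit A) \<boxtimes> act M a b)) \<bullet> al (unit A) ?H ?Ma \<bullet> (lu' ?H \<boxtimes> Idt ?Ma)"
        by simp
      also have "\<dots> = (cpt M N t b \<bullet> act M a b) \<bullet> (lu (?H \<otimes>\<^sub>o ?Ma) \<bullet> al (unit A) ?H ?Ma) \<bullet> (lu' ?H \<boxtimes> Idt ?Ma)"
        by (subst lu_natural[of _ "?H \<otimes>\<^sub>o ?Ma"]) simp_all
      also have "\<dots> = cpt M N t b \<bullet> act M a b"
        by (subst lu_tens) simp_all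
      finally show ?thesis .
    qed
    also have "Ev ?Ma ?Nb \<bullet> (?r \<boxtimes> Idt ?Ma) = act N a b \<bullet> (Idt ?H \<boxtimes> cpt M N t a)"
    proof -
      have "Ev ?Ma ?Nb \<bullet> (?r \<boxtimes> Idt ?Ma) = (Ev ?Ma ?Nb \<bullet> (?rc \<boxtimes> Idt ?Ma)) \<bullet> (ru' ?H \<boxtimes> Idt ?Ma)"
        by simp
      also have "\<dots> = (act N a b \<bullet> (Idt ?H \<boxtimes> (Ev ?Ma ?Na \<bullet> (name (cpt M N t a) \<boxtimes> Idt ?Ma))) \<bullet>
          al ?H (unit A) ?Ma) \<bullet> (ru' ?H \<boxtimes> Idt ?Ma)"
        by (subst Ev_self_comp[where U = ?H and V = "unit A"]) (simp_all add: act_def)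
      also have "\<dots> = act N a b \<bullet> (Idt ?H \<boxtimes> cpt M N t a) \<bullet> ((Idt ?H \<boxtimes> lu ?Ma) \<bullet> al ?H (unit A) ?Ma) \<bullet>
          (ru' ?H \<boxtimes> Idt ?Ma)"
        by simp
      also have "\<dots> = act N a b \<bullet> (Idt ?H \<boxtimes> cpt M N t a)"
        by (subst triangle_arrow) simp_all
      finally show ?thesis .
    qed
    finally show ?thesis .
  qed
  show ?thesis
    using nat eq
    by (simp add: ModCat_def enriched_natural_def ext) auto
qed

end

section \<open>Jointly epic families and preadditive categories\<close>

context category
begin

text \<open>The uniqueness half shared by coproducts (the inclusions) and cokernels (a family with
  the single index \<open>()\<close>). Stated for families, it allows one gluing argument to serve
  both colimits.\<close>

definition jointly_epic :: "'i set \<Rightarrow> 'o \<Rightarrow> ('i \<Rightarrow> ('o, 'm) arrow) \<Rightarrow> bool" where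
  "jointly_epic I P \<iota> \<longleftrightarrow> P \<in> Ob C \<and> (\<forall>i\<in>I. arr (\<iota> i) \<and> tgt (\<iota> i) = P) \<and>
     (\<forall>u v. arr u \<and> arr v \<and> src u = P \<and> src v = P \<and> tgt u = tgt v \<and> (\<forall>i\<in>I. u \<bullet> \<iota> i = v \<bullet> \<iota> i)
       \<longrightarrow> u = v)"

lemma jointly_epicD:
  "\<lbrakk>jointly_epic I P \<iota>; \<guillemotleft>u : P \<rightarrow> Y\<guillemotright>; \<guillemotleft>v : P \<rightarrow> Y\<guillemotright>; \<And>i. i \<in> I \<Longrightarrow> u \<bullet> \<iota> i = v \<bullet> \<iota> i\<rbrakk> \<Longrightarrow> u = v"
  unfolding jointly_epic_def by metis

lemma jointly_epic_arr:
  "jointly_epic I P \<iota> \<Longrightarrow> P \<in> Ob C"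
  "\<lbrakk>jointly_epic I P \<iota>; i \<in> I\<rbrakk> \<Longrightarrow> arr (\<iota> i)"
  "\<lbrakk>jointly_epic I P \<iota>; i \<in> I\<rbrakk> \<Longrightarrow> tgt (\<iota> i) = P"
  unfolding jointly_epic_def by blast+

lemma coproduct_arrow:
  assumes "is_coproduct C I X P inc"
  defines "\<iota> \<equiv> \<lambda>i. Arrow (X i) P (inc i)"
  shows "jointly_epic I P \<iota>"
    and "(\<And>i. i \<in> I \<Longrightarrow> \<guillemotleft>f i : X i \<rightarrow> Y\<guillemotright>) \<Longrightarrow> Y \<in> Ob C \<Longrightarrow> \<exists>h. \<guillemotleft>h : P \<rightarrow> Y\<guillemotright> \<and> (\<forall>i\<in>I. h \<bullet> \<iota> i = f i)"
proof -
  have ob: "P \<in> Ob C" "\<And>i. i \<in> I \<Longrightarrow> X i \<in> Ob C" "\<And>i. i \<in> I \<Longrightarrow> inc i \<in> Hom C (X i) P"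
    using assms(1) by (simp_all add: is_coproduct_def)
  have ex1: "\<exists>!h. h \<in> Hom C P Y \<and> (\<forall>i\<in>I. h \<cdot> inc i = f i)"
    if "Y \<in> Ob C" "\<And>i. i \<in> I \<Longrightarrow> f i \<in> Hom C (X i) Y" for Y f
    using assms(1) that by (simp add: is_coproduct_def)
  show "jointly_epic I P \<iota>"
    unfolding jointly_epic_def
  proof (intro conjI allI impI ballI)
    fix u v
    assume uv: "arr u \<and> arr v \<and> src u = P \<and> src v = P \<and> tgt u = tgt v \<and> (\<forall>i\<in>I. u \<bullet> \<iota> i = v \<bullet> \<iota> i)"
    have *: "lab u \<cdot> inc i = lab v \<cdot> inc i" "lab u \<cdot> inc i \<in> Hom C (X i) (tgt u)" if "i \<in> I" for i
    proof -
      have "lab (u \<bullet> \<iota> i) = lab (v \<bullet> \<iota> i)" using uv that by simp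
      then show "lab u \<cdot> inc i = lab v \<cdot> inc i" by (simp add: \<iota>_def)
      have "lab (u \<bullet> \<iota> i) \<in> Hom C (X i) (tgt u)"
        using uv that ob by (intro arr_lab) (auto simp: \<iota>_def)
      then show "lab u \<cdot> inc i \<in> Hom C (X i) (tgt u)" by (simp add: \<iota>_def)
    qed
    have "tgt u \<in> Ob C" using uv by simp
    from ex1[OF this *(2)] have "lab u = lab v"
      using uv *(1) by (metis arr_lab)
    then show "u = v" using uv by (intro arrow_eqI) auto
  qed (simp_all add: \<iota>_def ob)
  show "\<exists>h. \<guillemotleft>h : P \<rightarrow> Y\<guillemotright> \<and> (\<forall>i\<in>I. h \<bullet> \<iota> i = f i)"
    if f: "\<And>i. i \<in> I \<Longrightarrow> \<guillemotleft>f i : X i \<rightarrow> Y\<guillemotright>" and Y: "Y \<in> Ob C"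
  proof -
    obtain h where h: "h \<in> Hom C P Y" "\<forall>i\<in>I. h \<cdot> inc i = lab (f i)"
      using ex1[of Y "\<lambda>i. lab (f i)"] f Y by auto
    have "Arrow P Y h \<bullet> \<iota> i = f i" if "i \<in> I" for i
      using h that f[OF that] by (intro arrow_eqI) (simp_all add: \<iota>_def)
    then show ?thesis
      using h Y ob by (intro exI[of _ "Arrow P Y h"]) simp
  qed
qed

text \<open>Lift the restriction to each summand and glue the lifts; the resulting triangle commutes
  because it does so on every inclusion.\<close>

lemma projective_coproduct:
  assumes cop: "is_coproduct C I X P inc" and proj: "\<And>i. i \<in> I \<Longrightarrow> projective C (X i)"
  shows "projective C P"
  unfolding projective_def
proof (intro conjI ballI allI impI)
  show P: "P \<in> Ob C" using cop by (simp add: is_coproduct_def)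
  fix U V e f
  assume U: "U \<in> Ob C" and V: "V \<in> Ob C" and ef: "is_epi C U V e \<and> f \<in> Hom C P V"
  then have e: "e \<in> Hom C U V" by (simp add: is_epi_def)
  let ?\<iota> = "\<lambda>i. Arrow (X i) P (inc i)" and ?e = "Arrow U V e" and ?f = "Arrow P V f"
  have inc: "X i \<in> Ob C" "inc i \<in> Hom C (X i) P" if "i \<in> I" for i
    using cop that by (simp_all add: is_coproduct_def)
  have "\<exists>g. \<guillemotleft>g : X i \<rightarrow> U\<guillemotright> \<and> ?e \<bullet> g = ?f \<bullet> ?\<iota> i" if i: "i \<in> I" for i
  proof -
    have "f \<cdot> inc i \<in> Hom C (X i) V"
      using comp_in_hom[of "X i" P V "inc i" f] inc[OF i] P V ef by simp
    then obtain g where "g \<in> Hom C (X i) U" "e \<cdot> g = f \<cdot> inc i"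
      using proj[OF i] U V ef unfolding projective_def by blast
    then show ?thesis
      using inc[OF i] U by (intro exI[of _ "Arrow (X i) U g"]) (simp add: cmp_Arrow)
  qed
  then obtain g where g: "\<And>i. i \<in> I \<Longrightarrow> \<guillemotleft>g i : X i \<rightarrow> U\<guillemotright>" "\<And>i. i \<in> I \<Longrightarrow> ?e \<bullet> g i = ?f \<bullet> ?\<iota> i"
    by metis
  obtain h where h: "\<guillemotleft>h : P \<rightarrow> U\<guillemotright>" "\<And>i. i \<in> I \<Longrightarrow> h \<bullet> ?\<iota> i = g i"
    using coproduct_arrow(2)[OF cop g(1) U] by auto
  have "?e \<bullet> h = ?f"
  proof (rule jointly_epicD[OF coproduct_arrow(1)[OF cop], where Y = V])
    show "(?e \<bullet> h) \<bullet> ?\<iota> i = ?f \<bullet> ?\<iota> i" if "i \<in> I" for i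
      using that h U V e inc P g(2) by simp
  qed (use h U V e ef P in simp_all)
  then have "e \<cdot> lab h = f"
    by (metis arrow.sel(3) lab_cmp)
  then show "\<exists>g\<in>Hom C P U. e \<cdot> g = f"
    using h by (intro bexI[of _ "lab h"]) simp_all
qed

text \<open>A lift g of f r along e gives the lift g s of f, since e g s = f r s = f.\<close>

lemma projective_retract:
  assumes "projective C P" "M \<in> Ob C" "s \<in> Hom C M P" "r \<in> Hom C P M" "r \<cdot> s = idm C M"
  shows "projective C M"
  unfolding projective_def
proof (intro conjI ballI allI impI)
  fix U V e f
  assume U: "U \<in> Ob C" and V: "V \<in> Ob C" and ef: "is_epi C U V e \<and> f \<in> Hom C M V"
  have P: "P \<in> Ob C" using assms(1) by (simp add: projective_def)
  have e: "e \<in> Hom C U V" using ef by (simp add: is_epi_def)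
  have "f \<cdot> r \<in> Hom C P V"
    using comp_in_hom[of P M V r f] assms P V ef by simp
  then obtain g where g: "g \<in> Hom C P U" "e \<cdot> g = f \<cdot> r"
    using assms(1) U V ef unfolding projective_def by blast
  have "Arrow U V e \<bullet> Arrow P U g \<bullet> Arrow M P s = (Arrow U V e \<bullet> Arrow P U g) \<bullet> Arrow M P s"
    using U V e P g assms by simp
  also have "\<dots> = (Arrow M V f \<bullet> Arrow P M r) \<bullet> Arrow M P s"
    using g(2) by (simp add: cmp_Arrow)
  also have "\<dots> = Arrow M V f \<bullet> (Arrow P M r \<bullet> Arrow M P s)"
    using V P assms ef by simp
  also have "Arrow P M r \<bullet> Arrow M P s = Idt M"
    using assms by (simp add: cmp_Arrow Idt_def)
  also have "Arrow M V f \<bullet> Idt M = Arrow M V f"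
    using V assms ef by simp
  finally have "e \<cdot> (g \<cdot> s) = f"
    by (simp add: cmp_Arrow)
  moreover have "g \<cdot> s \<in> Hom C M U"
    using comp_in_hom[of M P U s g] assms P U g by simp
  ultimately show "\<exists>g\<in>Hom C M U. e \<cdot> g = f" by blast
qed (fact assms(2))

end

text \<open>An abelian category only asserts that some additive structure exists; here one is fixed.
  The zero object is what relates its neutral elements to \<open>zero_arrow\<close>, which is
  defined by factorisation.\<close>

locale preadditive_category = category C
  for C :: "('o, 'm, 'x) cat_scheme" (structure) +
  fixes add :: "'o \<Rightarrow> 'o \<Rightarrow> 'm \<Rightarrow> 'm \<Rightarrow> 'm" and zero :: "'o \<Rightarrow> 'o \<Rightarrow> 'm"
  assumes preadditive: "preadditive C add zero"
    and zero_ob: "\<exists>Z. zero_object C Z"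
begin

notation cmp  (infixr "\<bullet>" 70)
notation in_hom  ("\<guillemotleft>_ : _ \<rightarrow> _\<guillemotright>")

definition plus :: "('o, 'm) arrow \<Rightarrow> ('o, 'm) arrow \<Rightarrow> ('o, 'm) arrow"  (infixl "\<^bold>+" 65) where
  "f \<^bold>+ g = Arrow (src f) (tgt f) (add (src f) (tgt f) (lab f) (lab g))"

definition Zer :: "'o \<Rightarrow> 'o \<Rightarrow> ('o, 'm) arrow" where
  "Zer X Y = Arrow X Y (zero X Y)"

lemma hom_group:
  "\<lbrakk>X \<in> Ob C; Y \<in> Ob C\<rbrakk> \<Longrightarrow> group \<lparr>carrier = Hom C X Y, mult = add X Y, one = zero X Y\<rparr>"
  using preadditive by (simp add: preadditive_def comm_group_def)

lemma plus_simps [simp]: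
  "src (f \<^bold>+ g) = src f" "tgt (f \<^bold>+ g) = tgt f"
  "\<lbrakk>arr f; arr g; src g = src f; tgt g = tgt f\<rbrakk> \<Longrightarrow> arr (f \<^bold>+ g)"
proof -
  assume "arr f" "arr g" "src g = src f" "tgt g = tgt f"
  then show "arr (f \<^bold>+ g)"
    using hom_group[of "src f" "tgt f"]
    by (auto simp: plus_def group_def monoid_def)
qed (simp_all add: plus_def)

lemma Zer_simps [simp]:
  "src (Zer X Y) = X" "tgt (Zer X Y) = Y" "\<lbrakk>X \<in> Ob C; Y \<in> Ob C\<rbrakk> \<Longrightarrow> arr (Zer X Y)"
proof -
  assume "X \<in> Ob C" "Y \<in> Ob C"
  then show "arr (Zer X Y)"
    using hom_group[of X Y] by (simp add: Zer_def group_def monoid_def)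
qed (simp_all add: Zer_def)

lemma plus_assoc:
  assumes "\<guillemotleft>f : X \<rightarrow> Y\<guillemotright>" "\<guillemotleft>g : X \<rightarrow> Y\<guillemotright>" "\<guillemotleft>h : X \<rightarrow> Y\<guillemotright>"
  shows "(f \<^bold>+ g) \<^bold>+ h = f \<^bold>+ (g \<^bold>+ h)"
proof -
  have "X \<in> Ob C" "Y \<in> Ob C" using assms by auto
  from hom_group[OF this] show ?thesis
    using assms by (simp add: plus_def group_def monoid_def)
qed

lemma plus_commute:
  assumes "\<guillemotleft>f : X \<rightarrow> Y\<guillemotright>" "\<guillemotleft>g : X \<rightarrow> Y\<guillemotright>"
  shows "f \<^bold>+ g = g \<^bold>+ f"
proof -
  have ob: "X \<in> Ob C" "Y \<in> Ob C" and "lab f \<in> Hom C X Y" "lab g \<in> Hom C X Y" using assms by auto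
  then have "add X Y (lab f) (lab g) = add X Y (lab g) (lab f)"
    using preadditive comm_groupE(4)[of "\<lparr>carrier = Hom C X Y, mult = add X Y, one = zero X Y\<rparr>"]
    by (simp add: preadditive_def)
  then show ?thesis
    using assms by (simp add: plus_def)
qed

lemma plus_Zer [simp]:
  assumes "\<guillemotleft>f : X \<rightarrow> Y\<guillemotright>"
  shows "f \<^bold>+ Zer X Y = f" "Zer X Y \<^bold>+ f = f"
proof -
  have "X \<in> Ob C" "Y \<in> Ob C" using assms by auto
  from hom_group[OF this] show "f \<^bold>+ Zer X Y = f" "Zer X Y \<^bold>+ f = f"
    using assms by (cases f; simp add: plus_def Zer_def group_def monoid_def)+
qed

lemma ex_minus:
  assumes "\<guillemotleft>f : X \<rightarrow> Y\<guillemotright>"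
  obtains g where "\<guillemotleft>g : X \<rightarrow> Y\<guillemotright>" "f \<^bold>+ g = Zer X Y" "g \<^bold>+ f = Zer X Y"
proof -
  have ob: "X \<in> Ob C" "Y \<in> Ob C" using assms by auto
  let ?G = "\<lparr>carrier = Hom C X Y, mult = add X Y, one = zero X Y\<rparr>"
  have G: "group ?G" using hom_group[OF ob] .
  have f: "lab f \<in> Hom C X Y" using assms by simp
  let ?g = "Arrow X Y (inv\<^bsub>?G\<^esub> lab f)"
  have "inv\<^bsub>?G\<^esub> lab f \<in> Hom C X Y"
    using group.inv_closed[OF G, of "lab f"] f by simp
  moreover have "add X Y (lab f) (inv\<^bsub>?G\<^esub> lab f) = zero X Y"
    using group.r_inv[OF G, of "lab f"] f by simp
  moreover have "add X Y (inv\<^bsub>?G\<^esub> lab f) (lab f) = zero X Y"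
    using group.l_inv[OF G, of "lab f"] f by simp
  ultimately show thesis
    using assms ob by (intro that[of ?g]) (simp_all add: plus_def Zer_def)
qed

lemma plus_right_cancel:
  assumes "f \<^bold>+ h = g \<^bold>+ h" "\<guillemotleft>f : X \<rightarrow> Y\<guillemotright>" "\<guillemotleft>g : X \<rightarrow> Y\<guillemotright>" "\<guillemotleft>h : X \<rightarrow> Y\<guillemotright>"
  shows "f = g"
proof -
  obtain k where k: "\<guillemotleft>k : X \<rightarrow> Y\<guillemotright>" "h \<^bold>+ k = Zer X Y"
    using ex_minus[OF assms(4)] .
  have "(f \<^bold>+ h) \<^bold>+ k = (g \<^bold>+ h) \<^bold>+ k" using assms(1) by simp
  then show ?thesis
    using plus_assoc[OF assms(2,4) k(1)] plus_assoc[OF assms(3,4) k(1)] k(2) assms(2,3) by simp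
qed

text \<open>Stands in for subtraction: differences are used only through the equation d + f = g, so
  no operation for them is introduced.\<close>

lemma ex_diff:
  assumes "\<guillemotleft>f : X \<rightarrow> Y\<guillemotright>" "\<guillemotleft>g : X \<rightarrow> Y\<guillemotright>"
  obtains d where "\<guillemotleft>d : X \<rightarrow> Y\<guillemotright>" "d \<^bold>+ f = g"
proof -
  obtain k where k: "\<guillemotleft>k : X \<rightarrow> Y\<guillemotright>" "k \<^bold>+ f = Zer X Y"
    using ex_minus[OF assms(1)] by blast
  show thesis
    using assms k plus_assoc[OF assms(2) k(1) assms(1)] by (intro that[of "g \<^bold>+ k"]) simp_all
qed

lemma cmp_plus:
  assumes "\<guillemotleft>f : X \<rightarrow> Y\<guillemotright>" "\<guillemotleft>f' : X \<rightarrow> Y\<guillemotright>" "\<guillemotleft>g : Y \<rightarrow> Z\<guillemotright>"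
  shows "g \<bullet> (f \<^bold>+ f') = g \<bullet> f \<^bold>+ g \<bullet> f'"
proof -
  have "X \<in> Ob C" "Y \<in> Ob C" "Z \<in> Ob C" "lab f \<in> Hom C X Y" "lab f' \<in> Hom C X Y" "lab g \<in> Hom C Y Z"
    using assms by auto
  then have "lab g \<cdot> add X Y (lab f) (lab f') = add X Z (lab g \<cdot> lab f) (lab g \<cdot> lab f')"
    using preadditive unfolding preadditive_def by blast
  then show ?thesis
    using assms by (simp add: plus_def cmp_def)
qed

lemma plus_cmp:
  assumes "\<guillemotleft>f : X \<rightarrow> Y\<guillemotright>" "\<guillemotleft>g : Y \<rightarrow> Z\<guillemotright>" "\<guillemotleft>g' : Y \<rightarrow> Z\<guillemotright>"
  shows "(g \<^bold>+ g') \<bullet> f = g \<bullet> f \<^bold>+ g' \<bullet> f"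
proof -
  have "X \<in> Ob C" "Y \<in> Ob C" "Z \<in> Ob C" "lab f \<in> Hom C X Y" "lab g \<in> Hom C Y Z" "lab g' \<in> Hom C Y Z"
    using assms by auto
  then have "add Y Z (lab g) (lab g') \<cdot> lab f = add X Z (lab g \<cdot> lab f) (lab g' \<cdot> lab f)"
    using preadditive unfolding preadditive_def by blast
  then show ?thesis
    using assms by (simp add: plus_def cmp_def)
qed

text \<open>The only idempotent of a group is its neutral element. With bilinearity this yields that
  composites with zero arrows are zero.\<close>

lemma plus_self_eq_Zer:
  assumes "f \<^bold>+ f = f" "\<guillemotleft>f : X \<rightarrow> Y\<guillemotright>"
  shows "f = Zer X Y"
proof (rule plus_right_cancel)
  show "f \<^bold>+ f = Zer X Y \<^bold>+ f" using assms by simp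
qed (use assms in auto)

lemma cmp_Zer [simp]:
  assumes "X \<in> Ob C" "\<guillemotleft>g : Y \<rightarrow> Z\<guillemotright>"
  shows "g \<bullet> Zer X Y = Zer X Z"
proof (rule plus_self_eq_Zer)
  have "Y \<in> Ob C" using assms by auto
  then show "g \<bullet> Zer X Y \<^bold>+ g \<bullet> Zer X Y = g \<bullet> Zer X Y"
    using cmp_plus[of "Zer X Y" X Y "Zer X Y" g Z] assms by simp
qed (use assms in auto)

lemma Zer_cmp [simp]:
  assumes "Z \<in> Ob C" "\<guillemotleft>f : X \<rightarrow> Y\<guillemotright>"
  shows "Zer Y Z \<bullet> f = Zer X Z"
proof (rule plus_self_eq_Zer)
  have "Y \<in> Ob C" using assms by auto
  then show "Zer Y Z \<bullet> f \<^bold>+ Zer Y Z \<bullet> f = Zer Y Z \<bullet> f"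
    using plus_cmp[of f X Y "Zer Y Z" Z "Zer Y Z"] assms by simp
qed (use assms in auto)

lemma zero_object_arrow:
  assumes "zero_object C Z"
  shows "\<guillemotleft>f : X \<rightarrow> Z\<guillemotright> \<Longrightarrow> f = Zer X Z" "\<guillemotleft>f : Z \<rightarrow> X\<guillemotright> \<Longrightarrow> f = Zer Z X"
proof -
  have Z: "Z \<in> Ob C" using assms by (simp add: zero_object_def)
  have 1: "\<exists>!f. f \<in> Hom C X Z" "\<exists>!f. f \<in> Hom C Z X" if "X \<in> Ob C" for X
    using assms that by (simp_all add: zero_object_def)
  show "f = Zer X Z" if f: "\<guillemotleft>f : X \<rightarrow> Z\<guillemotright>"
  proof (rule arrow_eqI)
    have X: "X \<in> Ob C" using f by auto
    have "lab f \<in> Hom C X Z" "lab (Zer X Z) \<in> Hom C X Z"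
      using f X Z by (auto intro: arr_lab)
    then show "lab f = lab (Zer X Z)" using 1(1)[OF X] by blast
  qed (use f in simp_all)
  show "f = Zer Z X" if f: "\<guillemotleft>f : Z \<rightarrow> X\<guillemotright>"
  proof (rule arrow_eqI)
    have X: "X \<in> Ob C" using f by auto
    have "lab f \<in> Hom C Z X" "lab (Zer Z X) \<in> Hom C Z X"
      using f X Z by (auto intro: arr_lab)
    then show "lab f = lab (Zer Z X)" using 1(2)[OF X] by blast
  qed (use f in simp_all)
qed

text \<open>A hom-set into or out of a zero object is a singleton, so its arrow is the neutral
  element; composition then carries this to every factorisation through the zero object.\<close>

lemma zero_arrow_iff:
  assumes "X \<in> Ob C" "Y \<in> Ob C"
  shows "zero_arrow C X Y f \<longleftrightarrow> Arrow X Y f = Zer X Y"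
proof
  assume "zero_arrow C X Y f"
  then obtain Z u v where Z: "zero_object C Z" and u: "u \<in> Hom C X Z" and v: "v \<in> Hom C Z Y" and f: "f = v \<cdot> u"
    by (auto simp: zero_arrow_def)
  have ZO: "Z \<in> Ob C" using Z by (simp add: zero_object_def)
  have "Arrow Z Y v = Zer Z Y"
    using v ZO assms by (intro zero_object_arrow(2)[OF Z]) simp
  moreover have "Arrow X Y f = Arrow Z Y v \<bullet> Arrow X Z u"
    using f by (simp add: cmp_Arrow)
  ultimately show "Arrow X Y f = Zer X Y"
    using u ZO assms by simp
next
  assume f: "Arrow X Y f = Zer X Y"
  obtain Z where Z: "zero_object C Z" using zero_ob by blast
  then have ZO: "Z \<in> Ob C" by (simp add: zero_object_def)
  have "Arrow X Y f = Zer Z Y \<bullet> Zer X Z"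
    using f ZO assms by simp
  then have "f = lab (Zer Z Y) \<cdot> lab (Zer X Z)"
    by (metis arrow.sel(3) lab_cmp)
  moreover have "lab (Zer X Z) \<in> Hom C X Z" "lab (Zer Z Y) \<in> Hom C Z Y"
    using ZO assms by (simp_all)
  ultimately show "zero_arrow C X Y f"
    using Z unfolding zero_arrow_def by blast
qed

lemma cokernel_arrow:
  assumes cok: "is_cokernel C X Y f Q q" and X: "X \<in> Ob C" and Y: "Y \<in> Ob C" and f: "f \<in> Hom C X Y"
  shows "\<guillemotleft>Arrow Y Q q : Y \<rightarrow> Q\<guillemotright>"
    and "Arrow Y Q q \<bullet> Arrow X Y f = Zer X Q"
    and "\<lbrakk>\<guillemotleft>u : Y \<rightarrow> W\<guillemotright>; u \<bullet> Arrow X Y f = Zer X W\<rbrakk> \<Longrightarrow> \<exists>h. \<guillemotleft>h : Q \<rightarrow> W\<guillemotright> \<and> h \<bullet> Arrow Y Q q = u"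
    and "jointly_epic {()} Q (\<lambda>_. Arrow Y Q q)"
proof -
  have Q: "Q \<in> Ob C" "q \<in> Hom C Y Q" "zero_arrow C X Q (q \<cdot> f)"
    using cok by (simp_all add: is_cokernel_def)
  have ex1: "\<exists>!h. h \<in> Hom C Q W \<and> h \<cdot> q = u"
    if "W \<in> Ob C" "u \<in> Hom C Y W" "zero_arrow C X W (u \<cdot> f)" for W u
    using cok that by (simp add: is_cokernel_def)
  show q: "\<guillemotleft>Arrow Y Q q : Y \<rightarrow> Q\<guillemotright>"
    using Q Y by simp
  show qf: "Arrow Y Q q \<bullet> Arrow X Y f = Zer X Q"
    using Q X by (simp add: zero_arrow_iff cmp_Arrow)
  show "\<exists>h. \<guillemotleft>h : Q \<rightarrow> W\<guillemotright> \<and> h \<bullet> Arrow Y Q q = u" if u: "\<guillemotleft>u : Y \<rightarrow> W\<guillemotright>" and uf: "u \<bullet> Arrow X Y f = Zer X W"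
  proof -
    have W: "W \<in> Ob C" using u by auto
    have "Arrow X W (lab u \<cdot> f) = u \<bullet> Arrow X Y f"
      using u by (simp add: cmp_def)
    then have "zero_arrow C X W (lab u \<cdot> f)"
      using uf X W by (simp add: zero_arrow_iff)
    then obtain h where "h \<in> Hom C Q W" "h \<cdot> q = lab u"
      using ex1[OF W, of "lab u"] u by auto
    then show ?thesis
      using Q W u by (intro exI[of _ "Arrow Q W h"]) (auto intro: arrow_eqI)
  qed
  show "jointly_epic {()} Q (\<lambda>_. Arrow Y Q q)"
    unfolding jointly_epic_def
  proof (intro conjI allI impI ballI)
    fix u v
    assume uv: "arr u \<and> arr v \<and> src u = Q \<and> src v = Q \<and> tgt u = tgt v \<and>
      (\<forall>i\<in>{()}. u \<bullet> Arrow Y Q q = v \<bullet> Arrow Y Q q)"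
    let ?W = "tgt u"
    have W: "?W \<in> Ob C" using uv by simp
    have "lab u \<cdot> q \<in> Hom C Y ?W"
      using comp_in_hom[of Y Q ?W q "lab u"] uv Y Q W by simp
    moreover have "zero_arrow C X ?W ((lab u \<cdot> q) \<cdot> f)"
    proof -
      have "(u \<bullet> Arrow Y Q q) \<bullet> Arrow X Y f = Zer X ?W"
        using uv Q X Y f qf by simp
      moreover have "(u \<bullet> Arrow Y Q q) \<bullet> Arrow X Y f = Arrow X ?W ((lab u \<cdot> q) \<cdot> f)"
        by (simp add: cmp_def)
      ultimately show ?thesis
        using X W by (simp add: zero_arrow_iff)
    qed
    moreover have "lab v \<cdot> q = lab u \<cdot> q"
      using uv by (metis arrow.sel(3) lab_cmp singletonI)
    moreover have "lab u \<in> Hom C Q ?W" "lab v \<in> Hom C Q ?W"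
      using uv by simp_all
    ultimately have "lab u = lab v"
      using ex1[OF W, of "lab u \<cdot> q"] by blast
    then show "u = v" using uv by (intro arrow_eqI) auto
  qed (use Q Y in simp_all)
qed

end

section \<open>Colimits preserved by tensoring\<close>

context symmetric_monoidal_closed_category
begin

text \<open>Left adjoints preserve jointly epic families: arrows out of B \<otimes> P that agree on
  the family have transposes out of P that agree on the original family.\<close>

lemma tens_jointly_epic:
  assumes epi: "jointly_epic I P \<iota>" and B [simp]: "B \<in> Ob A"
  shows "jointly_epic I (B \<otimes>\<^sub>o P) (\<lambda>i. Idt B \<boxtimes> \<iota> i)"
proof -
  have P [simp]: "P \<in> Ob A" using epi by (rule jointly_epic_arr)
  have \<iota>: "arr (\<iota> i)" "tgt (\<iota> i) = P" if "i \<in> I" for i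
    using jointly_epic_arr(2,3)[OF epi that] .
  have eq: "u = v"
    if u: "\<guillemotleft>u : B \<otimes>\<^sub>o P \<rightarrow> W\<guillemotright>" and v: "\<guillemotleft>v : B \<otimes>\<^sub>o P \<rightarrow> W\<guillemotright>"
      and uv: "\<And>i. i \<in> I \<Longrightarrow> u \<bullet> (Idt B \<boxtimes> \<iota> i) = v \<bullet> (Idt B \<boxtimes> \<iota> i)" for u v W
  proof -
    have W [simp]: "W \<in> Ob A" using u by auto
    obtain u' where u': "\<guillemotleft>u' : P \<rightarrow> ihom A B W\<guillemotright>" "lev B W \<bullet> (Idt B \<boxtimes> u') = u"
      using lev_surj[OF u B P] .
    obtain v' where v': "\<guillemotleft>v' : P \<rightarrow> ihom A B W\<guillemotright>" "lev B W \<bullet> (Idt B \<boxtimes> v') = v"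
      using lev_surj[OF v B P] .
    have "u' = v'"
    proof (rule jointly_epicD[OF epi u'(1) v'(1)])
      fix i assume i: "i \<in> I"
      have "(lev B W \<bullet> (Idt B \<boxtimes> u')) \<bullet> (Idt B \<boxtimes> \<iota> i) = (lev B W \<bullet> (Idt B \<boxtimes> v')) \<bullet> (Idt B \<boxtimes> \<iota> i)"
        unfolding u'(2) v'(2) by (rule uv[OF i])
      then have "lev B W \<bullet> (Idt B \<boxtimes> (u' \<bullet> \<iota> i)) = lev B W \<bullet> (Idt B \<boxtimes> (v' \<bullet> \<iota> i))"
        using u'(1) v'(1) \<iota>[OF i] by simp
      then show "u' \<bullet> \<iota> i = v' \<bullet> \<iota> i"
        by (rule lev_inj[of _ "src (\<iota> i)" B W, rotated -1]) (use u'(1) v'(1) \<iota>[OF i] in simp_all)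
    qed
    then show ?thesis using u'(2) v'(2) by simp
  qed
  show ?thesis
    unfolding jointly_epic_def using \<iota> eq by auto
qed

text \<open>Only existence is at stake, uniqueness being \<open>tens_jointly_epic\<close>: transpose
  the given arrows, glue them out of P, and transpose back.\<close>

lemma tens_coproduct:
  assumes cop: "is_coproduct A I X P inc" and [simp]: "B \<in> Ob A" "Z \<in> Ob A"
    and f: "\<And>i. i \<in> I \<Longrightarrow> \<guillemotleft>f i : B \<otimes>\<^sub>o X i \<rightarrow> Z\<guillemotright>"
  obtains h where "\<guillemotleft>h : B \<otimes>\<^sub>o P \<rightarrow> Z\<guillemotright>" "\<And>i. i \<in> I \<Longrightarrow> h \<bullet> (Idt B \<boxtimes> Arrow (X i) P (inc i)) = f i"
proof -
  have ob [simp]: "P \<in> Ob A" "\<And>i. i \<in> I \<Longrightarrow> X i \<in> Ob A" "\<And>i. i \<in> I \<Longrightarrow> inc i \<in> Hom A (X i) P"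
    using cop by (simp_all add: is_coproduct_def)
  have "\<exists>g. \<guillemotleft>g : X i \<rightarrow> ihom A B Z\<guillemotright> \<and> lev B Z \<bullet> (Idt B \<boxtimes> g) = f i" if "i \<in> I" for i
    using lev_surj[OF f[OF that]] that by (metis \<open>B \<in> Ob A\<close> ob)
  then obtain g where g: "\<And>i. i \<in> I \<Longrightarrow> \<guillemotleft>g i : X i \<rightarrow> ihom A B Z\<guillemotright>"
      "\<And>i. i \<in> I \<Longrightarrow> lev B Z \<bullet> (Idt B \<boxtimes> g i) = f i"
    by metis
  obtain h where h: "\<guillemotleft>h : P \<rightarrow> ihom A B Z\<guillemotright>" "\<forall>i\<in>I. h \<bullet> Arrow (X i) P (inc i) = g i"
    using coproduct_arrow(2)[OF cop g(1)] by auto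
  show thesis
    using h g by (intro that[of "lev B Z \<bullet> (Idt B \<boxtimes> h)"]) simp_all
qed

end

section \<open>Tensoring, zero arrows and cokernels\<close>

locale preadditive_closed = symmetric_monoidal_closed_category A + preadditive_category A add zero
  for A :: "('o, 'm, 'x) smc_cat_scheme" (structure) and add zero
begin

notation cmp  (infixr "\<bullet>" 70)
notation in_hom  ("\<guillemotleft>_ : _ \<rightarrow> _\<guillemotright>")
notation tens  (infixr "\<boxtimes>" 75)
notation plus  (infixl "\<^bold>+" 65)

text \<open>Arrows out of B \<otimes> Z correspond to arrows out of Z, so for a zero object Z there
  is only one with a given target. An arbitrary zero arrow is then factored through Z.\<close>

lemma tens_Zer [simp]:
  assumes [simp]: "B \<in> Ob A" "X \<in> Ob A" "Y \<in> Ob A"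
  shows "Idt B \<boxtimes> Zer X Y = Zer (B \<otimes>\<^sub>o X) (B \<otimes>\<^sub>o Y)"
proof -
  obtain Z where Z: "zero_object A Z" using zero_ob by blast
  then have [simp]: "Z \<in> Ob A" by (simp add: zero_object_def)
  have "Idt B \<boxtimes> Zer Z Y = Zer (B \<otimes>\<^sub>o Z) (B \<otimes>\<^sub>o Y)"
  proof -
    obtain u where u: "\<guillemotleft>u : Z \<rightarrow> ihom A B (B \<otimes>\<^sub>o Y)\<guillemotright>" "lev B (B \<otimes>\<^sub>o Y) \<bullet> (Idt B \<boxtimes> u) = Idt B \<boxtimes> Zer Z Y"
      using lev_surj[of "Idt B \<boxtimes> Zer Z Y" B Z "B \<otimes>\<^sub>o Y"] by auto
    obtain v where v: "\<guillemotleft>v : Z \<rightarrow> ihom A B (B \<otimes>\<^sub>o Y)\<guillemotright>"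
        "lev B (B \<otimes>\<^sub>o Y) \<bullet> (Idt B \<boxtimes> v) = Zer (B \<otimes>\<^sub>o Z) (B \<otimes>\<^sub>o Y)"
      using lev_surj[of "Zer (B \<otimes>\<^sub>o Z) (B \<otimes>\<^sub>o Y)" B Z "B \<otimes>\<^sub>o Y"] by auto
    have "u = v"
      using zero_object_arrow(2)[OF Z u(1)] zero_object_arrow(2)[OF Z v(1)] by simp
    then show ?thesis using u v by simp
  qed
  then have "(Idt B \<boxtimes> Zer Z Y) \<bullet> (Idt B \<boxtimes> Zer X Z) = Zer (B \<otimes>\<^sub>o X) (B \<otimes>\<^sub>o Y)"
    by (simp del: tens_cmp)
  then show ?thesis by simp
qed

text \<open>The transpose of u kills f, by \<open>tens_Zer\<close> and injectivity of transposition,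
  hence factors through q; transposing the factor back gives h.\<close>

lemma tens_cokernel:
  assumes cok: "is_cokernel A X Y f Q q" and [simp]: "X \<in> Ob A" "Y \<in> Ob A" "f \<in> Hom A X Y" "B \<in> Ob A"
    and u: "\<guillemotleft>u : B \<otimes>\<^sub>o Y \<rightarrow> W\<guillemotright>" "u \<bullet> (Idt B \<boxtimes> Arrow X Y f) = Zer (B \<otimes>\<^sub>o X) W"
  obtains h where "\<guillemotleft>h : B \<otimes>\<^sub>o Q \<rightarrow> W\<guillemotright>" "h \<bullet> (Idt B \<boxtimes> Arrow Y Q q) = u"
proof -
  have [simp]: "W \<in> Ob A" using u by auto
  have [simp]: "Q \<in> Ob A" "q \<in> Hom A Y Q" using cok by (simp_all add: is_cokernel_def)
  obtain u' where u': "\<guillemotleft>u' : Y \<rightarrow> ihom A B W\<guillemotright>" "lev B W \<bullet> (Idt B \<boxtimes> u') = u"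
    using lev_surj[OF u(1)] by auto
  have "(lev B W \<bullet> (Idt B \<boxtimes> u')) \<bullet> (Idt B \<boxtimes> Arrow X Y f) = Zer (B \<otimes>\<^sub>o X) W"
    unfolding u'(2) by (rule u(2))
  then have "lev B W \<bullet> (Idt B \<boxtimes> (u' \<bullet> Arrow X Y f)) = lev B W \<bullet> (Idt B \<boxtimes> Zer X (ihom A B W))"
    using u'(1) by simp
  then have u'f: "u' \<bullet> Arrow X Y f = Zer X (ihom A B W)"
    by (rule lev_inj[of _ X B W, rotated -1]) (use u'(1) in simp_all)
  obtain h where "\<guillemotleft>h : Q \<rightarrow> ihom A B W\<guillemotright>" "h \<bullet> Arrow Y Q q = u'"
    using cokernel_arrow(3)[OF cok _ _ _ u'(1) u'f] by auto
  then show thesis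
    using u'(2) by (intro that[of "lev B W \<bullet> (Idt B \<boxtimes> h)"]) simp_all
qed

end

section \<open>The category of modules and free modules\<close>

context enriched_modules
begin

text \<open>Hom-sets of modules consist of extensional families, hence the restriction.\<close>

definition mk_hom :: "('c \<Rightarrow> ('o, 'm) arrow) \<Rightarrow> 'c \<Rightarrow> 'm" where
  "mk_hom \<tau> = (\<lambda>c\<in>EOb C. lab (\<tau> c))"

lemma Mod_comp: "s \<cdot>\<^bsub>Mod\<^esub> t = (\<lambda>c\<in>EOb C. s c \<cdot> t c)"
  and Mod_idm: "idm Mod M = (\<lambda>c\<in>EOb C. idm A (fob M c))"
  by (simp_all add: ModCat_def)

lemma cpt_comp: "c \<in> EOb C \<Longrightarrow> cpt M P (s \<cdot>\<^bsub>Mod\<^esub> t) c = cpt N P s c \<bullet> cpt M N t c"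
  by (simp add: Mod_comp cpt_def cmp_Arrow)

lemma cpt_idm [simp]: "c \<in> EOb C \<Longrightarrow> cpt M M (idm Mod M) c = Idt (fob M c)"
  by (simp add: Mod_idm cpt_def Idt_def)

lemma cpt_mk_hom:
  "\<lbrakk>c \<in> EOb C; \<guillemotleft>\<tau> c : fob M c \<rightarrow> fob N c\<guillemotright>\<rbrakk> \<Longrightarrow> cpt M N (mk_hom \<tau>) c = \<tau> c"
  by (rule arrow_eqI) (simp_all add: mk_hom_def)

lemma mk_hom:
  assumes "M \<in> Ob Mod" "N \<in> Ob Mod"
    and arr: "\<And>c. c \<in> EOb C \<Longrightarrow> \<guillemotleft>\<tau> c : fob M c \<rightarrow> fob N c\<guillemotright>"
    and nat: "\<And>a b. \<lbrakk>a \<in> EOb C; b \<in> EOb C\<rbrakk> \<Longrightarrow> \<tau> b \<bullet> act M a b = act N a b \<bullet> (Idt (EHom C a b) \<boxtimes> \<tau> a)"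
  shows "mk_hom \<tau> \<in> Hom Mod M N"
proof -
  have "cpt M N (mk_hom \<tau>) c = \<tau> c" if "c \<in> EOb C" for c
    using that arr[OF that] by (rule cpt_mk_hom)
  then show ?thesis
    using arr nat by (simp add: module_hom_iff[OF assms(1,2)]) (simp add: mk_hom_def)
qed

lemma hom_arr:
  "\<lbrakk>t \<in> Hom Mod M N; M \<in> Ob Mod; N \<in> Ob Mod; c \<in> EOb C\<rbrakk> \<Longrightarrow> arr (cpt M N t c)"
  by (simp add: module_hom_iff)

lemma hom_natural:
  "\<lbrakk>t \<in> Hom Mod M N; M \<in> Ob Mod; N \<in> Ob Mod; a \<in> EOb C; b \<in> EOb C\<rbrakk>
    \<Longrightarrow> cpt M N t b \<bullet> act M a b = act N a b \<bullet> (Idt (EHom C a b) \<boxtimes> cpt M N t a)"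
  by (simp add: module_hom_iff)

lemma hom_eqI:
  assumes "t \<in> Hom Mod M N" "t' \<in> Hom Mod M N"
    and "\<And>c. c \<in> EOb C \<Longrightarrow> cpt M N t c = cpt M N t' c"
  shows "t = t'"
proof (rule extensionalityI)
  show "t \<in> extensional (EOb C)" "t' \<in> extensional (EOb C)"
    using assms(1,2) by (auto simp: ModCat_def PiE_def)
  show "t c = t' c" if "c \<in> EOb C" for c
    using assms(3)[OF that] by (simp add: cpt_def)
qed

lemma Mod_comp_in_hom:
  assumes "M \<in> Ob Mod" "N \<in> Ob Mod" "P \<in> Ob Mod" "t \<in> Hom Mod M N" "s \<in> Hom Mod N P"
  shows "s \<cdot>\<^bsub>Mod\<^esub> t \<in> Hom Mod M P"
proof -
  note [simp] = module_simps(1,2)[OF assms(1)] module_simps(1,2)[OF assms(2)] module_simps(1,2)[OF assms(3)]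
    hom_arr[OF assms(4,1,2)] hom_arr[OF assms(5,2,3)]
  have "(cpt N P s b \<bullet> cpt M N t b) \<bullet> act M a b =
      act P a b \<bullet> (Idt (EHom C a b) \<boxtimes> (cpt N P s a \<bullet> cpt M N t a))"
    if [simp]: "a \<in> EOb C" "b \<in> EOb C" for a b
  proof -
    have "(cpt N P s b \<bullet> cpt M N t b) \<bullet> act M a b
        = (cpt N P s b \<bullet> act N a b) \<bullet> (Idt (EHom C a b) \<boxtimes> cpt M N t a)"
      using hom_natural[OF assms(4,1,2) that] by simp
    also have "\<dots> = act P a b \<bullet> (Idt (EHom C a b) \<boxtimes> (cpt N P s a \<bullet> cpt M N t a))"
      using hom_natural[OF assms(5,2,3) that] by simp
    finally show ?thesis .
  qed
  then show ?thesis
    using assms(1,3) by (simp add: module_hom_iff cpt_comp[of _ _ _ _ _ N]) (simp add: Mod_comp)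
qed

lemma Mod_id_in_hom:
  assumes "M \<in> Ob Mod"
  shows "idm Mod M \<in> Hom Mod M M"
  using assms by (simp add: module_hom_iff module_simps) (simp add: Mod_idm)

lemma category_Mod: "category Mod"
proof
  show "idm Mod M \<in> Hom Mod M M" if "M \<in> Ob Mod" for M
    using that by (rule Mod_id_in_hom)
  show "s \<cdot>\<^bsub>Mod\<^esub> t \<in> Hom Mod M P"
    if "M \<in> Ob Mod" "N \<in> Ob Mod" "P \<in> Ob Mod" "t \<in> Hom Mod M N" "s \<in> Hom Mod N P" for M N P t s
    using that by (rule Mod_comp_in_hom)
  show "idm Mod N \<cdot>\<^bsub>Mod\<^esub> t = t" if "M \<in> Ob Mod" "N \<in> Ob Mod" "t \<in> Hom Mod M N" for M N t
    using that by (intro hom_eqI[of _ M N] Mod_comp_in_hom[of M N N] Mod_id_in_hom)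
      (simp_all add: cpt_comp[of _ _ _ _ _ N] hom_arr)
  show "t \<cdot>\<^bsub>Mod\<^esub> idm Mod M = t" if "M \<in> Ob Mod" "N \<in> Ob Mod" "t \<in> Hom Mod M N" for M N t
    using that by (intro hom_eqI[of _ M N] Mod_comp_in_hom[of M M N] Mod_id_in_hom)
      (simp_all add: cpt_comp[of _ _ _ _ _ M] hom_arr)
  show "(u \<cdot>\<^bsub>Mod\<^esub> s) \<cdot>\<^bsub>Mod\<^esub> t = u \<cdot>\<^bsub>Mod\<^esub> (s \<cdot>\<^bsub>Mod\<^esub> t)"
    if [simp]: "M \<in> Ob Mod" "N \<in> Ob Mod" "P \<in> Ob Mod" "R \<in> Ob Mod"
      and [simp]: "t \<in> Hom Mod M N" "s \<in> Hom Mod N P" "u \<in> Hom Mod P R" for M N P R t s u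
  proof (rule hom_eqI)
    show "(u \<cdot>\<^bsub>Mod\<^esub> s) \<cdot>\<^bsub>Mod\<^esub> t \<in> Hom Mod M R"
      by (rule Mod_comp_in_hom[of M N R], simp_all, rule Mod_comp_in_hom[of N P R], simp_all)
    show "u \<cdot>\<^bsub>Mod\<^esub> (s \<cdot>\<^bsub>Mod\<^esub> t) \<in> Hom Mod M R"
      by (rule Mod_comp_in_hom[of M P R], simp_all, rule Mod_comp_in_hom[of M N P], simp_all)
    fix c assume c [simp]: "c \<in> EOb C"
    show "cpt M R ((u \<cdot>\<^bsub>Mod\<^esub> s) \<cdot>\<^bsub>Mod\<^esub> t) c = cpt M R (u \<cdot>\<^bsub>Mod\<^esub> (s \<cdot>\<^bsub>Mod\<^esub> t)) c"
      using cpt_comp[OF c, of M R "u \<cdot>\<^bsub>Mod\<^esub> s" t N] cpt_comp[OF c, of N R u s P]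
        cpt_comp[OF c, of M R u "s \<cdot>\<^bsub>Mod\<^esub> t" P] cpt_comp[OF c, of M P s t N]
      by (simp add: hom_arr[of _ M N] hom_arr[of _ N P] hom_arr[of _ P R])
  qed
qed

section \<open>The modules x \<otimes> C(c,-) and their universal property\<close>

definition rep_act :: "'o \<Rightarrow> 'c \<Rightarrow> 'c \<Rightarrow> 'c \<Rightarrow> ('o, 'm) arrow" where
  "rep_act x c d e = (Idt x \<boxtimes> emu c d e) \<bullet> swap (EHom C d e) x (EHom C c d)"

lemma tensor_rep_mk_module:
  "tensor_rep A C x c = mk_module (\<lambda>d. x \<otimes>\<^sub>o EHom C c d) (rep_act x c)"
  by (simp add: tensor_rep_def mk_module_def cur_def rep_act_def tensor_rep_action_def emu_def swap_def
      al_def br_def al'_def)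

text \<open>Naturality of \<open>swap\<close> moves the unit and the composition of C past x. What
  remains are the corresponding laws of C together with \<open>swap_unit_left\<close> and
  \<open>swap_tens\<close>.\<close>

lemma module_action_rep:
  assumes [simp]: "x \<in> Ob A" "c \<in> EOb C"
  shows "module_action (\<lambda>d. x \<otimes>\<^sub>o EHom C c d) (rep_act x c)"
  unfolding module_action_def
proof (intro conjI ballI)
  fix a assume [simp]: "a \<in> EOb C"
  let ?B = "EHom C c a"
  show "x \<otimes>\<^sub>o ?B \<in> Ob A" by simp
  have "rep_act x c a a \<bullet> (eun a \<boxtimes> Idt (x \<otimes>\<^sub>o ?B))
      = (Idt x \<boxtimes> emu c a a) \<bullet> swap (EHom C a a) x ?B \<bullet> (eun a \<boxtimes> (Idt x \<boxtimes> Idt ?B))"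
    by (simp add: rep_act_def)
  also have "\<dots> = (Idt x \<boxtimes> (emu c a a \<bullet> (eun a \<boxtimes> Idt ?B))) \<bullet> swap (unit A) x ?B"
    by (subst swap_natural[of _ "unit A" _ _ x _ _ ?B]) simp_all
  also have "\<dots> = lu (x \<otimes>\<^sub>o ?B)"
    by (simp add: emu_unit swap_unit_left)
  finally show "rep_act x c a a \<bullet> (eun a \<boxtimes> Idt (x \<otimes>\<^sub>o ?B)) = lu (x \<otimes>\<^sub>o ?B)" .
next
  fix a b assume [simp]: "a \<in> EOb C" "b \<in> EOb C"
  show "arr (rep_act x c a b)" "src (rep_act x c a b) = EHom C a b \<otimes>\<^sub>o x \<otimes>\<^sub>o EHom C c a"
    "tgt (rep_act x c a b) = x \<otimes>\<^sub>o EHom C c b"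
    by (simp_all add: rep_act_def)
next
  fix a b d assume [simp]: "a \<in> EOb C" "b \<in> EOb C" "d \<in> EOb C"
  let ?B = "EHom C c a" and ?D = "EHom C a b" and ?E = "EHom C b d"
  have "rep_act x c a d \<bullet> (emu a b d \<boxtimes> Idt (x \<otimes>\<^sub>o ?B))
      = (Idt x \<boxtimes> emu c a d) \<bullet> swap (EHom C a d) x ?B \<bullet> (emu a b d \<boxtimes> (Idt x \<boxtimes> Idt ?B))"
    by (simp add: rep_act_def)
  also have "\<dots> = (Idt x \<boxtimes> (emu c a d \<bullet> (emu a b d \<boxtimes> Idt ?B))) \<bullet> swap (?E \<otimes>\<^sub>o ?D) x ?B"
    by (subst swap_natural[of _ "?E \<otimes>\<^sub>o ?D" _ _ x _ _ ?B]) simp_all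
  also have "\<dots> = (Idt x \<boxtimes> (emu c b d \<bullet> (Idt ?E \<boxtimes> emu c a b))) \<bullet> (Idt x \<boxtimes> al ?E ?D ?B) \<bullet> swap (?E \<otimes>\<^sub>o ?D) x ?B"
    by (simp add: emu_assoc)
  also have "\<dots> = (Idt x \<boxtimes> emu c b d) \<bullet> ((Idt x \<boxtimes> (Idt ?E \<boxtimes> emu c a b)) \<bullet> swap ?E x (?D \<otimes>\<^sub>o ?B)) \<bullet>
      (Idt ?E \<boxtimes> swap ?D x ?B) \<bullet> al ?E ?D (x \<otimes>\<^sub>o ?B)"
    by (subst swap_tens) simp_all
  also have "\<dots> = (Idt x \<boxtimes> emu c b d) \<bullet> (swap ?E x (EHom C c b) \<bullet> (Idt ?E \<boxtimes> (Idt x \<boxtimes> emu c a b))) \<bullet>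
      (Idt ?E \<boxtimes> swap ?D x ?B) \<bullet> al ?E ?D (x \<otimes>\<^sub>o ?B)"
    by (subst swap_natural[of "Idt ?E" ?E ?E "Idt x" x x _ "?D \<otimes>\<^sub>o ?B" "EHom C c b"]) simp_all
  also have "\<dots> = rep_act x c b d \<bullet> (Idt ?E \<boxtimes> rep_act x c a b) \<bullet> al ?E ?D (x \<otimes>\<^sub>o ?B)"
    by (simp add: rep_act_def)
  finally show "rep_act x c a d \<bullet> (emu a b d \<boxtimes> Idt (x \<otimes>\<^sub>o ?B))
      = rep_act x c b d \<bullet> (Idt ?E \<boxtimes> rep_act x c a b) \<bullet> al ?E ?D (x \<otimes>\<^sub>o ?B)" .
qed

lemma tensor_rep:
  assumes "x \<in> Ob A" "c \<in> EOb C"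
  shows "tensor_rep A C x c \<in> Ob Mod"
    and "d \<in> EOb C \<Longrightarrow> fob (tensor_rep A C x c) d = x \<otimes>\<^sub>o EHom C c d"
    and "\<lbrakk>d \<in> EOb C; e \<in> EOb C\<rbrakk> \<Longrightarrow> act (tensor_rep A C x c) d e = rep_act x c d e"
  using mk_module[OF module_action_rep[OF assms]] by (simp_all add: tensor_rep_mk_module)

text \<open>The universal element of the Yoneda correspondence: x placed at the identity of
  c.\<close>

definition rep_unit :: "'o \<Rightarrow> 'c \<Rightarrow> ('o, 'm) arrow" where
  "rep_unit x c = (Idt x \<boxtimes> eun c) \<bullet> ru' x"

lemma rep_unit_simps [simp]:
  "src (rep_unit x c) = x" "tgt (rep_unit x c) = x \<otimes>\<^sub>o EHom C c c"
  "\<lbrakk>x \<in> Ob A; c \<in> EOb C\<rbrakk> \<Longrightarrow> arr (rep_unit x c)"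
  by (simp_all add: rep_unit_def)

text \<open>The morphism that sends the generator x to f and extends it by the action of C. The
  braiding is needed because C(c,d) stands to the right of x but acts from the left.\<close>

definition rep_hom :: "('c, 'o, 'm) enr_functor \<Rightarrow> 'c \<Rightarrow> ('o, 'm) arrow \<Rightarrow> 'c \<Rightarrow> ('o, 'm) arrow" where
  "rep_hom M c f d = act M c d \<bullet> br (fob M c) (EHom C c d) \<bullet> (f \<boxtimes> Idt (EHom C c d))"

context
  fixes x c M
  assumes x [simp]: "x \<in> Ob A" and c [simp]: "c \<in> EOb C" and M [simp]: "M \<in> Ob Mod"
begin

lemma rep_hom_arr:
  assumes "\<guillemotleft>f : x \<rightarrow> fob M c\<guillemotright>" "d \<in> EOb C"
  shows "\<guillemotleft>rep_hom M c f d : x \<otimes>\<^sub>o EHom C c d \<rightarrow> fob M d\<guillemotright>"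
  using assms by (simp add: rep_hom_def module_simps)

text \<open>Naturality is associativity of the action on M; \<open>swap_br\<close> reconciles the
  braiding in the free action with the one in \<open>rep_hom\<close>.\<close>

lemma rep_hom:
  assumes f: "\<guillemotleft>f : x \<rightarrow> fob M c\<guillemotright>"
  shows "mk_hom (rep_hom M c f) \<in> Hom Mod (tensor_rep A C x c) M"
proof (rule mk_hom)
  show "\<guillemotleft>rep_hom M c f d : fob (tensor_rep A C x c) d \<rightarrow> fob M d\<guillemotright>" if "d \<in> EOb C" for d
    using rep_hom_arr[OF f that] that by (simp add: tensor_rep)
  fix d e assume [simp]: "d \<in> EOb C" "e \<in> EOb C"
  note [simp] = module_simps(1,2)[OF M]
  let ?y = "fob M c" and ?B = "EHom C c d" and ?D = "EHom C d e"
  have "rep_hom M c f e \<bullet> rep_act x c d e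
      = act M c e \<bullet> br ?y (EHom C c e) \<bullet> (Idt ?y \<boxtimes> emu c d e) \<bullet> (f \<boxtimes> Idt (?D \<otimes>\<^sub>o ?B)) \<bullet> swap ?D x ?B"
    using f by (simp add: rep_hom_def rep_act_def)
  also have "(f \<boxtimes> Idt (?D \<otimes>\<^sub>o ?B)) \<bullet> swap ?D x ?B = swap ?D ?y ?B \<bullet> (Idt ?D \<boxtimes> (f \<boxtimes> Idt ?B))"
    using f by (subst swap_natural[of _ ?D _ _ x _ _ ?B]) simp_all
  also have "act M c e \<bullet> br ?y (EHom C c e) \<bullet> (Idt ?y \<boxtimes> emu c d e) \<bullet> swap ?D ?y ?B \<bullet> (Idt ?D \<boxtimes> (f \<boxtimes> Idt ?B))
      = act M c e \<bullet> (br ?y (EHom C c e) \<bullet> (Idt ?y \<boxtimes> emu c d e)) \<bullet> swap ?D ?y ?B \<bullet> (Idt ?D \<boxtimes> (f \<boxtimes> Idt ?B))"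
    using f by simp
  also have "\<dots> = (act M c e \<bullet> (emu c d e \<boxtimes> Idt ?y)) \<bullet> br ?y (?D \<otimes>\<^sub>o ?B) \<bullet> swap ?D ?y ?B \<bullet> (Idt ?D \<boxtimes> (f \<boxtimes> Idt ?B))"
    using f by (subst br_natural[of _ ?y _ _ "?D \<otimes>\<^sub>o ?B"]) simp_all
  also have "\<dots> = act M d e \<bullet> (Idt ?D \<boxtimes> act M c d) \<bullet> (al ?D ?B ?y \<bullet> br ?y (?D \<otimes>\<^sub>o ?B) \<bullet> swap ?D ?y ?B) \<bullet>
      (Idt ?D \<boxtimes> (f \<boxtimes> Idt ?B))"
    using f by (subst module_simps(4)) simp_all
  also have "\<dots> = act M d e \<bullet> (Idt ?D \<boxtimes> rep_hom M c f d)"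
    using f by (subst swap_br) (simp_all add: rep_hom_def)
  finally show "rep_hom M c f e \<bullet> act (tensor_rep A C x c) d e = act M d e \<bullet> (Idt ?D \<boxtimes> rep_hom M c f d)"
    by (simp add: tensor_rep)
qed (simp_all add: tensor_rep)

text \<open>This is the unit law of M, once the braiding has been moved past \<open>eun c\<close>
  and absorbed by \<open>lu_br\<close>.\<close>

lemma rep_hom_unit:
  assumes f: "\<guillemotleft>f : x \<rightarrow> fob M c\<guillemotright>"
  shows "rep_hom M c f c \<bullet> rep_unit x c = f"
proof -
  note [simp] = module_simps(1,2)[OF M]
  let ?y = "fob M c"
  have "rep_hom M c f c \<bullet> rep_unit x c
      = act M c c \<bullet> (br ?y (EHom C c c) \<bullet> (Idt ?y \<boxtimes> eun c)) \<bullet> (f \<boxtimes> Idt (unit A)) \<bullet> ru' x"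
    using f by (simp add: rep_hom_def rep_unit_def)
  also have "\<dots> = (act M c c \<bullet> (eun c \<boxtimes> Idt ?y)) \<bullet> br ?y (unit A) \<bullet> (f \<boxtimes> Idt (unit A)) \<bullet> ru' x"
    using f by (subst br_natural[of _ ?y _ _ "unit A"]) simp_all
  also have "\<dots> = (lu ?y \<bullet> br ?y (unit A)) \<bullet> (f \<boxtimes> Idt (unit A)) \<bullet> ru' x"
    using f by (subst module_simps(3)) simp_all
  also have "\<dots> = (ru ?y \<bullet> (f \<boxtimes> Idt (unit A))) \<bullet> ru' x"
    using f by (subst lu_br) simp_all
  also have "\<dots> = f"
    using f by (subst ru_natural[of f x]) simp_all
  finally show ?thesis .
qed

text \<open>Naturality of t from c to d expresses its component at d through the one at c, acting on
  the generator. The right unit law of C and \<open>swap_unit_right\<close> show that the generator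
  then fills all of x \<otimes> C(c,d).\<close>

lemma rep_hom_eta:
  assumes t: "t \<in> Hom Mod (tensor_rep A C x c) M" and d: "d \<in> EOb C"
  shows "cpt (tensor_rep A C x c) M t d = rep_hom M c (cpt (tensor_rep A C x c) M t c \<bullet> rep_unit x c) d"
proof -
  let ?T = "tensor_rep A C x c"
  note [simp] = module_simps(1,2)[OF M] d tensor_rep[OF x c] hom_arr[OF t]
  let ?y = "fob M c" and ?B = "EHom C c d"
  let ?t = "cpt ?T M t"
  have "rep_hom M c (?t c \<bullet> rep_unit x c) d = act M c d \<bullet> (br ?y ?B \<bullet> (?t c \<boxtimes> Idt ?B)) \<bullet> (rep_unit x c \<boxtimes> Idt ?B)"
    by (simp add: rep_hom_def)
  also have "\<dots> = (act M c d \<bullet> (Idt ?B \<boxtimes> ?t c)) \<bullet> br (x \<otimes>\<^sub>o EHom C c c) ?B \<bullet> (rep_unit x c \<boxtimes> Idt ?B)"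
    by (subst br_natural[of _ "x \<otimes>\<^sub>o EHom C c c" _ _ ?B]) simp_all
  also have "\<dots> = ?t d \<bullet> rep_act x c c d \<bullet> br (x \<otimes>\<^sub>o EHom C c c) ?B \<bullet> (rep_unit x c \<boxtimes> Idt ?B)"
    using hom_natural[OF t, of c d, symmetric] by (simp add: rep_act_def)
  also have "br (x \<otimes>\<^sub>o EHom C c c) ?B \<bullet> (rep_unit x c \<boxtimes> Idt ?B) = (Idt ?B \<boxtimes> rep_unit x c) \<bullet> br x ?B"
    by (subst br_natural[of _ x _ _ ?B]) simp_all
  also have "rep_act x c c d \<bullet> (Idt ?B \<boxtimes> rep_unit x c) \<bullet> br x ?B
      = (Idt x \<boxtimes> emu c c d) \<bullet> (swap ?B x (EHom C c c) \<bullet> (Idt ?B \<boxtimes> (Idt x \<boxtimes> eun c))) \<bullet> (Idt ?B \<boxtimes> ru' x) \<bullet> br x ?B"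
    by (simp add: rep_act_def rep_unit_def)
  also have "\<dots> = (Idt x \<boxtimes> (emu c c d \<bullet> (Idt ?B \<boxtimes> eun c))) \<bullet> swap ?B x (unit A) \<bullet> (Idt ?B \<boxtimes> ru' x) \<bullet> br x ?B"
    by (subst swap_natural[of _ ?B _ _ x _ _ "unit A"]) simp_all
  also have "\<dots> = ((Idt x \<boxtimes> ru ?B) \<bullet> swap ?B x (unit A) \<bullet> (Idt ?B \<boxtimes> ru' x)) \<bullet> br x ?B"
    by (simp add: emu_unit)
  also have "\<dots> = Idt (x \<otimes>\<^sub>o ?B)"
    by (subst swap_unit_right) simp_all
  also have "?t d \<bullet> Idt (x \<otimes>\<^sub>o ?B) = ?t d"
    by simp
  finally show ?thesis ..
qed

end

text \<open>Tensoring keeps the families \<open>\<iota> c\<close> jointly epic, so the module axioms of the glued action can be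
  checked on the \<open>N i\<close>; this covers both coproducts and cokernels.\<close>

lemma glue_module:
  assumes N: "\<And>i. i \<in> I \<Longrightarrow> N i \<in> Ob Mod"
    and epi: "\<And>c. c \<in> EOb C \<Longrightarrow> jointly_epic I (P c) (\<iota> c)"
    and src: "\<And>c i. \<lbrakk>c \<in> EOb C; i \<in> I\<rbrakk> \<Longrightarrow> src (\<iota> c i) = fob (N i) c"
    and ex: "\<And>a b. \<lbrakk>a \<in> EOb C; b \<in> EOb C\<rbrakk> \<Longrightarrow> \<exists>m. \<guillemotleft>m : EHom C a b \<otimes>\<^sub>o P a \<rightarrow> P b\<guillemotright> \<and>
      (\<forall>i\<in>I. m \<bullet> (Idt (EHom C a b) \<boxtimes> \<iota> a i) = \<iota> b i \<bullet> act (N i) a b)"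
  obtains Q where "Q \<in> Ob Mod" "\<And>c. c \<in> EOb C \<Longrightarrow> fob Q c = P c"
    "\<And>i. i \<in> I \<Longrightarrow> mk_hom (\<lambda>c. \<iota> c i) \<in> Hom Mod (N i) Q"
    "\<And>R h. \<lbrakk>R \<in> Ob Mod; \<And>c. c \<in> EOb C \<Longrightarrow> \<guillemotleft>h c : P c \<rightarrow> fob R c\<guillemotright>;
        \<And>i. i \<in> I \<Longrightarrow> mk_hom (\<lambda>c. h c \<bullet> \<iota> c i) \<in> Hom Mod (N i) R\<rbrakk> \<Longrightarrow> mk_hom h \<in> Hom Mod Q R"
proof -
  have P [simp]: "P c \<in> Ob A" if "c \<in> EOb C" for c
    using epi[OF that] by (rule jointly_epic_arr)
  have \<iota> [simp]: "arr (\<iota> c i)" "src (\<iota> c i) = fob (N i) c" "tgt (\<iota> c i) = P c" if "c \<in> EOb C" "i \<in> I" for c i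
    using jointly_epic_arr(2,3)[OF epi] src that by auto
  note [simp] = module_simps(1,2)[OF N]
  obtain m where m [simp]: "\<And>a b. \<lbrakk>a \<in> EOb C; b \<in> EOb C\<rbrakk> \<Longrightarrow> \<guillemotleft>m a b : EHom C a b \<otimes>\<^sub>o P a \<rightarrow> P b\<guillemotright>"
    and m_\<iota>: "\<And>a b i. \<lbrakk>a \<in> EOb C; b \<in> EOb C; i \<in> I\<rbrakk>
      \<Longrightarrow> m a b \<bullet> (Idt (EHom C a b) \<boxtimes> \<iota> a i) = \<iota> b i \<bullet> act (N i) a b"
    using ex by metis
  have "module_action P m"
    unfolding module_action_def
  proof (intro conjI ballI)
    fix a assume a [simp]: "a \<in> EOb C"
    show "m a a \<bullet> (eun a \<boxtimes> Idt (P a)) = lu (P a)"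
    proof (rule jointly_epicD[OF tens_jointly_epic[OF epi[OF a] unit_ob], where Y = "P a"])
      fix i assume i [simp]: "i \<in> I"
      have "(m a a \<bullet> (eun a \<boxtimes> Idt (P a))) \<bullet> (Idt (unit A) \<boxtimes> \<iota> a i)
          = (m a a \<bullet> (Idt (EHom C a a) \<boxtimes> \<iota> a i)) \<bullet> (eun a \<boxtimes> Idt (fob (N i) a))"
        by simp
      also have "\<dots> = \<iota> a i \<bullet> act (N i) a a \<bullet> (eun a \<boxtimes> Idt (fob (N i) a))"
        by (subst m_\<iota>) simp_all
      also have "\<dots> = lu (P a) \<bullet> (Idt (unit A) \<boxtimes> \<iota> a i)"
        by (simp add: module_simps(3)[OF N] lu_natural[of _ "fob (N i) a"])
      finally show "(m a a \<bullet> (eun a \<boxtimes> Idt (P a))) \<bullet> (Idt (unit A) \<boxtimes> \<iota> a i) = lu (P a) \<bullet> (Idt (unit A) \<boxtimes> \<iota> a i)" .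
    qed simp_all
  next
    fix a b d assume [simp]: "a \<in> EOb C" "b \<in> EOb C" "d \<in> EOb C"
    let ?D = "EHom C a b" and ?E = "EHom C b d"
    show "m a d \<bullet> (emu a b d \<boxtimes> Idt (P a)) = m b d \<bullet> (Idt ?E \<boxtimes> m a b) \<bullet> al ?E ?D (P a)"
    proof (rule jointly_epicD[OF tens_jointly_epic[OF epi, of a "?E \<otimes>\<^sub>o ?D"], where Y = "P d"])
      fix i assume i [simp]: "i \<in> I"
      let ?X = "fob (N i) a"
      have "(m a d \<bullet> (emu a b d \<boxtimes> Idt (P a))) \<bullet> (Idt (?E \<otimes>\<^sub>o ?D) \<boxtimes> \<iota> a i)
          = (m a d \<bullet> (Idt (EHom C a d) \<boxtimes> \<iota> a i)) \<bullet> (emu a b d \<boxtimes> Idt ?X)"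
        by simp
      also have "\<dots> = \<iota> d i \<bullet> act (N i) a d \<bullet> (emu a b d \<boxtimes> Idt ?X)"
        by (subst m_\<iota>) simp_all
      also have "\<dots> = (\<iota> d i \<bullet> act (N i) b d) \<bullet> (Idt ?E \<boxtimes> act (N i) a b) \<bullet> al ?E ?D ?X"
        by (simp add: module_simps(4)[OF N])
      also have "\<dots> = m b d \<bullet> (Idt ?E \<boxtimes> (\<iota> b i \<bullet> act (N i) a b)) \<bullet> al ?E ?D ?X"
        by (simp flip: m_\<iota>)
      also have "\<dots> = m b d \<bullet> (Idt ?E \<boxtimes> m a b) \<bullet> ((Idt ?E \<boxtimes> (Idt ?D \<boxtimes> \<iota> a i)) \<bullet> al ?E ?D ?X)"
        by (simp flip: m_\<iota>)
      also have "\<dots> = m b d \<bullet> (Idt ?E \<boxtimes> m a b) \<bullet> (al ?E ?D (P a) \<bullet> ((Idt ?E \<boxtimes> Idt ?D) \<boxtimes> \<iota> a i))"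
        by (subst al_natural[of "Idt ?E" ?E ?E "Idt ?D" ?D ?D _ ?X "P a"]) simp_all
      also have "\<dots> = (m b d \<bullet> (Idt ?E \<boxtimes> m a b) \<bullet> al ?E ?D (P a)) \<bullet> (Idt (?E \<otimes>\<^sub>o ?D) \<boxtimes> \<iota> a i)"
        by simp
      finally show "(m a d \<bullet> (emu a b d \<boxtimes> Idt (P a))) \<bullet> (Idt (?E \<otimes>\<^sub>o ?D) \<boxtimes> \<iota> a i)
        = (m b d \<bullet> (Idt ?E \<boxtimes> m a b) \<bullet> al ?E ?D (P a)) \<bullet> (Idt (?E \<otimes>\<^sub>o ?D) \<boxtimes> \<iota> a i)" .
    qed simp_all
  qed simp_all
  note Q = mk_module[OF this]
  let ?Q = "mk_module P m"
  have 1: "mk_hom (\<lambda>c. \<iota> c i) \<in> Hom Mod (N i) ?Q" if "i \<in> I" for i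
    using that by (intro mk_hom) (simp_all add: Q N m_\<iota>)
  \<comment> \<open>A family of arrows out of the glued module is natural as soon as its
    restrictions to all \<open>N i\<close> are, again because the tensored family is jointly
    epic.\<close>
  have 2: "mk_hom h \<in> Hom Mod ?Q R"
    if R: "R \<in> Ob Mod" and h [simp]: "\<And>c. c \<in> EOb C \<Longrightarrow> \<guillemotleft>h c : P c \<rightarrow> fob R c\<guillemotright>"
      and h\<iota>: "\<And>i. i \<in> I \<Longrightarrow> mk_hom (\<lambda>c. h c \<bullet> \<iota> c i) \<in> Hom Mod (N i) R" for R h
  proof (rule mk_hom)
    note [simp] = module_simps(1,2)[OF R]
    fix a b assume [simp]: "a \<in> EOb C" "b \<in> EOb C"
    let ?D = "EHom C a b"
    have "h b \<bullet> m a b = act R a b \<bullet> (Idt ?D \<boxtimes> h a)"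
    proof (rule jointly_epicD[OF tens_jointly_epic[OF epi, of a ?D], where Y = "fob R b"])
      fix i assume i [simp]: "i \<in> I"
      have "(h b \<bullet> m a b) \<bullet> (Idt ?D \<boxtimes> \<iota> a i) = (h b \<bullet> \<iota> b i) \<bullet> act (N i) a b"
        by (simp add: m_\<iota>)
      also have "\<dots> = (act R a b \<bullet> (Idt ?D \<boxtimes> h a)) \<bullet> (Idt ?D \<boxtimes> \<iota> a i)"
        using hom_natural[OF h\<iota>[OF i] N[OF i] R, of a b] by (simp add: cpt_mk_hom)
      finally show "(h b \<bullet> m a b) \<bullet> (Idt ?D \<boxtimes> \<iota> a i) = (act R a b \<bullet> (Idt ?D \<boxtimes> h a)) \<bullet> (Idt ?D \<boxtimes> \<iota> a i)" .
    qed simp_all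
    then show "h b \<bullet> act ?Q a b = act R a b \<bullet> (Idt ?D \<boxtimes> h a)"
      by (simp add: Q)
  qed (simp_all add: Q R)
  show thesis
    using Q(1,2) 1 2 by (rule that)
qed

end

section \<open>Additivity and cokernels of modules\<close>

context category
begin

lemma epi_arrow:
  assumes "is_epi C X Y e" "\<guillemotleft>u : Y \<rightarrow> Z\<guillemotright>" "\<guillemotleft>v : Y \<rightarrow> Z\<guillemotright>"
    and eq: "u \<bullet> Arrow X Y e = v \<bullet> Arrow X Y e"
  shows "u = v"
proof (rule arrow_eqI)
  have "lab u \<cdot> e = lab v \<cdot> e"
    using arg_cong[OF eq, of lab] by simp
  moreover have "Z \<in> Ob C" "lab u \<in> Hom C Y Z" "lab v \<in> Hom C Y Z"
    using assms(2,3) by auto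
  ultimately show "lab u = lab v"
    using assms(1) unfolding is_epi_def by blast
qed (use assms in simp_all)

end

locale abelian_modules = enriched_modules A C + abelian_category A + preadditive_closed A add zero
  for A :: "('o, 'm, 'x) smc_cat_scheme" (structure) and C :: "('c, 'o, 'm, 'y) enr_cat_scheme"
    and add zero
begin

notation cmp  (infixr "\<bullet>" 70)
notation in_hom  ("\<guillemotleft>_ : _ \<rightarrow> _\<guillemotright>")
notation tens  (infixr "\<boxtimes>" 75)
notation plus  (infixl "\<^bold>+" 65)

text \<open>A functor with a right adjoint preserves biproducts, and a functor that preserves biproducts is
  additive.\<close>

lemma tens_plus:
  assumes f: "\<guillemotleft>f : X \<rightarrow> Y\<guillemotright>" and g: "\<guillemotleft>g : X \<rightarrow> Y\<guillemotright>" and B [simp]: "B \<in> Ob A"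
  shows "Idt B \<boxtimes> (f \<^bold>+ g) = (Idt B \<boxtimes> f) \<^bold>+ (Idt B \<boxtimes> g)"
proof -
  have [simp]: "X \<in> Ob A" "Y \<in> Ob A" using f by auto
  obtain S inc pr where bi: "is_biproduct A X X S inc pr"
    using ex_biproduct[of X X] by auto
  then have cop: "is_coproduct A (UNIV :: bool set) (\<lambda>_. X) S inc"
    and prod: "is_product A (UNIV :: bool set) (\<lambda>_. X) S pr"
    and pi: "pr True \<cdot> inc True = idm A X" "pr False \<cdot> inc False = idm A X"
      "zero_arrow A X X (pr False \<cdot> inc True)" "zero_arrow A X X (pr True \<cdot> inc False)"
    by (simp_all add: is_biproduct_def)
  have [simp]: "S \<in> Ob A" "\<And>b. inc b \<in> Hom A X S" "\<And>b. pr b \<in> Hom A S X"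
    using cop prod by (simp_all add: is_coproduct_def is_product_def)
  define i where "i b = Arrow X S (inc b)" for b
  define p where "p b = Arrow S X (pr b)" for b
  have [simp]: "\<guillemotleft>i b : X \<rightarrow> S\<guillemotright>" "\<guillemotleft>p b : S \<rightarrow> X\<guillemotright>" for b
    by (simp_all add: i_def p_def)
  have [simp]: "p True \<bullet> i True = Idt X" "p False \<bullet> i False = Idt X"
      "p False \<bullet> i True = Zer X X" "p True \<bullet> i False = Zer X X"
    using pi by (simp_all add: zero_arrow_iff) (simp_all add: i_def p_def cmp_Arrow Idt_def)
  obtain h where h: "\<guillemotleft>h : S \<rightarrow> Y\<guillemotright>" "h \<bullet> i True = f" "h \<bullet> i False = g"
  proof -
    have "\<exists>h. \<guillemotleft>h : S \<rightarrow> Y\<guillemotright> \<and> (\<forall>b\<in>UNIV. h \<bullet> Arrow X S (inc b) = (if b then f else g))"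
      using f g by (intro coproduct_arrow(2)[OF cop]) auto
    then show thesis
      using that unfolding i_def by (metis UNIV_I)
  qed
  \<comment> \<open>The diagonal of X. With h given by f and g on the two summands, f + g = h d, so
    it suffices to know B \<otimes> d.\<close>
  define d where "d = i True \<^bold>+ i False"
  have d [simp]: "\<guillemotleft>d : X \<rightarrow> S\<guillemotright>"
    by (simp add: d_def)
  have pd: "p b \<bullet> d = Idt X" for b
    unfolding d_def by (subst cmp_plus[of _ X S _ _ X]) (cases b; simp)+
  have hd: "h \<bullet> d = f \<^bold>+ g"
    unfolding d_def using h by (subst cmp_plus[of _ X S _ _ Y]) simp_all
  \<comment> \<open>The image under B \<otimes> - of the decomposition i p + i' p' of the identity
    of S. It is the identity of B \<otimes> S because it fixes both tensored inclusions, which are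
    jointly epic.\<close>
  let ?s = "(Idt B \<boxtimes> (i True \<bullet> p True)) \<^bold>+ (Idt B \<boxtimes> (i False \<bullet> p False))"
  have "Idt (B \<otimes>\<^sub>o S) = ?s"
  proof (rule jointly_epicD[OF tens_jointly_epic[OF coproduct_arrow(1)[OF cop] B], where Y = "B \<otimes>\<^sub>o S"])
    fix b :: bool
    have "?s \<bullet> (Idt B \<boxtimes> i b) = Idt B \<boxtimes> i b"
      by (subst plus_cmp[of _ "B \<otimes>\<^sub>o X" "B \<otimes>\<^sub>o S" _ "B \<otimes>\<^sub>o S"]) (cases b; simp)+
    then show "Idt (B \<otimes>\<^sub>o S) \<bullet> (Idt B \<boxtimes> Arrow X S (inc b)) = ?s \<bullet> (Idt B \<boxtimes> Arrow X S (inc b))"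
      unfolding i_def[symmetric] by simp
  qed simp_all
  then have "Idt B \<boxtimes> d = ?s \<bullet> (Idt B \<boxtimes> d)"
    by (metis Idt_cmp arr_tens arr_Idt B d tgt_tens tgt_Idt)
  also have "\<dots> = (Idt B \<boxtimes> i True) \<^bold>+ (Idt B \<boxtimes> i False)"
    by (subst plus_cmp[of _ "B \<otimes>\<^sub>o X" "B \<otimes>\<^sub>o S" _ "B \<otimes>\<^sub>o S"]) (simp_all add: pd)
  finally have "(Idt B \<boxtimes> h) \<bullet> (Idt B \<boxtimes> d) = (Idt B \<boxtimes> h) \<bullet> ((Idt B \<boxtimes> i True) \<^bold>+ (Idt B \<boxtimes> i False))"
    by (rule arg_cong)
  also have "\<dots> = (Idt B \<boxtimes> f) \<^bold>+ (Idt B \<boxtimes> g)"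
    using h by (subst cmp_plus[of _ "B \<otimes>\<^sub>o X" "B \<otimes>\<^sub>o S" _ _ "B \<otimes>\<^sub>o Y"]) simp_all
  finally show ?thesis
    using h by (simp add: hd)
qed

section \<open>Zero objects and cokernels of modules, componentwise epimorphisms\<close>

text \<open>Module morphisms as families of bundled arrows, free of extensionality, so that sums and
  composites can be formed pointwise.\<close>

definition natural ::
  "('c, 'o, 'm) enr_functor \<Rightarrow> ('c, 'o, 'm) enr_functor \<Rightarrow> ('c \<Rightarrow> ('o, 'm) arrow) \<Rightarrow> bool" where
  "natural M N \<tau> \<longleftrightarrow> (\<forall>c\<in>EOb C. \<guillemotleft>\<tau> c : fob M c \<rightarrow> fob N c\<guillemotright>) \<and>
    (\<forall>a\<in>EOb C. \<forall>b\<in>EOb C. \<tau> b \<bullet> act M a b = act N a b \<bullet> (Idt (EHom C a b) \<boxtimes> \<tau> a))"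

lemma natural_arr: "\<lbrakk>natural M N \<tau>; c \<in> EOb C\<rbrakk> \<Longrightarrow> \<guillemotleft>\<tau> c : fob M c \<rightarrow> fob N c\<guillemotright>"
  by (simp add: natural_def)

lemma natural_act:
  "\<lbrakk>natural M N \<tau>; a \<in> EOb C; b \<in> EOb C\<rbrakk>
    \<Longrightarrow> \<tau> b \<bullet> act M a b = act N a b \<bullet> (Idt (EHom C a b) \<boxtimes> \<tau> a)"
  by (simp add: natural_def)

lemma natural_cpt:
  "\<lbrakk>t \<in> Hom Mod M N; M \<in> Ob Mod; N \<in> Ob Mod\<rbrakk> \<Longrightarrow> natural M N (cpt M N t)"
  by (simp add: natural_def hom_arr hom_natural)

lemma natural_mk_hom:
  "\<lbrakk>natural M N \<tau>; M \<in> Ob Mod; N \<in> Ob Mod\<rbrakk> \<Longrightarrow> mk_hom \<tau> \<in> Hom Mod M N"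
  by (rule mk_hom) (auto simp: natural_def)

lemma natural_cmp:
  assumes "natural M N \<tau>" "natural N P \<sigma>" and [simp]: "M \<in> Ob Mod" "N \<in> Ob Mod" "P \<in> Ob Mod"
  shows "natural M P (\<lambda>c. \<sigma> c \<bullet> \<tau> c)"
proof -
  note [simp] = natural_arr[OF assms(1)] natural_arr[OF assms(2)] module_simps(1,2)
  have "(\<sigma> b \<bullet> \<tau> b) \<bullet> act M a b = act P a b \<bullet> (Idt (EHom C a b) \<boxtimes> (\<sigma> a \<bullet> \<tau> a))"
    if [simp]: "a \<in> EOb C" "b \<in> EOb C" for a b
  proof -
    have "(\<sigma> b \<bullet> \<tau> b) \<bullet> act M a b = (\<sigma> b \<bullet> act N a b) \<bullet> (Idt (EHom C a b) \<boxtimes> \<tau> a)"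
      by (simp add: natural_act[OF assms(1)])
    then show ?thesis
      by (simp add: natural_act[OF assms(2)])
  qed
  then show ?thesis by (simp add: natural_def)
qed

text \<open>Both sides of a naturality square are additive; for the second one this is where
  additivity of B \<otimes> - enters.\<close>

lemma natural_plus_act:
  assumes "\<And>c. c \<in> EOb C \<Longrightarrow> \<guillemotleft>\<tau> c : fob M c \<rightarrow> fob N c\<guillemotright>" "\<And>c. c \<in> EOb C \<Longrightarrow> \<guillemotleft>\<sigma> c : fob M c \<rightarrow> fob N c\<guillemotright>"
    and [simp]: "M \<in> Ob Mod" "N \<in> Ob Mod" "a \<in> EOb C" "b \<in> EOb C"
  shows "(\<tau> b \<^bold>+ \<sigma> b) \<bullet> act M a b = \<tau> b \<bullet> act M a b \<^bold>+ \<sigma> b \<bullet> act M a b"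
    and "act N a b \<bullet> (Idt (EHom C a b) \<boxtimes> (\<tau> a \<^bold>+ \<sigma> a))
      = act N a b \<bullet> (Idt (EHom C a b) \<boxtimes> \<tau> a) \<^bold>+ act N a b \<bullet> (Idt (EHom C a b) \<boxtimes> \<sigma> a)"
proof -
  note [simp] = assms(1,2) module_simps(1,2)
  show "(\<tau> b \<^bold>+ \<sigma> b) \<bullet> act M a b = \<tau> b \<bullet> act M a b \<^bold>+ \<sigma> b \<bullet> act M a b"
    by (rule plus_cmp[of _ _ "fob M b" _ "fob N b"]) simp_all
  show "act N a b \<bullet> (Idt (EHom C a b) \<boxtimes> (\<tau> a \<^bold>+ \<sigma> a))
      = act N a b \<bullet> (Idt (EHom C a b) \<boxtimes> \<tau> a) \<^bold>+ act N a b \<bullet> (Idt (EHom C a b) \<boxtimes> \<sigma> a)"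
    by (subst tens_plus[of _ "fob M a" "fob N a"], simp_all)
      (rule cmp_plus[of _ "EHom C a b \<otimes>\<^sub>o fob M a" "EHom C a b \<otimes>\<^sub>o fob N a" _ _ "fob N b"], simp_all)
qed

lemma natural_plus:
  assumes "natural M N \<tau>" "natural M N \<sigma>" "M \<in> Ob Mod" "N \<in> Ob Mod"
  shows "natural M N (\<lambda>c. \<tau> c \<^bold>+ \<sigma> c)"
  using natural_arr[OF assms(1)] natural_arr[OF assms(2)] assms
    natural_act[OF assms(1)] natural_act[OF assms(2)]
  by (simp add: natural_def[of M N "\<lambda>c. \<tau> c \<^bold>+ \<sigma> c"] natural_plus_act)

text \<open>Cancelling the square of \<sigma> from that of the sum leaves the square of \<tau>. It
  serves for 1 - s e, which is known only through its sum with s e.\<close>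

lemma natural_diff:
  assumes sum: "natural M N (\<lambda>c. \<tau> c \<^bold>+ \<sigma> c)" and \<sigma>: "natural M N \<sigma>"
    and \<tau>: "\<And>c. c \<in> EOb C \<Longrightarrow> \<guillemotleft>\<tau> c : fob M c \<rightarrow> fob N c\<guillemotright>" and [simp]: "M \<in> Ob Mod" "N \<in> Ob Mod"
  shows "natural M N \<tau>"
  unfolding natural_def
proof (intro conjI ballI)
  note [simp] = \<tau> natural_arr[OF \<sigma>] module_simps(1,2)
  fix a b assume [simp]: "a \<in> EOb C" "b \<in> EOb C"
  show "\<tau> b \<bullet> act M a b = act N a b \<bullet> (Idt (EHom C a b) \<boxtimes> \<tau> a)"
  proof (rule plus_right_cancel[where h = "\<sigma> b \<bullet> act M a b"])
    show "\<tau> b \<bullet> act M a b \<^bold>+ \<sigma> b \<bullet> act M a b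
        = act N a b \<bullet> (Idt (EHom C a b) \<boxtimes> \<tau> a) \<^bold>+ \<sigma> b \<bullet> act M a b"
      using natural_act[OF sum, of a b] natural_act[OF \<sigma>, of a b]
      by (simp add: natural_plus_act[of \<tau> M N \<sigma>])
  qed simp_all
qed (use \<tau> in auto)

lemma natural_Zer:
  assumes [simp]: "M \<in> Ob Mod" "N \<in> Ob Mod"
  shows "natural M N (\<lambda>c. Zer (fob M c) (fob N c))"
  using module_simps(1,2)[OF assms(1)] module_simps(1,2)[OF assms(2)] by (simp add: natural_def)

text \<open>The zero object of A in every component, with zero action; the unit law holds because
  every arrow into a zero object is zero.\<close>

lemma Mod_zero_object:
  obtains Z where "zero_object Mod Z"
proof -
  obtain Z where Z: "zero_object A Z" using zero_ob by blast
  have [simp]: "Z \<in> Ob A" using Z by (simp add: zero_object_def)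
  have "lu Z = Zer (unit A \<otimes>\<^sub>o Z) Z"
    by (rule zero_object_arrow(1)[OF Z]) simp
  then have "module_action (\<lambda>_. Z) (\<lambda>a b. Zer (EHom C a b \<otimes>\<^sub>o Z) Z)"
    by (simp add: module_action_def)
  note M = mk_module[OF this]
  let ?Z = "mk_module (\<lambda>_. Z) (\<lambda>a b. Zer (EHom C a b \<otimes>\<^sub>o Z) Z)"
  have "zero_object Mod ?Z"
    unfolding zero_object_def
  proof (intro conjI ballI)
    fix X assume X: "X \<in> Ob Mod"
    show "\<exists>!f. f \<in> Hom Mod X ?Z"
    proof (rule ex1I)
      show "mk_hom (\<lambda>c. Zer (fob X c) (fob ?Z c)) \<in> Hom Mod X ?Z"
        using natural_Zer X M(1) by (intro natural_mk_hom)
      then show "f = mk_hom (\<lambda>c. Zer (fob X c) (fob ?Z c))" if "f \<in> Hom Mod X ?Z" for f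
      proof (rule hom_eqI[OF that])
        fix c assume c [simp]: "c \<in> EOb C"
        have "cpt X ?Z f c = Zer (fob X c) (fob ?Z c)"
          unfolding M(2)[OF c] by (rule zero_object_arrow(1)[OF Z]) (simp add: M hom_arr[OF that] X)
        then show "cpt X ?Z f c = cpt X ?Z (mk_hom (\<lambda>c. Zer (fob X c) (fob ?Z c))) c"
          by (simp add: cpt_mk_hom M module_simps(1)[OF X])
      qed
    qed
    show "\<exists>!f. f \<in> Hom Mod ?Z X"
    proof (rule ex1I)
      show "mk_hom (\<lambda>c. Zer (fob ?Z c) (fob X c)) \<in> Hom Mod ?Z X"
        using natural_Zer X M(1) by (intro natural_mk_hom)
      then show "f = mk_hom (\<lambda>c. Zer (fob ?Z c) (fob X c))" if "f \<in> Hom Mod ?Z X" for f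
      proof (rule hom_eqI[OF that])
        fix c assume c [simp]: "c \<in> EOb C"
        have "cpt ?Z X f c = Zer (fob ?Z c) (fob X c)"
          unfolding M(2)[OF c] by (rule zero_object_arrow(2)[OF Z]) (simp add: M hom_arr[OF that] X)
        then show "cpt ?Z X f c = cpt ?Z X (mk_hom (\<lambda>c. Zer (fob ?Z c) (fob X c))) c"
          by (simp add: cpt_mk_hom M module_simps(1)[OF X])
      qed
    qed
  qed (rule M(1))
  then show thesis by (rule that)
qed

lemma Mod_zero_arrow:
  assumes M: "M \<in> Ob Mod" and N: "N \<in> Ob Mod" and t: "t \<in> Hom Mod M N"
    and zero: "\<And>c. c \<in> EOb C \<Longrightarrow> cpt M N t c = Zer (fob M c) (fob N c)"
  shows "zero_arrow Mod M N t"
proof -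
  obtain Z where Z: "zero_object Mod Z" by (rule Mod_zero_object)
  have ZM: "Z \<in> Ob Mod" using Z by (simp add: zero_object_def)
  note [simp] = module_simps(1,2)[OF M] module_simps(1,2)[OF N] module_simps(1,2)[OF ZM]
  let ?u = "mk_hom (\<lambda>c. Zer (fob M c) (fob Z c))" and ?v = "mk_hom (\<lambda>c. Zer (fob Z c) (fob N c))"
  have u: "?u \<in> Hom Mod M Z" and v: "?v \<in> Hom Mod Z N"
    using M N ZM by (auto intro: natural_mk_hom natural_Zer)
  have "t = ?v \<cdot>\<^bsub>Mod\<^esub> ?u"
    by (rule hom_eqI[OF t Mod_comp_in_hom[OF M ZM N u v]])
      (simp add: zero cpt_comp[of _ _ _ _ _ Z] cpt_mk_hom)
  then show ?thesis
    using Z u v unfolding zero_arrow_def by blast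
qed

text \<open>The universal property is stated in each component, for arbitrary objects W of A, since
  both applications argue in a single component. The last clause reduces naturality out of Q to
  naturality out of N.\<close>

lemma Mod_cokernel:
  assumes M: "M \<in> Ob Mod" and N: "N \<in> Ob Mod" and t: "t \<in> Hom Mod M N"
  obtains Q q where "Q \<in> Ob Mod" "natural N Q q"
    "\<And>c. c \<in> EOb C \<Longrightarrow> q c \<bullet> cpt M N t c = Zer (fob M c) (fob Q c)"
    "\<And>c u W. \<lbrakk>c \<in> EOb C; \<guillemotleft>u : fob N c \<rightarrow> W\<guillemotright>; u \<bullet> cpt M N t c = Zer (fob M c) W\<rbrakk>
      \<Longrightarrow> \<exists>h. \<guillemotleft>h : fob Q c \<rightarrow> W\<guillemotright> \<and> h \<bullet> q c = u"
    "\<And>c u v W. \<lbrakk>c \<in> EOb C; \<guillemotleft>u : fob Q c \<rightarrow> W\<guillemotright>; \<guillemotleft>v : fob Q c \<rightarrow> W\<guillemotright>; u \<bullet> q c = v \<bullet> q c\<rbrakk> \<Longrightarrow> u = v"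
    "\<And>R h. \<lbrakk>R \<in> Ob Mod; \<And>c. c \<in> EOb C \<Longrightarrow> \<guillemotleft>h c : fob Q c \<rightarrow> fob R c\<guillemotright>; natural N R (\<lambda>c. h c \<bullet> q c)\<rbrakk>
      \<Longrightarrow> natural Q R h"
proof -
  note [simp] = module_simps(1,2)[OF M] module_simps(1,2)[OF N] hom_arr[OF t M N]
  have tc: "t c \<in> Hom A (fob M c) (fob N c)" if "c \<in> EOb C" for c
    using hom_arr[OF t M N that] by (simp add: cpt_def)
  then have "\<exists>P k. is_cokernel A (fob M c) (fob N c) (t c) P k" if "c \<in> EOb C" for c
    using that by (intro ex_cokernel) auto
  then obtain P k where cok: "\<And>c. c \<in> EOb C \<Longrightarrow> is_cokernel A (fob M c) (fob N c) (t c) (P c) (k c)"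
    by metis
  define q where "q c = Arrow (fob N c) (P c) (k c)" for c
  have q: "\<guillemotleft>q c : fob N c \<rightarrow> P c\<guillemotright>" "q c \<bullet> cpt M N t c = Zer (fob M c) (P c)"
      "\<And>u W. \<lbrakk>\<guillemotleft>u : fob N c \<rightarrow> W\<guillemotright>; u \<bullet> cpt M N t c = Zer (fob M c) W\<rbrakk>
        \<Longrightarrow> \<exists>h. \<guillemotleft>h : P c \<rightarrow> W\<guillemotright> \<and> h \<bullet> q c = u"
      "jointly_epic {()} (P c) (\<lambda>_. q c)" if "c \<in> EOb C" for c
    unfolding q_def cpt_def
    using cokernel_arrow[OF cok[OF that] _ _ tc[OF that]] that by simp_all
  note [simp] = q(1,2)
  have [simp]: "P c \<in> Ob A" if "c \<in> EOb C" for c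
    using jointly_epic_arr(1)[OF q(4)[OF that]] .
  have ex: "\<exists>m. \<guillemotleft>m : EHom C a b \<otimes>\<^sub>o P a \<rightarrow> P b\<guillemotright> \<and>
      (\<forall>i\<in>{()}. m \<bullet> (Idt (EHom C a b) \<boxtimes> q a) = q b \<bullet> act N a b)"
    if [simp]: "a \<in> EOb C" "b \<in> EOb C" for a b
  proof -
    \<comment> \<open>By naturality of t, the action on N followed by q kills C(a,b) \<otimes> t a.
      It therefore descends to the tensored cokernel, which defines the action on Q.\<close>
    have "(q b \<bullet> act N a b) \<bullet> (Idt (EHom C a b) \<boxtimes> cpt M N t a) = (q b \<bullet> cpt M N t b) \<bullet> act M a b"
      using hom_natural[OF t M N that] by (simp del: q(2))
    also have "\<dots> = Zer (EHom C a b \<otimes>\<^sub>o fob M a) (P b)"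
      by (subst q(2)) simp_all
    finally have "(q b \<bullet> act N a b) \<bullet> (Idt (EHom C a b) \<boxtimes> Arrow (fob M a) (fob N a) (t a)) =
        Zer (EHom C a b \<otimes>\<^sub>o fob M a) (P b)"
      by (simp add: cpt_def)
    then obtain h where "\<guillemotleft>h : EHom C a b \<otimes>\<^sub>o P a \<rightarrow> P b\<guillemotright>"
        "h \<bullet> (Idt (EHom C a b) \<boxtimes> q a) = q b \<bullet> act N a b"
      using tens_cokernel[OF cok[of a] _ _ tc[of a], of "EHom C a b" "q b \<bullet> act N a b" "P b"]
      unfolding q_def[of a] by auto
    then show ?thesis by blast
  qed
  obtain Q where Q: "Q \<in> Ob Mod" "\<And>c. c \<in> EOb C \<Longrightarrow> fob Q c = P c"
    "mk_hom q \<in> Hom Mod N Q"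
    "\<And>R h. \<lbrakk>R \<in> Ob Mod; \<And>c. c \<in> EOb C \<Longrightarrow> \<guillemotleft>h c : P c \<rightarrow> fob R c\<guillemotright>;
        mk_hom (\<lambda>c. h c \<bullet> q c) \<in> Hom Mod N R\<rbrakk> \<Longrightarrow> mk_hom h \<in> Hom Mod Q R"
    using glue_module[of "{()}" "\<lambda>_. N" P "\<lambda>c _. q c", OF _ q(4) _ ex] N by auto
  show thesis
  proof
    show "Q \<in> Ob Mod" by (rule Q(1))
    show "natural N Q q"
      using natural_cpt[OF Q(3) N Q(1)] q(1) Q(2) by (simp add: natural_def cpt_mk_hom)
    show "q c \<bullet> cpt M N t c = Zer (fob M c) (fob Q c)" if "c \<in> EOb C" for c
      using that by (simp add: Q(2))
    show "\<exists>h. \<guillemotleft>h : fob Q c \<rightarrow> W\<guillemotright> \<and> h \<bullet> q c = u"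
      if "c \<in> EOb C" "\<guillemotleft>u : fob N c \<rightarrow> W\<guillemotright>" "u \<bullet> cpt M N t c = Zer (fob M c) W" for c u W
      using q(3)[OF that] Q(2)[OF that(1)] by simp
    show "u = v" if "c \<in> EOb C" "\<guillemotleft>u : fob Q c \<rightarrow> W\<guillemotright>" "\<guillemotleft>v : fob Q c \<rightarrow> W\<guillemotright>" "u \<bullet> q c = v \<bullet> q c" for c u v W
      using that(2-4) unfolding Q(2)[OF that(1)] by (rule jointly_epicD[OF q(4)[OF that(1)]])
    show "natural Q R h"
      if R: "R \<in> Ob Mod" and h: "\<And>c. c \<in> EOb C \<Longrightarrow> \<guillemotleft>h c : fob Q c \<rightarrow> fob R c\<guillemotright>"
        and nat: "natural N R (\<lambda>c. h c \<bullet> q c)" for R h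
    proof -
      have "mk_hom h \<in> Hom Mod Q R"
        using h Q(2) natural_mk_hom[OF nat N R] by (intro Q(4)[OF R]) auto
      from natural_cpt[OF this Q(1) R] show ?thesis
        using h by (simp add: natural_def cpt_mk_hom)
    qed
  qed
qed

text \<open>With q the cokernel of e, the morphisms q and 0 agree after e, so q = 0. If u and v
  agree after the component of e at c, their difference factors through \<open>q c\<close>, hence
  vanishes.\<close>

lemma Mod_epi_cpt:
  assumes epi: "is_epi Mod M N e" and M: "M \<in> Ob Mod" and N: "N \<in> Ob Mod" and c: "c \<in> EOb C"
  shows "is_epi A (fob M c) (fob N c) (e c)"
proof -
  have e: "e \<in> Hom Mod M N" using epi by (simp add: is_epi_def)
  note [simp] = module_simps(1,2)[OF M] module_simps(1,2)[OF N] hom_arr[OF e M N] c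
  obtain Q q where Q: "Q \<in> Ob Mod" and q: "natural N Q q"
    and q0: "\<And>c. c \<in> EOb C \<Longrightarrow> q c \<bullet> cpt M N e c = Zer (fob M c) (fob Q c)"
    and fac: "\<And>c u W. \<lbrakk>c \<in> EOb C; \<guillemotleft>u : fob N c \<rightarrow> W\<guillemotright>; u \<bullet> cpt M N e c = Zer (fob M c) W\<rbrakk>
      \<Longrightarrow> \<exists>h. \<guillemotleft>h : fob Q c \<rightarrow> W\<guillemotright> \<and> h \<bullet> q c = u"
    by (rule Mod_cokernel[OF M N e], rule that, assumption+)
  note [simp] = module_simps(1,2)[OF Q] natural_arr[OF q]
  let ?z = "\<lambda>c. Zer (fob N c) (fob Q c)"
  have qz: "mk_hom q \<in> Hom Mod N Q" "mk_hom ?z \<in> Hom Mod N Q"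
    using q N Q by (auto intro: natural_mk_hom natural_Zer)
  have "mk_hom q \<cdot>\<^bsub>Mod\<^esub> e = mk_hom ?z \<cdot>\<^bsub>Mod\<^esub> e"
    by (rule hom_eqI[OF Mod_comp_in_hom[OF M N Q e] Mod_comp_in_hom[OF M N Q e]])
      (simp_all add: qz cpt_comp[of _ _ _ _ _ N] cpt_mk_hom q0)
  then have "mk_hom q = mk_hom ?z"
    using epi qz Q unfolding is_epi_def by blast
  then have "cpt N Q (mk_hom q) c = cpt N Q (mk_hom ?z) c" by simp
  then have qc: "q c = Zer (fob N c) (fob Q c)"
    by (simp add: cpt_mk_hom)
  show ?thesis
    unfolding is_epi_def
  proof (intro conjI ballI impI)
    show "e c \<in> Hom A (fob M c) (fob N c)"
      using hom_arr[OF e M N c] by (simp add: cpt_def)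
    fix W u v
    assume W [simp]: "W \<in> Ob A" and u: "u \<in> Hom A (fob N c) W" and v: "v \<in> Hom A (fob N c) W"
      and eq: "u \<cdot> e c = v \<cdot> e c"
    let ?u = "Arrow (fob N c) W u" and ?v = "Arrow (fob N c) W v"
    have [simp]: "arr ?u" "arr ?v" using u v by simp_all
    \<comment> \<open>The arrow d is u - v.\<close>
    obtain d where d: "\<guillemotleft>d : fob N c \<rightarrow> W\<guillemotright>" "d \<^bold>+ ?v = ?u"
      by (rule ex_diff[of ?v "fob N c" W ?u]) (simp_all add: u v)
    have "d \<bullet> cpt M N e c = Zer (fob M c) W"
    proof (rule plus_right_cancel[where h = "?v \<bullet> cpt M N e c"])
      have "d \<bullet> cpt M N e c \<^bold>+ ?v \<bullet> cpt M N e c = (d \<^bold>+ ?v) \<bullet> cpt M N e c"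
        using d(1) by (subst plus_cmp[of _ "fob M c" "fob N c" _ W]) (simp_all add: v)
      also have "\<dots> = ?v \<bullet> cpt M N e c"
        unfolding d(2) using eq by (simp add: cpt_def cmp_Arrow)
      finally show "d \<bullet> cpt M N e c \<^bold>+ ?v \<bullet> cpt M N e c = Zer (fob M c) W \<^bold>+ ?v \<bullet> cpt M N e c"
        by (simp add: v)
    qed (use d in \<open>simp_all add: v\<close>)
    then obtain h where "\<guillemotleft>h : fob Q c \<rightarrow> W\<guillemotright>" "h \<bullet> q c = d"
      using fac[OF c d(1)] by blast
    then have "d = Zer (fob N c) W"
      by (auto simp: qc)
    then have "?v = ?u"
      using d(2) by (simp add: u v)
    then show "u = v" by simp
  qed
qed

text \<open>A lifting problem for x \<otimes> C(c,-) becomes, by the Yoneda correspondence, one for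
  x along the component of e at c, which is an epimorphism by \<open>Mod_epi_cpt\<close>.\<close>

lemma projective_tensor_rep:
  assumes x: "projective A x" and c: "c \<in> EOb C"
  shows "projective Mod (tensor_rep A C x c)"
  unfolding projective_def
proof (intro conjI ballI allI impI)
  have xO: "x \<in> Ob A" using x by (simp add: projective_def)
  let ?T = "tensor_rep A C x c"
  show T: "?T \<in> Ob Mod" by (rule tensor_rep(1)[OF xO c])
  fix M N e f
  assume M: "M \<in> Ob Mod" and N: "N \<in> Ob Mod" and ef: "is_epi Mod M N e \<and> f \<in> Hom Mod ?T N"
  then have e: "e \<in> Hom Mod M N" and f: "f \<in> Hom Mod ?T N"
    by (simp_all add: is_epi_def)
  note [simp] = module_simps(1,2)[OF M] module_simps(1,2)[OF N] hom_arr[OF e M N] hom_arr[OF f T N] c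
    tensor_rep(2)[OF xO c] xO
  let ?f = "cpt ?T N f c \<bullet> rep_unit x c"
  have f': "\<guillemotleft>?f : x \<rightarrow> fob N c\<guillemotright>" by simp
  have "lab ?f \<in> Hom A x (fob N c)"
    using f' by (intro arr_lab) auto
  moreover have "is_epi A (fob M c) (fob N c) (e c)"
    using ef M N by (intro Mod_epi_cpt) auto
  ultimately obtain g where g: "g \<in> Hom A x (fob M c)" "e c \<cdot> g = lab ?f"
    using x unfolding projective_def by (metis \<open>c \<in> EOb C\<close> M N module_simps(1))
  let ?g = "Arrow x (fob M c) g"
  have g': "\<guillemotleft>?g : x \<rightarrow> fob M c\<guillemotright>" using g by simp
  have eg: "cpt M N e c \<bullet> ?g = ?f"
    using g(2) by (intro arrow_eqI) simp_all
  let ?h = "mk_hom (rep_hom M c ?g)"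
  have h: "?h \<in> Hom Mod ?T M" by (rule rep_hom[OF xO c M g'])
  have eh: "e \<cdot>\<^bsub>Mod\<^esub> ?h \<in> Hom Mod ?T N" by (rule Mod_comp_in_hom[OF T M N h e])
  have hc: "cpt ?T M ?h d = rep_hom M c ?g d" if "d \<in> EOb C" for d
    using rep_hom_arr[OF xO c M g' that] that by (simp add: cpt_mk_hom)
  have "e \<cdot>\<^bsub>Mod\<^esub> ?h = f"
  proof (rule hom_eqI[OF eh f])
    fix d assume d: "d \<in> EOb C"
    \<comment> \<open>Morphisms out of \<open>?T\<close> are determined by their values on
      \<open>rep_unit\<close>, so only these are compared.\<close>
    have "cpt ?T N (e \<cdot>\<^bsub>Mod\<^esub> ?h) c \<bullet> rep_unit x c = cpt M N e c \<bullet> rep_hom M c ?g c \<bullet> rep_unit x c"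
      using rep_hom_arr[OF xO c M g' c] by (simp add: cpt_comp[of _ _ _ _ _ M] hc)
    also have "\<dots> = ?f"
      by (simp add: rep_hom_unit[OF xO c M g'] eg)
    finally show "cpt ?T N (e \<cdot>\<^bsub>Mod\<^esub> ?h) d = cpt ?T N f d"
      by (simp add: rep_hom_eta[OF xO c N eh d] rep_hom_eta[OF xO c N f d])
  qed
  then show "\<exists>g\<in>Hom Mod ?T M. e \<cdot>\<^bsub>Mod\<^esub> g = f"
    using h by blast
qed

end

section \<open>Coproducts, direct summands and projectives\<close>

text \<open>\<open>cocomplete\<close> speaks of shapes with objects and arrows in \<open>'u\<close>,
  whereas I may have another type. Since |I| is below \<kappa> and \<kappa> has the cardinality of
  its field, I embeds into \<open>'u\<close>; the coproduct is the colimit over the discrete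
  category on the image.\<close>

lemma cocomplete_coproduct:
  fixes \<kappa> :: "'u rel" and A :: "('o, 'm, 'x) cat_scheme" (structure)
  assumes \<kappa>: "Cinfinite \<kappa>" and "category A" and cocomp: "cocomplete \<kappa> A" and I: "small \<kappa> I"
    and X: "\<And>i. i \<in> I \<Longrightarrow> X i \<in> Ob A"
  shows "\<exists>P inc. is_coproduct A I X P inc"
proof -
  interpret category A by fact
  have "|I| \<le>o \<kappa>"
    using I unfolding small_def by (rule ordLess_imp_ordLeq)
  moreover have "\<kappa> =o |Field \<kappa>|"
    using \<kappa> card_of_Field_ordIso ordIso_symmetric by (auto simp: cinfinite_def)
  ultimately have "|I| \<le>o |Field \<kappa>|"
    by (rule ordLeq_ordIso_trans)
  then obtain g :: "'a \<Rightarrow> 'u" where g: "inj_on g I"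
    by (auto simp flip: card_of_ordLeq)
  \<comment> \<open>Each object serves as its own identity arrow, so the set of all arrows is again
    the image of I and is small.\<close>
  define J :: "('u, 'u) cat" where
    "J = \<lparr>Ob = g ` I, Hom = \<lambda>i j. if i = j then {i} else {}, idm = \<lambda>i. i, Comp = \<lambda>f f'. f\<rparr>"
  have J [simp]: "Ob J = g ` I" "Hom J i j = (if i = j then {i} else {})" "idm J i = i" "f \<cdot>\<^bsub>J\<^esub> f' = f" for i j f f'
    by (simp_all add: J_def)
  have "|g ` I| <o \<kappa>"
    using I ordLeq_ordLess_trans[OF card_of_image] unfolding small_def by blast
  moreover have "(\<Union>i\<in>Ob J. \<Union>j\<in>Ob J. Hom J i j) = g ` I"
    by (auto split: if_splits)
  moreover have "category J"
    by standard (auto split: if_splits)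
  ultimately have smallJ: "small_category \<kappa> J"
    by (simp add: small_category_def small_def)
  define D where "D = X \<circ> inv_into I g"
  define Dm where "Dm = idm A \<circ> D"
  have D [simp]: "D (g i) = X i" if "i \<in> I" for i
    using that g by (simp add: D_def)
  have "is_functor J A D Dm"
    using X unfolding is_functor_def by (auto simp: Dm_def id_in_hom id_left[OF _ _ id_in_hom] inj_on_eq_iff[OF g] split: if_splits)
  then obtain L q where L: "is_colimit J A D Dm L q"
    using cocomp smallJ unfolding cocomplete_def by blast
  \<comment> \<open>In a discrete shape the only compatibility conditions concern identities, so a
    cocone is merely a family of arrows.\<close>
  have cocone: "is_cocone J A D Dm Y f \<longleftrightarrow> Y \<in> Ob A \<and> (\<forall>i\<in>I. f (g i) \<in> Hom A (X i) Y)" for Y f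
  proof -
    have "f (g i) \<cdot> idm A (X i) = f (g i)" if "Y \<in> Ob A" "i \<in> I" "f (g i) \<in> Hom A (X i) Y" for i
      using id_right that X by blast
    then show ?thesis
      by (auto simp: is_cocone_def Dm_def split: if_splits)
  qed
  have "is_coproduct A I X L (q \<circ> g)"
    unfolding is_coproduct_def
  proof (intro conjI ballI allI impI)
    show "L \<in> Ob A" "\<And>i. i \<in> I \<Longrightarrow> X i \<in> Ob A" "\<And>i. i \<in> I \<Longrightarrow> (q \<circ> g) i \<in> Hom A (X i) L"
      using L X by (auto simp: is_colimit_def cocone)
    fix Y f assume Y: "Y \<in> Ob A" and f: "\<forall>i\<in>I. f i \<in> Hom A (X i) Y"
    have "is_cocone J A D Dm Y (f \<circ> inv_into I g)"
      using Y f g by (simp add: cocone)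
    then have "\<exists>!h. h \<in> Hom A L Y \<and> (\<forall>j\<in>Ob J. h \<cdot> q j = (f \<circ> inv_into I g) j)"
      using L unfolding is_colimit_def by blast
    then show "\<exists>!h. h \<in> Hom A L Y \<and> (\<forall>i\<in>I. h \<cdot> (q \<circ> g) i = f i)"
      using g by simp
  qed
  then show ?thesis by blast
qed

section \<open>Coproducts of modules\<close>

context enriched_modules
begin

text \<open>Coproducts are taken in each component; \<open>tens_coproduct\<close> supplies the glued
  action and \<open>glue_module\<close> its laws.\<close>

lemma Mod_coproduct:
  assumes N: "\<And>i. i \<in> I \<Longrightarrow> N i \<in> Ob Mod"
    and ex_cop: "\<And>c. c \<in> EOb C \<Longrightarrow> \<exists>P inc. is_coproduct A I (\<lambda>i. fob (N i) c) P inc"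
  shows "\<exists>Q inc. is_coproduct Mod I N Q inc"
proof -
  note [simp] = module_simps(1,2)[OF N]
  obtain P k where cop: "\<And>c. c \<in> EOb C \<Longrightarrow> is_coproduct A I (\<lambda>i. fob (N i) c) (P c) (k c)"
    using ex_cop by metis
  define \<iota> where "\<iota> c i = Arrow (fob (N i) c) (P c) (k c i)" for c i
  have epi: "jointly_epic I (P c) (\<iota> c)" if "c \<in> EOb C" for c
    using coproduct_arrow(1)[OF cop[OF that]] by (simp add: \<iota>_def[abs_def])
  have [simp]: "P c \<in> Ob A" if "c \<in> EOb C" for c
    using jointly_epic_arr(1)[OF epi[OF that]] .
  have \<iota> [simp]: "arr (\<iota> c i)" "src (\<iota> c i) = fob (N i) c" "tgt (\<iota> c i) = P c" if "c \<in> EOb C" "i \<in> I" for c i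
    using jointly_epic_arr(2)[OF epi that(2)] that by (simp_all add: \<iota>_def)
  have ex: "\<exists>m. \<guillemotleft>m : EHom C a b \<otimes>\<^sub>o P a \<rightarrow> P b\<guillemotright> \<and>
      (\<forall>i\<in>I. m \<bullet> (Idt (EHom C a b) \<boxtimes> \<iota> a i) = \<iota> b i \<bullet> act (N i) a b)"
    if [simp]: "a \<in> EOb C" "b \<in> EOb C" for a b
    by (rule tens_coproduct[OF cop[of a], of "EHom C a b" "P b" "\<lambda>i. \<iota> b i \<bullet> act (N i) a b"])
      (auto simp: \<iota>_def[of a])
  obtain Q where Q: "Q \<in> Ob Mod" "\<And>c. c \<in> EOb C \<Longrightarrow> fob Q c = P c"
    "\<And>i. i \<in> I \<Longrightarrow> mk_hom (\<lambda>c. \<iota> c i) \<in> Hom Mod (N i) Q"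
    "\<And>R h. \<lbrakk>R \<in> Ob Mod; \<And>c. c \<in> EOb C \<Longrightarrow> \<guillemotleft>h c : P c \<rightarrow> fob R c\<guillemotright>;
        \<And>i. i \<in> I \<Longrightarrow> mk_hom (\<lambda>c. h c \<bullet> \<iota> c i) \<in> Hom Mod (N i) R\<rbrakk> \<Longrightarrow> mk_hom h \<in> Hom Mod Q R"
  proof (rule glue_module[OF N epi \<iota>(2) ex], assumption+, goal_cases)
    case 1
    show ?case by (rule 1(1)[OF 1(2-)])
  qed
  let ?inc = "\<lambda>i. mk_hom (\<lambda>c. \<iota> c i)"
  have inc: "cpt (N i) Q (?inc i) c = \<iota> c i" if "c \<in> EOb C" "i \<in> I" for c i
    using that by (simp add: cpt_mk_hom Q(2))
  have "is_coproduct Mod I N Q ?inc"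
    unfolding is_coproduct_def
  proof (intro conjI ballI allI impI)
    fix R f
    assume R: "R \<in> Ob Mod" and "\<forall>i\<in>I. f i \<in> Hom Mod (N i) R"
    then have f: "f i \<in> Hom Mod (N i) R" if "i \<in> I" for i
      using that by blast
    have "\<exists>h. \<guillemotleft>h : P c \<rightarrow> fob R c\<guillemotright> \<and> (\<forall>i\<in>I. h \<bullet> \<iota> c i = cpt (N i) R (f i) c)" if c: "c \<in> EOb C" for c
      unfolding \<iota>_def using module_simps(1)[OF R c] hom_arr[OF f N R c]
      by (intro coproduct_arrow(2)[OF cop[OF c]]) simp_all
    then obtain h where h: "\<And>c. c \<in> EOb C \<Longrightarrow> \<guillemotleft>h c : P c \<rightarrow> fob R c\<guillemotright>"
        "\<And>c i. \<lbrakk>c \<in> EOb C; i \<in> I\<rbrakk> \<Longrightarrow> h c \<bullet> \<iota> c i = cpt (N i) R (f i) c"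
      by metis
    \<comment> \<open>The glued components restrict to the given morphisms, so naturality of h
      follows from the last clause of \<open>glue_module\<close>.\<close>
    have "mk_hom (\<lambda>c. h c \<bullet> \<iota> c i) = f i" if i: "i \<in> I" for i
    proof (rule extensionalityI)
      show "mk_hom (\<lambda>c. h c \<bullet> \<iota> c i) \<in> extensional (EOb C)" by (simp add: mk_hom_def)
      show "f i \<in> extensional (EOb C)"
        using f[OF i] by (simp add: module_hom_iff N[OF i] R)
      show "mk_hom (\<lambda>c. h c \<bullet> \<iota> c i) c = f i c" if c: "c \<in> EOb C" for c
        using c arg_cong[OF h(2)[OF c i], of lab] by (simp add: mk_hom_def)
    qed
    then have mk_h: "mk_hom h \<in> Hom Mod Q R"
      using f by (intro Q(4) R h(1)) simp_all
    show "\<exists>!h. h \<in> Hom Mod Q R \<and> (\<forall>i\<in>I. h \<cdot>\<^bsub>Mod\<^esub> ?inc i = f i)"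
    proof (rule ex1I, intro conjI ballI)
      show "mk_hom h \<in> Hom Mod Q R" by (rule mk_h)
      fix i assume i: "i \<in> I"
      show "mk_hom h \<cdot>\<^bsub>Mod\<^esub> ?inc i = f i"
      proof (rule hom_eqI[OF Mod_comp_in_hom[OF N[OF i] Q(1) R Q(3)[OF i] mk_h] f[OF i]])
        fix c assume c: "c \<in> EOb C"
        have "cpt Q R (mk_hom h) c = h c"
          using h(1)[OF c] Q(2)[OF c] c by (intro cpt_mk_hom) simp_all
        then show "cpt (N i) R (mk_hom h \<cdot>\<^bsub>Mod\<^esub> ?inc i) c = cpt (N i) R (f i) c"
          using inc[OF c i] h(2)[OF c i] by (simp add: cpt_comp[OF c, of _ _ _ _ Q])
      qed
    next
      fix h' assume h': "h' \<in> Hom Mod Q R \<and> (\<forall>i\<in>I. h' \<cdot>\<^bsub>Mod\<^esub> ?inc i = f i)"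
      show "h' = mk_hom h"
      proof (rule hom_eqI[OF _ mk_h])
        show "h' \<in> Hom Mod Q R" using h' by blast
        fix c assume c: "c \<in> EOb C"
        have hc: "cpt Q R (mk_hom h) c = h c"
          using h(1)[OF c] Q(2)[OF c] c by (intro cpt_mk_hom) simp_all
        have "cpt Q R h' c = h c"
        proof (rule jointly_epicD[OF epi[OF c] _ h(1)[OF c]])
          show "\<guillemotleft>cpt Q R h' c : P c \<rightarrow> fob R c\<guillemotright>"
            using hom_arr[OF _ Q(1) R c] h' Q(2)[OF c] by simp
          fix i assume i: "i \<in> I"
          have "cpt (N i) R (h' \<cdot>\<^bsub>Mod\<^esub> ?inc i) c = cpt (N i) R (f i) c"
            using h' i by simp
          then show "cpt Q R h' c \<bullet> \<iota> c i = h c \<bullet> \<iota> c i"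
            using inc[OF c i] h(2)[OF c i] by (simp add: cpt_comp[OF c, of _ _ _ _ Q])
        qed
        then show "cpt Q R h' c = cpt Q R (mk_hom h) c" by (simp add: hc)
      qed
    qed
  qed (use N Q in auto)
  then show ?thesis by blast
qed

end

section \<open>Splitting off summands, and epimorphisms from free modules\<close>

context abelian_modules
begin

text \<open>The complement of a split monomorphism \<open>s\<close> with retraction \<open>e\<close> is its cokernel \<open>q\<close>, with
  section \<open>j\<close> obtained by factoring \<open>d = 1 - s e\<close> through \<open>q\<close>.\<close>

lemma Mod_direct_summand:
  assumes M: "M \<in> Ob Mod" and F: "F \<in> Ob Mod" and sH: "s \<in> Hom Mod M F" and eH: "e \<in> Hom Mod F M"
    and es: "e \<cdot>\<^bsub>Mod\<^esub> s = idm Mod M"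
  shows "direct_summand Mod M F"
proof -
  obtain Q q where Q: "Q \<in> Ob Mod" and q: "natural F Q q"
    and qs: "\<And>c. c \<in> EOb C \<Longrightarrow> q c \<bullet> cpt M F s c = Zer (fob M c) (fob Q c)"
    and fac: "\<And>c u W. \<lbrakk>c \<in> EOb C; \<guillemotleft>u : fob F c \<rightarrow> W\<guillemotright>; u \<bullet> cpt M F s c = Zer (fob M c) W\<rbrakk>
      \<Longrightarrow> \<exists>h. \<guillemotleft>h : fob Q c \<rightarrow> W\<guillemotright> \<and> h \<bullet> q c = u"
    and qepi: "\<And>c u v W. \<lbrakk>c \<in> EOb C; \<guillemotleft>u : fob Q c \<rightarrow> W\<guillemotright>; \<guillemotleft>v : fob Q c \<rightarrow> W\<guillemotright>; u \<bullet> q c = v \<bullet> q c\<rbrakk> \<Longrightarrow> u = v"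
    and qnat: "\<And>R h. \<lbrakk>R \<in> Ob Mod; \<And>c. c \<in> EOb C \<Longrightarrow> \<guillemotleft>h c : fob Q c \<rightarrow> fob R c\<guillemotright>;
        natural F R (\<lambda>c. h c \<bullet> q c)\<rbrakk> \<Longrightarrow> natural Q R h"
  proof (rule Mod_cokernel[OF M F sH], goal_cases)
    case 1
    show ?case by (rule 1(1)[OF 1(2-)])
  qed
  define S where "S = cpt M F s"
  define E where "E = cpt F M e"
  have S: "natural M F S" and E: "natural F M E"
    using sH eH M F by (simp_all add: S_def E_def natural_cpt)
  have Sa: "\<guillemotleft>S c : fob M c \<rightarrow> fob F c\<guillemotright>" and Ea: "\<guillemotleft>E c : fob F c \<rightarrow> fob M c\<guillemotright>"
    and qa: "\<guillemotleft>q c : fob F c \<rightarrow> fob Q c\<guillemotright>" if "c \<in> EOb C" for c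
    using natural_arr[OF S that] natural_arr[OF E that] natural_arr[OF q that] by auto
  have qS: "q c \<bullet> S c = Zer (fob M c) (fob Q c)" if "c \<in> EOb C" for c
    using qs[OF that] by (simp add: S_def)
  have ES: "E c \<bullet> S c = Idt (fob M c)" if c: "c \<in> EOb C" for c
  proof -
    have "cpt M M (e \<cdot>\<^bsub>Mod\<^esub> s) c = Idt (fob M c)"
      using c by (simp add: es)
    then show ?thesis
      using cpt_comp[OF c, of M M e s F] by (simp add: S_def E_def)
  qed
  note [simp] = module_simps(1,2)[OF M] module_simps(1,2)[OF F] module_simps(1,2)[OF Q] Sa Ea qa ES qS
  have "\<exists>d j. \<guillemotleft>d : fob F c \<rightarrow> fob F c\<guillemotright> \<and> d \<^bold>+ S c \<bullet> E c = Idt (fob F c) \<and> \<guillemotleft>j : fob Q c \<rightarrow> fob F c\<guillemotright> \<and>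
      j \<bullet> q c = d \<and> E c \<bullet> j = Zer (fob Q c) (fob M c) \<and> q c \<bullet> j = Idt (fob Q c)"
    if c [simp]: "c \<in> EOb C" for c
  proof -
    let ?F = "fob F c" and ?M = "fob M c" and ?Q = "fob Q c"
    obtain d where d: "\<guillemotleft>d : ?F \<rightarrow> ?F\<guillemotright>" "d \<^bold>+ S c \<bullet> E c = Idt ?F"
      by (rule ex_diff[of "S c \<bullet> E c" ?F ?F "Idt ?F"]) simp_all
    \<comment> \<open>Composing d + S E = 1 with S on the right and with E and q on the left gives d
      S = 0, E d = 0 and q d = q. As q is epic, the last two yield E j = 0 and q j = 1.\<close>
    have "d \<bullet> S c \<^bold>+ S c = (d \<^bold>+ S c \<bullet> E c) \<bullet> S c"
      using d(1) by (subst plus_cmp[of _ ?M ?F _ ?F]) simp_all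
    also have "\<dots> = Zer ?M ?F \<^bold>+ S c"
      unfolding d(2) by simp
    finally have dS: "d \<bullet> S c = Zer ?M ?F"
      by (rule plus_right_cancel) (use d in simp_all)
    have ESE: "E c \<bullet> S c \<bullet> E c = E c"
      by (simp flip: cmp_assoc)
    have qSE: "q c \<bullet> S c \<bullet> E c = Zer ?F ?Q"
      by (simp flip: cmp_assoc)
    have "E c \<bullet> d \<^bold>+ E c = E c \<bullet> (d \<^bold>+ S c \<bullet> E c)"
      using d(1) ESE by (subst cmp_plus[of _ ?F ?F _ _ ?M]) simp_all
    also have "\<dots> = Zer ?F ?M \<^bold>+ E c"
      unfolding d(2) by simp
    finally have Ed: "E c \<bullet> d = Zer ?F ?M"
      by (rule plus_right_cancel) (use d in simp_all)
    have "q c \<bullet> d = q c \<bullet> (d \<^bold>+ S c \<bullet> E c)"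
      using d(1) qSE by (subst cmp_plus[of _ ?F ?F _ _ ?Q]) simp_all
    then have qd: "q c \<bullet> d = q c"
      unfolding d(2) by simp
    obtain j where j: "\<guillemotleft>j : ?Q \<rightarrow> ?F\<guillemotright>" "j \<bullet> q c = d"
      using fac[OF c d(1)] dS by (auto simp: S_def)
    have arrs: "\<guillemotleft>E c \<bullet> j : ?Q \<rightarrow> ?M\<guillemotright>" "\<guillemotleft>q c \<bullet> j : ?Q \<rightarrow> ?Q\<guillemotright>"
      using j by simp_all
    have "E c \<bullet> j = Zer ?Q ?M"
      by (rule qepi[OF c arrs(1)]) (use j Ed in simp_all)
    moreover have "q c \<bullet> j = Idt ?Q"
      by (rule qepi[OF c arrs(2)]) (use j qd in simp_all)
    ultimately show ?thesis using d j by blast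
  qed
  then obtain d j where dj: "\<And>c. c \<in> EOb C \<Longrightarrow> \<guillemotleft>d c : fob F c \<rightarrow> fob F c\<guillemotright> \<and> d c \<^bold>+ S c \<bullet> E c = Idt (fob F c) \<and>
      \<guillemotleft>j c : fob Q c \<rightarrow> fob F c\<guillemotright> \<and> j c \<bullet> q c = d c \<and> E c \<bullet> j c = Zer (fob Q c) (fob M c) \<and> q c \<bullet> j c = Idt (fob Q c)"
    by metis
  then have dsum: "\<And>c. c \<in> EOb C \<Longrightarrow> d c \<^bold>+ S c \<bullet> E c = Idt (fob F c)"
    and da: "\<And>c. c \<in> EOb C \<Longrightarrow> \<guillemotleft>d c : fob F c \<rightarrow> fob F c\<guillemotright>"
    and ja: "\<And>c. c \<in> EOb C \<Longrightarrow> \<guillemotleft>j c : fob Q c \<rightarrow> fob F c\<guillemotright>"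
    and jq: "\<And>c. c \<in> EOb C \<Longrightarrow> j c \<bullet> q c = d c"
    and Ej: "\<And>c. c \<in> EOb C \<Longrightarrow> E c \<bullet> j c = Zer (fob Q c) (fob M c)"
    and qj: "\<And>c. c \<in> EOb C \<Longrightarrow> q c \<bullet> j c = Idt (fob Q c)"
    by blast+
  note [simp] = da ja jq Ej qj
  \<comment> \<open>The identity d + S E and the composite S E are natural, hence so is d. The last
    clause of \<open>Mod_cokernel\<close> passes this on to j, because j q = d.\<close>
  have nat_d: "natural F F d"
  proof (rule natural_diff)
    show "natural F F (\<lambda>c. d c \<^bold>+ S c \<bullet> E c)"
      by (simp add: natural_def dsum)
    show "natural F F (\<lambda>c. S c \<bullet> E c)"
      by (rule natural_cmp[OF E S F M F])
  qed (simp_all add: F)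
  have j: "natural Q F j"
    by (rule qnat[OF F]) (use nat_d in \<open>simp_all add: natural_def\<close>)
  let ?q = "mk_hom q" and ?j = "mk_hom j"
  have qH: "?q \<in> Hom Mod F Q" and jH: "?j \<in> Hom Mod Q F"
    using natural_mk_hom[OF q F Q] natural_mk_hom[OF j Q F] .
  have cq [simp]: "cpt F Q ?q c = q c" and cj [simp]: "cpt Q F ?j c = j c"
    and cs [simp]: "cpt M F s c = S c" and ce [simp]: "cpt F M e c = E c" if "c \<in> EOb C" for c
    using that by (simp_all add: cpt_mk_hom S_def E_def)
  have cmpH: "g \<cdot>\<^bsub>Mod\<^esub> f \<in> Hom Mod X Z"
    if "f \<in> Hom Mod X Y" "g \<in> Hom Mod Y Z" "X \<in> Ob Mod" "Y \<in> Ob Mod" "Z \<in> Ob Mod" for f g X Y Z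
    using Mod_comp_in_hom that by blast
  let ?inc = "\<lambda>b. if b then s else ?j" and ?pr = "\<lambda>b. if b then e else ?q"
  have "is_coproduct Mod UNIV (\<lambda>b. if b then M else Q) F ?inc"
    unfolding is_coproduct_def
  proof (intro conjI ballI allI impI)
    fix Y f assume Y: "Y \<in> Ob Mod" and "\<forall>b\<in>UNIV. f b \<in> Hom Mod (if b then M else Q) Y"
    then have f1: "f True \<in> Hom Mod M Y" and f2: "f False \<in> Hom Mod Q Y"
      by (metis UNIV_I)+
    let ?f = "cpt M Y (f True)" and ?g = "cpt Q Y (f False)"
    have fg: "natural M Y ?f" "natural Q Y ?g"
      using natural_cpt[OF f1 M Y] natural_cpt[OF f2 Q Y] .
    have [simp]: "\<guillemotleft>?f c : fob M c \<rightarrow> fob Y c\<guillemotright>" "\<guillemotleft>?g c : fob Q c \<rightarrow> fob Y c\<guillemotright>" if "c \<in> EOb C" for c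
      using natural_arr[OF fg(1) that] natural_arr[OF fg(2) that] by auto
    note [simp] = module_simps(1)[OF Y]
    \<comment> \<open>E and q are the projections of F onto M and Q, so this is the copairing of the
      two given morphisms.\<close>
    let ?h = "\<lambda>c. ?f c \<bullet> E c \<^bold>+ ?g c \<bullet> q c"
    have h: "mk_hom ?h \<in> Hom Mod F Y"
      by (intro natural_mk_hom natural_plus natural_cmp[OF E fg(1)] natural_cmp[OF q fg(2)] M F Q Y)
    have ch: "cpt F Y (mk_hom ?h) c = ?h c" if "c \<in> EOb C" for c
      using that by (simp add: cpt_mk_hom)
    have hs: "?h c \<bullet> S c = ?f c" "?h c \<bullet> j c = ?g c" if [simp]: "c \<in> EOb C" for c
      by (subst plus_cmp[of _ _ "fob F c" _ "fob Y c"]; simp)+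
    show "\<exists>!h. h \<in> Hom Mod F Y \<and> (\<forall>b\<in>UNIV. h \<cdot>\<^bsub>Mod\<^esub> ?inc b = f b)"
    proof (rule ex1I[of _ "mk_hom ?h"])
      have "mk_hom ?h \<cdot>\<^bsub>Mod\<^esub> s = f True"
        by (rule hom_eqI[OF cmpH[OF sH h M F Y] f1]) (simp add: cpt_comp[of _ _ _ _ _ F] ch hs)
      moreover have "mk_hom ?h \<cdot>\<^bsub>Mod\<^esub> ?j = f False"
        by (rule hom_eqI[OF cmpH[OF jH h Q F Y] f2]) (simp add: cpt_comp[of _ _ _ _ _ F] ch hs)
      ultimately show "mk_hom ?h \<in> Hom Mod F Y \<and> (\<forall>b\<in>UNIV. mk_hom ?h \<cdot>\<^bsub>Mod\<^esub> ?inc b = f b)"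
        using h by (simp add: all_bool_eq)
      fix h' assume "h' \<in> Hom Mod F Y \<and> (\<forall>b\<in>UNIV. h' \<cdot>\<^bsub>Mod\<^esub> ?inc b = f b)"
      then have h': "h' \<in> Hom Mod F Y" "h' \<cdot>\<^bsub>Mod\<^esub> s = f True" "h' \<cdot>\<^bsub>Mod\<^esub> ?j = f False"
        by (simp_all add: all_bool_eq)
      show "h' = mk_hom ?h"
      proof (rule hom_eqI[OF h'(1) h])
        fix c assume c [simp]: "c \<in> EOb C"
        let ?k = "cpt F Y h' c"
        have k [simp]: "arr ?k" by (rule hom_arr[OF h'(1) F Y c])
        have "?k \<bullet> S c = ?f c" "?k \<bullet> j c = ?g c"
          using cpt_comp[OF c, of M Y h' s F] cpt_comp[OF c, of Q Y h' ?j F] h'(2,3) by simp_all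
        \<comment> \<open>Uniqueness: k is recovered from k S and k j by means of 1 = j q + S
          E.\<close>
        then have "?h c = (?k \<bullet> S c) \<bullet> E c \<^bold>+ (?k \<bullet> j c) \<bullet> q c" by simp
        also have "\<dots> = (?k \<bullet> j c) \<bullet> q c \<^bold>+ (?k \<bullet> S c) \<bullet> E c"
          by (rule plus_commute[of _ "fob F c" "fob Y c"]) simp_all
        also have "\<dots> = ?k \<bullet> (d c \<^bold>+ S c \<bullet> E c)"
          by (subst cmp_plus[of _ "fob F c" "fob F c" _ _ "fob Y c"]) simp_all
        also have "\<dots> = ?k"
          by (subst dsum) simp_all
        finally show "?k = cpt F Y (mk_hom ?h) c" by (simp add: ch)
      qed
    qed
  qed (use M F Q sH jH in auto)
  moreover have "is_product Mod UNIV (\<lambda>b. if b then M else Q) F ?pr"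
    unfolding is_product_def
  proof (intro conjI ballI allI impI)
    fix Y f assume Y: "Y \<in> Ob Mod" and "\<forall>b\<in>UNIV. f b \<in> Hom Mod Y (if b then M else Q)"
    then have f1: "f True \<in> Hom Mod Y M" and f2: "f False \<in> Hom Mod Y Q"
      by (metis UNIV_I)+
    let ?f = "cpt Y M (f True)" and ?g = "cpt Y Q (f False)"
    have fg: "natural Y M ?f" "natural Y Q ?g"
      using natural_cpt[OF f1 Y M] natural_cpt[OF f2 Y Q] .
    have [simp]: "\<guillemotleft>?f c : fob Y c \<rightarrow> fob M c\<guillemotright>" "\<guillemotleft>?g c : fob Y c \<rightarrow> fob Q c\<guillemotright>" if "c \<in> EOb C" for c
      using natural_arr[OF fg(1) that] natural_arr[OF fg(2) that] by auto
    note [simp] = module_simps(1)[OF Y]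
    \<comment> \<open>Dually, S and j are the inclusions, and uniqueness again comes from 1 = j q +
      S E, now composed on the other side.\<close>
    let ?h = "\<lambda>c. S c \<bullet> ?f c \<^bold>+ j c \<bullet> ?g c"
    have h: "mk_hom ?h \<in> Hom Mod Y F"
      by (intro natural_mk_hom natural_plus natural_cmp[OF fg(1) S] natural_cmp[OF fg(2) j] M F Q Y)
    have ch: "cpt Y F (mk_hom ?h) c = ?h c" if "c \<in> EOb C" for c
      using that by (simp add: cpt_mk_hom)
    have eh: "E c \<bullet> ?h c = ?f c" "q c \<bullet> ?h c = ?g c" if [simp]: "c \<in> EOb C" for c
      by (subst cmp_plus[of _ "fob Y c" "fob F c"]; simp flip: cmp_assoc)+
    show "\<exists>!h. h \<in> Hom Mod Y F \<and> (\<forall>b\<in>UNIV. ?pr b \<cdot>\<^bsub>Mod\<^esub> h = f b)"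
    proof (rule ex1I[of _ "mk_hom ?h"])
      have "e \<cdot>\<^bsub>Mod\<^esub> mk_hom ?h = f True"
        by (rule hom_eqI[OF cmpH[OF h eH Y F M] f1]) (simp add: cpt_comp[of _ _ _ _ _ F] ch eh)
      moreover have "?q \<cdot>\<^bsub>Mod\<^esub> mk_hom ?h = f False"
        by (rule hom_eqI[OF cmpH[OF h qH Y F Q] f2]) (simp add: cpt_comp[of _ _ _ _ _ F] ch eh)
      ultimately show "mk_hom ?h \<in> Hom Mod Y F \<and> (\<forall>b\<in>UNIV. ?pr b \<cdot>\<^bsub>Mod\<^esub> mk_hom ?h = f b)"
        using h by (simp add: all_bool_eq)
      fix h' assume "h' \<in> Hom Mod Y F \<and> (\<forall>b\<in>UNIV. ?pr b \<cdot>\<^bsub>Mod\<^esub> h' = f b)"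
      then have h': "h' \<in> Hom Mod Y F" "e \<cdot>\<^bsub>Mod\<^esub> h' = f True" "?q \<cdot>\<^bsub>Mod\<^esub> h' = f False"
        by (simp_all add: all_bool_eq)
      show "h' = mk_hom ?h"
      proof (rule hom_eqI[OF h'(1) h])
        fix c assume c [simp]: "c \<in> EOb C"
        let ?k = "cpt Y F h' c"
        have k [simp]: "arr ?k" by (rule hom_arr[OF h'(1) Y F c])
        have Ek: "E c \<bullet> ?k = ?f c" "q c \<bullet> ?k = ?g c"
          using cpt_comp[OF c, of Y M e h' F] cpt_comp[OF c, of Y Q ?q h' F] h'(2,3) by simp_all
        have "?h c = S c \<bullet> E c \<bullet> ?k \<^bold>+ j c \<bullet> q c \<bullet> ?k"
          unfolding Ek ..
        also have "\<dots> = (j c \<bullet> q c) \<bullet> ?k \<^bold>+ (S c \<bullet> E c) \<bullet> ?k"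
          by (subst plus_commute[of _ "fob Y c" "fob F c"]) (simp_all del: jq)
        also have "\<dots> = (d c \<^bold>+ S c \<bullet> E c) \<bullet> ?k"
          by (subst plus_cmp[of _ "fob Y c" "fob F c" _ "fob F c"]) simp_all
        also have "\<dots> = ?k"
          by (subst dsum) simp_all
        finally show "?k = cpt Y F (mk_hom ?h) c" by (simp add: ch)
      qed
    qed
  qed (use M F Q eH qH in auto)
  moreover have "?q \<cdot>\<^bsub>Mod\<^esub> ?j = idm Mod Q"
    by (rule hom_eqI[OF cmpH[OF jH qH Q F Q] Mod_id_in_hom[OF Q]]) (simp add: cpt_comp[of _ _ _ _ _ F])
  moreover have "zero_arrow Mod M Q (?q \<cdot>\<^bsub>Mod\<^esub> s)"
    by (rule Mod_zero_arrow[OF M Q cmpH[OF sH qH M F Q]]) (simp add: cpt_comp[of _ _ _ _ _ F])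
  moreover have "zero_arrow Mod Q M (e \<cdot>\<^bsub>Mod\<^esub> ?j)"
    by (rule Mod_zero_arrow[OF Q M cmpH[OF jH eH Q F M]]) (simp add: cpt_comp[of _ _ _ _ _ F])
  ultimately have "is_biproduct Mod M Q F ?inc ?pr"
    using es by (simp add: is_biproduct_def)
  then show ?thesis
    unfolding direct_summand_def by blast
qed

lemma projective_Fr:
  assumes "\<And>c. c \<in> EOb C \<Longrightarrow> projective A (p c)" and "is_Fr A C p F"
  shows "projective Mod F"
proof -
  obtain inc where "is_coproduct Mod (EOb C) (\<lambda>c. tensor_rep A C (p c) c) F inc"
    using assms(2) by (auto simp: is_Fr_def)
  then show ?thesis
    by (rule category.projective_coproduct[OF category_Mod]) (rule projective_tensor_rep[OF assms(1)])
qed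

text \<open>Already the generator p c of the summand at c maps to M c by the chosen epimorphism, so
  morphisms out of M that agree after e agree in every component. Coproducts over
  \<open>EOb C\<close> are a hypothesis here in order to keep \<kappa> out of the locale.\<close>

lemma ex_epi_from_Fr:
  assumes cop: "\<And>X. (\<And>c. c \<in> EOb C \<Longrightarrow> X c \<in> Ob A) \<Longrightarrow> \<exists>P inc. is_coproduct A (EOb C) X P inc"
    and enough: "enough_projectives A" and M: "M \<in> Ob Mod"
  shows "\<exists>p F e. (\<forall>c\<in>EOb C. projective A (p c)) \<and> is_Fr A C p F \<and> is_epi Mod F M e"
proof -
  note [simp] = module_simps(1,2)[OF M]
  have "\<exists>p \<epsilon>. projective A p \<and> is_epi A p (fob M c) \<epsilon>" if "c \<in> EOb C" for c
    using enough that by (simp add: enough_projectives_def)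
  then obtain p \<epsilon> where p: "\<And>c. c \<in> EOb C \<Longrightarrow> projective A (p c)"
      and \<epsilon>: "\<And>c. c \<in> EOb C \<Longrightarrow> is_epi A (p c) (fob M c) (\<epsilon> c)"
    by metis
  have pO [simp]: "p c \<in> Ob A" if "c \<in> EOb C" for c
    using p[OF that] by (simp add: projective_def)
  have \<epsilon>' : "\<guillemotleft>Arrow (p c) (fob M c) (\<epsilon> c) : p c \<rightarrow> fob M c\<guillemotright>" if "c \<in> EOb C" for c
    using \<epsilon>[OF that] that unfolding is_epi_def by simp
  let ?T = "\<lambda>c. tensor_rep A C (p c) c"
  have T: "?T c \<in> Ob Mod" if "c \<in> EOb C" for c
    using tensor_rep(1) pO that by blast
  have "\<exists>F inc. is_coproduct Mod (EOb C) ?T F inc"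
  proof (rule Mod_coproduct[OF T])
    fix d assume "d \<in> EOb C"
    then show "\<exists>P inc. is_coproduct A (EOb C) (\<lambda>c. fob (?T c) d) P inc"
      by (intro cop) (simp add: tensor_rep(2))
  qed
  then obtain F inc where F: "is_coproduct Mod (EOb C) ?T F inc" by blast
  then have FO: "F \<in> Ob Mod" and inc: "\<And>c. c \<in> EOb C \<Longrightarrow> inc c \<in> Hom Mod (?T c) F"
    by (simp_all add: is_coproduct_def)
  let ?g = "\<lambda>c. rep_hom M c (Arrow (p c) (fob M c) (\<epsilon> c))"
  have g: "mk_hom (?g c) \<in> Hom Mod (?T c) M" if "c \<in> EOb C" for c
    using rep_hom[OF pO[OF that] that M \<epsilon>'[OF that]] .
  obtain e where e: "e \<in> Hom Mod F M" "\<And>c. c \<in> EOb C \<Longrightarrow> e \<cdot>\<^bsub>Mod\<^esub> inc c = mk_hom (?g c)"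
  proof -
    have "\<exists>!h. h \<in> Hom Mod F M \<and> (\<forall>c\<in>EOb C. h \<cdot>\<^bsub>Mod\<^esub> inc c = mk_hom (?g c))"
      using F M g by (simp add: is_coproduct_def)
    then show thesis using that by blast
  qed
  have "is_epi Mod F M e"
    unfolding is_epi_def
  proof (intro conjI ballI impI)
    fix Z u v
    assume Z: "Z \<in> Ob Mod" and u: "u \<in> Hom Mod M Z" and v: "v \<in> Hom Mod M Z"
      and eq: "u \<cdot>\<^bsub>Mod\<^esub> e = v \<cdot>\<^bsub>Mod\<^esub> e"
    note [simp] = module_simps(1,2)[OF Z] module_simps(1,2)[OF FO] hom_arr[OF u M Z] hom_arr[OF v M Z]
      hom_arr[OF e(1) FO M] hom_arr[OF inc T FO]
    show "u = v"
    proof (rule hom_eqI[OF u v])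
      fix c assume c [simp]: "c \<in> EOb C"
      \<comment> \<open>The generator p c, included into F c by way of the summand at c. The
        component of e carries it to the chosen epimorphism onto M c.\<close>
      let ?i = "cpt (?T c) F (inc c) c \<bullet> rep_unit (p c) c" and ?e = "cpt F M e c"
      have i [simp]: "\<guillemotleft>?i : p c \<rightarrow> fob F c\<guillemotright>"
        by (simp add: tensor_rep(2))
      have "?e \<bullet> ?i = cpt (?T c) M (e \<cdot>\<^bsub>Mod\<^esub> inc c) c \<bullet> rep_unit (p c) c"
        by (simp add: cpt_comp[of _ _ _ _ _ F] tensor_rep(2))
      also have "\<dots> = ?g c c \<bullet> rep_unit (p c) c"
        using rep_hom_arr[OF pO[OF c] c M \<epsilon>'[OF c] c] by (simp add: e(2) cpt_mk_hom tensor_rep(2))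
      also have "\<dots> = Arrow (p c) (fob M c) (\<epsilon> c)"
        by (rule rep_hom_unit[OF pO[OF c] c M \<epsilon>'[OF c]])
      finally have ei: "?e \<bullet> ?i = Arrow (p c) (fob M c) (\<epsilon> c)" .
      have "cpt F Z (u \<cdot>\<^bsub>Mod\<^esub> e) c = cpt F Z (v \<cdot>\<^bsub>Mod\<^esub> e) c"
        using eq by simp
      then have "cpt M Z u c \<bullet> ?e = cpt M Z v c \<bullet> ?e"
        by (simp add: cpt_comp[of _ _ _ _ _ M])
      then have "(cpt M Z u c \<bullet> ?e) \<bullet> ?i = (cpt M Z v c \<bullet> ?e) \<bullet> ?i"
        by (rule arg_cong)
      moreover have "(w \<bullet> ?e) \<bullet> ?i = w \<bullet> Arrow (p c) (fob M c) (\<epsilon> c)"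
        if "arr w" "src w = fob M c" for w
        unfolding ei[symmetric] using that by (intro cmp_assoc) simp_all
      ultimately have "cpt M Z u c \<bullet> Arrow (p c) (fob M c) (\<epsilon> c) = cpt M Z v c \<bullet> Arrow (p c) (fob M c) (\<epsilon> c)"
        by simp
      then show "cpt M Z u c = cpt M Z v c"
        by (rule epi_arrow[OF \<epsilon>[OF c], where Z = "fob Z c", rotated -1]) simp_all
    qed
  qed (rule e(1))
  moreover have "is_Fr A C p F"
    using F by (auto simp: is_Fr_def)
  ultimately show ?thesis using p by blast
qed

end

theorem proposition3p6:
  fixes \<kappa> :: "'u rel"
    and A :: "('o, 'm) smc_cat"
    and C :: "('c, 'o, 'm) enr_cat"
  assumes "Cinfinite \<kappa>"
    and "abelian_benabou_cosmos \<kappa> A"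
    and "small_enriched_category \<kappa> A C"
    and "enough_projectives A"
  shows "enough_projectives (ModCat A C) \<and>
    (\<forall>M \<in> Ob (ModCat A C). projective (ModCat A C) M \<longleftrightarrow>
      (\<exists>p F. (\<forall>c \<in> EOb C. projective A (p c)) \<and> is_Fr A C p F \<and>
        direct_summand (ModCat A C) M F))"
proof -
  have smc: "symmetric_monoidal_closed_category A" and cocomp: "cocomplete \<kappa> A"
    and ab: "abelian_category A" and enr: "enriched_category A C" and small: "small \<kappa> (EOb C)"
    using assms(2,3)
    by (simp_all add: abelian_benabou_cosmos_def benabou_cosmos_def small_enriched_category_def)
  obtain add zero where add: "preadditive A add zero"
    using abelian_category.ex_preadditive[OF ab] by blast
  \<comment> \<open>The additive structure is an arbitrary choice, which the theorem does not
    mention.\<close>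
  interpret abelian_modules A C add zero
    using smc ab enr add abelian_category.ex_zero_object[OF ab]
    by (simp add: abelian_modules_def enriched_modules_def preadditive_closed_def preadditive_category_def
        preadditive_category_axioms_def abelian_category_def)
  have Fr: "\<exists>p F e. (\<forall>c\<in>EOb C. projective A (p c)) \<and> is_Fr A C p F \<and> is_epi Mod F M e"
    if "M \<in> Ob Mod" for M
    using cocomplete_coproduct[OF assms(1) _ cocomp small] category_axioms assms(4) that
    by (intro ex_epi_from_Fr) auto
  have FO: "F \<in> Ob Mod" if "is_Fr A C p F" for p F
    using that by (auto simp: is_Fr_def is_coproduct_def)
  have "enough_projectives Mod"
    unfolding enough_projectives_def using Fr projective_Fr by blast
  moreover have "projective Mod M \<longleftrightarrow>
      (\<exists>p F. (\<forall>c\<in>EOb C. projective A (p c)) \<and> is_Fr A C p F \<and> direct_summand Mod M F)"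
    if M: "M \<in> Ob Mod" for M
  proof
    assume proj: "projective Mod M"
    obtain p F e where F: "\<forall>c\<in>EOb C. projective A (p c)" "is_Fr A C p F" "is_epi Mod F M e"
      using Fr[OF M] by blast
    then have e: "e \<in> Hom Mod F M" by (simp add: is_epi_def)
    \<comment> \<open>The lift of the identity of M along e is a section of e.\<close>
    obtain s where "s \<in> Hom Mod M F" "e \<cdot>\<^bsub>Mod\<^esub> s = idm Mod M"
      using proj F(3) FO[OF F(2)] M Mod_id_in_hom[OF M] unfolding projective_def by blast
    then have "direct_summand Mod M F"
      using Mod_direct_summand[OF M FO[OF F(2)] _ e] by blast
    then show "\<exists>p F. (\<forall>c\<in>EOb C. projective A (p c)) \<and> is_Fr A C p F \<and> direct_summand Mod M F"
      using F by blast
  next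
    assume "\<exists>p F. (\<forall>c\<in>EOb C. projective A (p c)) \<and> is_Fr A C p F \<and> direct_summand Mod M F"
    then obtain p F Q inc pr where "\<forall>c\<in>EOb C. projective A (p c)" "is_Fr A C p F"
      and bi: "is_biproduct Mod M Q F inc pr"
      by (auto simp: direct_summand_def)
    then have "projective Mod F" by (blast intro: projective_Fr)
    moreover have "inc True \<in> Hom Mod M F" "pr True \<in> Hom Mod F M" "pr True \<cdot>\<^bsub>Mod\<^esub> inc True = idm Mod M"
      using bi by (simp_all add: is_biproduct_def is_coproduct_def is_product_def all_bool_eq)
    ultimately show "projective Mod M"
      using category.projective_retract[OF category_Mod] M by blast
  qed
  ultimately show ?thesis by blast
qed

end
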